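(* Let $D$ be a 2-dimensional regular local ring and assume that $X=\operatorname{Proj} D[Jt]$ is a nonsingular projective model over $D$. Let $b\in J$ be part of a minimal set of generators of $J$ and let $A=D[J/b]$ be the associated affine component of $\operatorname{Proj} D[Jt]$. Then $A$ is a regular Noetherian domain. Let $\mathcal U\subset Q(D)$ denote the set of closed points of $X$ that contain $A$, and let $B=\mathcal O_{\mathcal U}=\bigcap_{\alpha\in\mathcal U}\alpha$. Then: (1) Each $\alpha\in\mathcal U$ is a localization of $A$ at a height 2 maximal ideal. (2) $A_{\mathfrak m}\in\mathcal U$ and $A_{\mathfrak m}=B_{(\mathfrak mA_{\mathfrak m}\cap B)}$ for each height 2 maximal ideal $\mathfrak m$ of $A$. (3) $\mathcal U$ defines an essential representation of $\mathcal O_{\mathcal U}$. (4) If $\mathfrak q$ is a maximal ideal of $B$, then $\operatorname{ht}\mathfrak q=2$ and $B_{\mathfrak q}=A_{\mathfrak q\cap A}$. (5) $\mathcal O_{\mathcal U}=B$ is a flat overring of $A$.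
   Context: $D$ is a 2-dimensional regular local ring with quotient field $F$ and maximal ideal $\mathfrak m_D$. For a 2-dimensional regular local ring $S$ with maximal ideal $\mathfrak m_S$, a local quadratic transform of $S$ is a localization of $S[\mathfrak m_S/a]$ (with $a\in\mathfrak m_S\setminus\mathfrak m_S^2$) at a height 2 maximal ideal. $Q(D)$ is the set of all rings obtained from $D$ by a finite (possibly zero) number of successive local quadratic transforms; it is the set of all 2-dimensional regular local rings with quotient field $F$ that dominate $D$. An overring of a domain is a ring between it and its quotient field. A projective model over $D$ is $\operatorname{Proj} D[Jt]$ for an $\mathfrak m_D$-primary ideal $J=(a_0,\ldots,a_n)D$ with all $a_i\ne 0$, identified with the set of all local rings $(A_i)_{\mathfrak p}$, $\mathfrak p\in\operatorname{Spec}A_i$, where $A_i=D[a_0/a_i,\ldots,a_n/a_i]=D[J/a_i]$. It is nonsingular if each of these local rings is regular. Its closed points are the local rings in it of dimension 2; for a nonsingular projective model over $D$ these belong to $Q(D)$. For a subset $\mathcal U$ of $Q(D)$, $\mathcal O_{\mathcal U}=\bigcap_{\alpha\in\mathcal U}\alpha$, and $\mathcal U$ defines an essential representation of $\mathcal O_{\mathcal U}$ if each $\alpha\in\mathcal U$ is a localization of $\mathcal O_{\mathcal U}$.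
   Formalization: Part (4) is stated only when U is nonempty; U can be empty (e.g. J=(x^10,x^9y,xy^9,y^10,x^5y^6), b=x^5y^6, where A=D[1/(xy)]), and then B=F has maximal ideal 0 of height 0, so (4) fails. *)

theory Defs
  imports "HOL-Algebra.Algebra" "HOL-Library.Extended_Nat"
begin

text \<open>
  All rings other than the modules below live inside a fixed field \<open>F\<close>: a subring is given by its
  underlying set \<open>R\<close>, and the ring structure on it is \<open>F\<lparr>carrier := R\<rparr>\<close>.
\<close>

section \<open>Dimension and regularity\<close>

definition prime_chain :: "('a, 'm) ring_scheme \<Rightarrow> 'a set list \<Rightarrow> bool" where
  "prime_chain R ps \<longleftrightarrow> ps \<noteq> [] \<and> (\<forall>p \<in> set ps. primeideal p R) \<and> sorted_wrt (\<subset>) ps"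

definition krull_dim :: "('a, 'm) ring_scheme \<Rightarrow> enat" where
  "krull_dim R = (SUP ps \<in> {ps. prime_chain R ps}. enat (length ps - 1))"

definition height :: "('a, 'm) ring_scheme \<Rightarrow> 'a set \<Rightarrow> enat" where
  "height R p = (SUP ps \<in> {ps. prime_chain R ps \<and> last ps = p}. enat (length ps - 1))"

definition local_ring :: "('a, 'm) ring_scheme \<Rightarrow> bool" where
  "local_ring R \<longleftrightarrow> cring R \<and> (\<exists>!M. maximalideal M R)"

definition max_ideal :: "('a, 'm) ring_scheme \<Rightarrow> 'a set" where
  "max_ideal R = (THE M. maximalideal M R)"

definition regular_local_ring :: "('a, 'm) ring_scheme \<Rightarrow> bool" where
  "regular_local_ring R \<longleftrightarrow> local_ring R \<and> noetherian_ring R \<and>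
     (\<exists>G \<subseteq> carrier R. finite G \<and> enat (card G) = krull_dim R \<and> genideal R G = max_ideal R)"

section \<open>Ideals\<close>

definition ideal_radical :: "('a, 'm) ring_scheme \<Rightarrow> 'a set \<Rightarrow> 'a set" where
  "ideal_radical R J = {x \<in> carrier R. \<exists>k::nat. x [^]\<^bsub>R\<^esub> k \<in> J}"

text \<open>\<open>J\<close> is \<open>P\<close>-primary: a proper primary ideal with radical \<open>P\<close>.\<close>

definition primary_to :: "('a, 'm) ring_scheme \<Rightarrow> 'a set \<Rightarrow> 'a set \<Rightarrow> bool" where
  "primary_to R P J \<longleftrightarrow> ideal J R \<and> J \<noteq> carrier R \<and>
     (\<forall>x \<in> carrier R. \<forall>y \<in> carrier R. x \<otimes>\<^bsub>R\<^esub> y \<in> J \<longrightarrow> x \<in> J \<or> y \<in> ideal_radical R J) \<and>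
     ideal_radical R J = P"

definition minimal_generating_set :: "('a, 'm) ring_scheme \<Rightarrow> 'a set \<Rightarrow> 'a set \<Rightarrow> bool" where
  "minimal_generating_set R J G \<longleftrightarrow>
     G \<subseteq> carrier R \<and> genideal R G = J \<and> (\<forall>H. H \<subset> G \<longrightarrow> genideal R H \<noteq> J)"

section \<open>Localizations and overrings inside the field\<close>

definition localization :: "('a, 'm) ring_scheme \<Rightarrow> 'a set \<Rightarrow> 'a set \<Rightarrow> 'a set" where
  "localization F R S = {x \<otimes>\<^bsub>F\<^esub> inv\<^bsub>F\<^esub> s | x s. x \<in> R \<and> s \<in> S}"

definition localization_at :: "('a, 'm) ring_scheme \<Rightarrow> 'a set \<Rightarrow> 'a set \<Rightarrow> 'a set" where
  "localization_at F R p = localization F R (R - p)"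

definition is_localization_of :: "('a, 'm) ring_scheme \<Rightarrow> 'a set \<Rightarrow> 'a set \<Rightarrow> bool" where
  "is_localization_of F T R \<longleftrightarrow>
     (\<exists>S. submonoid S (F\<lparr>carrier := R\<rparr>) \<and> \<zero>\<^bsub>F\<^esub> \<notin> S \<and> T = localization F R S)"

definition quotient_field :: "('a, 'm) ring_scheme \<Rightarrow> 'a set \<Rightarrow> 'a set" where
  "quotient_field F R = localization F R (R - {\<zero>\<^bsub>F\<^esub>})"

definition overring :: "('a, 'm) ring_scheme \<Rightarrow> 'a set \<Rightarrow> 'a set \<Rightarrow> bool" where
  "overring F R T \<longleftrightarrow> subring T F \<and> R \<subseteq> T \<and> T \<subseteq> quotient_field F R"

definition regular_domain :: "('a, 'm) ring_scheme \<Rightarrow> 'a set \<Rightarrow> bool" where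
  "regular_domain F R \<longleftrightarrow> domain (F\<lparr>carrier := R\<rparr>) \<and> noetherian_ring (F\<lparr>carrier := R\<rparr>) \<and>
     (\<forall>p. primeideal p (F\<lparr>carrier := R\<rparr>) \<longrightarrow>
        regular_local_ring (F\<lparr>carrier := localization_at F R p\<rparr>))"

text \<open>
  \<open>\<O>\<^sub>U\<close>, the intersection of the members of \<open>U\<close>. It is taken inside \<open>F\<close>, so that the
  intersection of the empty family is \<open>F\<close> itself (and not the whole type).
\<close>

definition intersection_ring :: "('a, 'm) ring_scheme \<Rightarrow> 'a set set \<Rightarrow> 'a set" where
  "intersection_ring F U = carrier F \<inter> \<Inter>U"

definition essential_representation :: "('a, 'm) ring_scheme \<Rightarrow> 'a set set \<Rightarrow> bool" where
  "essential_representation F U \<longleftrightarrow>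
     (\<forall>\<alpha> \<in> U. is_localization_of F \<alpha> (intersection_ring F U))"

section \<open>Projective models\<close>

text \<open>The ring \<open>D[J/b]\<close>.\<close>

definition affine_component :: "('a, 'm) ring_scheme \<Rightarrow> 'a set \<Rightarrow> 'a set \<Rightarrow> 'a \<Rightarrow> 'a set" where
  "affine_component F D J b = generate_ring F (D \<union> {c \<otimes>\<^bsub>F\<^esub> inv\<^bsub>F\<^esub> b | c. c \<in> J})"

text \<open>
  \<open>Proj D[Jt]\<close> for \<open>J = (a\<^sub>0, \<dots>, a\<^sub>n)D\<close>, as the set of the local rings of its affine pieces
  \<open>D[J/a\<^sub>i]\<close>.
\<close>

definition proj_model :: "('a, 'm) ring_scheme \<Rightarrow> 'a set \<Rightarrow> nat \<Rightarrow> (nat \<Rightarrow> 'a) \<Rightarrow> 'a set set" where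
  "proj_model F D n a =
     (let J = genideal (F\<lparr>carrier := D\<rparr>) (a ` {..n}) in
       {localization_at F (affine_component F D J (a i)) p | i p.
          i \<le> n \<and> primeideal p (F\<lparr>carrier := affine_component F D J (a i)\<rparr>)})"

definition nonsingular_model :: "('a, 'm) ring_scheme \<Rightarrow> 'a set set \<Rightarrow> bool" where
  "nonsingular_model F V \<longleftrightarrow> (\<forall>\<alpha> \<in> V. regular_local_ring (F\<lparr>carrier := \<alpha>\<rparr>))"

definition closed_points :: "('a, 'm) ring_scheme \<Rightarrow> 'a set set \<Rightarrow> 'a set set" where
  "closed_points F V = {\<alpha> \<in> V. krull_dim (F\<lparr>carrier := \<alpha>\<rparr>) = 2}"

section \<open>Tensor products and flatness\<close>

definition module_hom ::
    "('a, 'm) ring_scheme \<Rightarrow> ('a, 'n) module \<Rightarrow> ('a, 'k) module \<Rightarrow> ('n \<Rightarrow> 'k) set" where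
  "module_hom R N N' = {f \<in> hom (add_monoid N) (add_monoid N').
     \<forall>r \<in> carrier R. \<forall>x \<in> carrier N. f (r \<odot>\<^bsub>N\<^esub> x) = r \<odot>\<^bsub>N'\<^esub> f x}"

text \<open>
  The abelian group \<open>N \<otimes>\<^sub>R M\<close> is the free abelian group on the pairs \<open>(x, y)\<close>, written additively
  as finitely supported integer functions, modulo the subgroup making the pairing bilinear and
  balanced.
\<close>

definition tensor_relations ::
    "('a, 'm) ring_scheme \<Rightarrow> ('a, 'n) module \<Rightarrow> ('a, 'b) module \<Rightarrow> (('n \<times> 'b) \<Rightarrow>\<^sub>0 int) set" where
  "tensor_relations R N M = generate (free_Abelian_group (carrier N \<times> carrier M))
     ({frag_of (x \<oplus>\<^bsub>N\<^esub> x', y) - frag_of (x, y) - frag_of (x', y) | x x' y.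
         x \<in> carrier N \<and> x' \<in> carrier N \<and> y \<in> carrier M} \<union>
      {frag_of (x, y \<oplus>\<^bsub>M\<^esub> y') - frag_of (x, y) - frag_of (x, y') | x y y'.
         x \<in> carrier N \<and> y \<in> carrier M \<and> y' \<in> carrier M} \<union>
      {frag_of (r \<odot>\<^bsub>N\<^esub> x, y) - frag_of (x, r \<odot>\<^bsub>M\<^esub> y) | r x y.
         r \<in> carrier R \<and> x \<in> carrier N \<and> y \<in> carrier M})"

definition tensor_product ::
    "('a, 'm) ring_scheme \<Rightarrow> ('a, 'n) module \<Rightarrow> ('a, 'b) module \<Rightarrow> (('n \<times> 'b) \<Rightarrow>\<^sub>0 int) set monoid" where
  "tensor_product R N M =
     free_Abelian_group (carrier N \<times> carrier M) Mod tensor_relations R N M"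

text \<open>
  The map \<open>f \<otimes> id : N \<otimes>\<^sub>R M \<rightarrow> N' \<otimes>\<^sub>R M\<close>, sending the class of a formal sum of pairs \<open>(x, y)\<close> to the
  class of the formal sum of the pairs \<open>(f x, y)\<close>.
\<close>

definition tensor_map ::
    "('a, 'm) ring_scheme \<Rightarrow> ('a, 'k) module \<Rightarrow> ('a, 'b) module \<Rightarrow> ('n \<Rightarrow> 'k) \<Rightarrow>
       (('n \<times> 'b) \<Rightarrow>\<^sub>0 int) set \<Rightarrow> (('k \<times> 'b) \<Rightarrow>\<^sub>0 int) set" where
  "tensor_map R N' M f =
     (\<lambda>C. the_elem ((\<lambda>c. tensor_relations R N' M
                          #>\<^bsub>free_Abelian_group (carrier N' \<times> carrier M)\<^esub>
                          frag_extend (\<lambda>(x, y). frag_of (f x, y)) c) ` C))"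

text \<open>
  Flatness: tensoring with \<open>M\<close> preserves injectivity of homomorphisms. HOL cannot quantify over
  types inside a formula, so the element types of the test modules are parameters; they are to
  be left as type variables, hence arbitrary, wherever flatness is asserted.
\<close>

definition flat_module ::
    "'n itself \<Rightarrow> 'k itself \<Rightarrow> ('a, 'm) ring_scheme \<Rightarrow> ('a, 'b) module \<Rightarrow> bool" where
  "flat_module tn tk R M \<longleftrightarrow> module R M \<and>
     (\<forall>(N :: ('a, 'n) module) (N' :: ('a, 'k) module) f.
        module R N \<and> module R N' \<and> f \<in> module_hom R N N' \<and> inj_on f (carrier N) \<longrightarrow>
        inj_on (tensor_map R N' M f) (carrier (tensor_product R N M)))"

text \<open>A subset \<open>B\<close> of \<open>F\<close>, with the action of a subring by multiplication in \<open>F\<close>.\<close>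

definition subset_module :: "('a, 'm) ring_scheme \<Rightarrow> 'a set \<Rightarrow> ('a, 'a) module" where
  "subset_module F B = \<lparr>carrier = B, monoid.mult = monoid.mult F, one = one F,
     ring.zero = ring.zero F, ring.add = ring.add F, smult = monoid.mult F\<rparr>"

end

theory Submission
  imports Defs
begin

text \<open>
  Every local ring \<open>A\<^sub>P\<close> of the chart \<open>A = D[J/b]\<close> lies on the model, because \<open>J A = b A\<close> forces some
  \<open>a\<^sub>i/b\<close> to be outside \<open>P\<close>; hence \<open>A\<close> is regular. The essential point is that primes of \<open>A\<close> have height
  at most two. Given nonzero primes \<open>P\<^sub>1 \<subset> P\<^sub>2 \<subset> P\<^sub>3\<close>, pick \<open>z\<^sub>2 \<in> P\<^sub>2 - P\<^sub>1\<close> and \<open>z\<^sub>3 \<in> P\<^sub>3 - P\<^sub>2\<close>.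
  An ideal of \<open>D\<close> containing an element of order \<open>s\<close> modulo a regular parameter is generated by \<open>s + 1\<close>
  elements; applied to \<open>b\<^sup>n A \<inter> D\<close>, whose order grows linearly in \<open>n\<close>, this yields a nontrivial
  relation between the quadratically many monomials \<open>z\<^sub>2\<^sup>i z\<^sub>3\<^sup>j\<close> over the residue field of \<open>D\<close>, and its
  lexicographically first term gives a contradiction. (If \<open>b \<notin> P\<^sub>1\<close>, the same argument modulo \<open>P\<^sub>1\<close>, where the
  orders stay bounded, applies to the powers of \<open>z\<^sub>3\<close>.)

  Consequently a maximal ideal \<open>N\<close> of \<open>A\<close> not of height two is zero or invertible of height one, and in the
  latter case \<open>N\<inverse> \<subseteq> B\<close>, so that \<open>N B = B\<close>. It follows that for every prime \<open>q\<close> of \<open>B\<close> the denominators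
  of an element of \<open>B\<close> are not all in \<open>q\<close>, that is \<open>B\<^sub>q = A\<^bsub>q \<inter> A\<^esub>\<close>; this gives the statements about \<open>B\<close>,
  and flatness because a relation in \<open>N \<otimes> B\<close> can be tested after clearing denominators locally on \<open>B\<close>.
\<close>

section \<open>Ideals of subrings of a field\<close>

text \<open>The linear growth of orders comes from \<open>J\<close> being primary to the maximal
  ideal: some power \<open>y^c\<close> lies in \<open>J\<close>, hence in \<open>b A\<close>, so
  \<open>y^(c n)\<close> lies in \<open>b^n A \<inter> D\<close>. Quotient rings are avoided
  throughout. A linear dependence over the residue field of \<open>D\<close> is a family of
  coefficients in \<open>D\<close>, one of them outside the maximal ideal; an element of order
  \<open>t\<close> modulo \<open>x\<close> is one of the form \<open>y^t + x h\<close>, and Krull's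
  intersection theorem takes care of the elements that have no finite order. Localizations are
  subsets of \<open>F\<close> described by the denominators they admit, so that primes of
  \<open>A\<close>, of \<open>B\<close> and of different charts can be compared by intersecting
  sets. The obstacle on the side of \<open>B\<close> is that no finiteness of \<open>B\<close> over
  \<open>A\<close> is available. Its primes are therefore known only through their contractions to
  \<open>A\<close>, and each statement about \<open>B\<close> is reduced to finding, for a given
  prime, a denominator in \<open>A\<close> outside of it.\<close>

context field
begin

abbreviation sub :: "'a set \<Rightarrow> ('a, 'b) ring_scheme" where
  "sub A \<equiv> R\<lparr>carrier := A\<rparr>"

lemma field_inv:
  assumes "s \<in> carrier R" "s \<noteq> \<zero>"
  shows "inv s \<in> carrier R" "s \<otimes> inv s = \<one>" "inv s \<otimes> s = \<one>" "inv s \<noteq> \<zero>"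
proof -
  have "s \<in> Units R" using assms field_Units by auto
  then show "inv s \<in> carrier R" "s \<otimes> inv s = \<one>" "inv s \<otimes> s = \<one>" by auto
  then show "inv s \<noteq> \<zero>" using assms(1) by (metis r_null one_not_zero)
qed

lemma eq_mult_inv_iff:
  assumes "x \<in> carrier R" "y \<in> carrier R" "s \<in> carrier R" "s \<noteq> \<zero>"
  shows "x = y \<otimes> inv s \<longleftrightarrow> s \<otimes> x = y"
proof -
  note i = field_inv[OF assms(3,4)]
  show ?thesis
  proof
    assume "x = y \<otimes> inv s"
    then show "s \<otimes> x = y" using i assms by (metis m_assoc m_comm r_one)
  next
    assume "s \<otimes> x = y"
    then show "x = y \<otimes> inv s" using i assms by (metis m_assoc m_comm r_one)
  qed
qed

lemma subring_closed:
  assumes "subring A R"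
  shows "\<And>x. x \<in> A \<Longrightarrow> x \<in> carrier R" "\<zero> \<in> A" "\<one> \<in> A" "\<And>x. x \<in> A \<Longrightarrow> \<ominus> x \<in> A"
    "\<And>x y. x \<in> A \<Longrightarrow> y \<in> A \<Longrightarrow> x \<otimes> y \<in> A" "\<And>x y. x \<in> A \<Longrightarrow> y \<in> A \<Longrightarrow> x \<oplus> y \<in> A"
    "\<And>x y. x \<in> A \<Longrightarrow> y \<in> A \<Longrightarrow> x \<ominus> y \<in> A" "\<And>x k::nat. x \<in> A \<Longrightarrow> x [^] k \<in> A"
proof -
  note e = subringE[OF assms]
  show "\<And>x. x \<in> A \<Longrightarrow> x \<in> carrier R" "\<zero> \<in> A" "\<one> \<in> A" "\<And>x. x \<in> A \<Longrightarrow> \<ominus> x \<in> A"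
    "\<And>x y. x \<in> A \<Longrightarrow> y \<in> A \<Longrightarrow> x \<otimes> y \<in> A" "\<And>x y. x \<in> A \<Longrightarrow> y \<in> A \<Longrightarrow> x \<oplus> y \<in> A"
    "\<And>x y. x \<in> A \<Longrightarrow> y \<in> A \<Longrightarrow> x \<ominus> y \<in> A"
    using e by (auto simp: a_minus_def)
  show "x [^] k \<in> A" if "x \<in> A" for x and k :: nat
    using that e by (induction k) auto
qed

lemma sub_cring: "subring A R \<Longrightarrow> cring (sub A)"
  using subcring_iff[OF subringE(1)] subcringI' by blast

lemma sub_ring: "subring A R \<Longrightarrow> ring (sub A)"
  by (rule subring_is_ring)

lemma sub_a_inv:
  assumes "subring A R" "x \<in> A"
  shows "\<ominus>\<^bsub>sub A\<^esub> x = \<ominus> x"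
proof -
  interpret A: ring "sub A" by (rule sub_ring[OF assms(1)])
  note c[simp] = subring_closed[OF assms(1)]
  have "\<ominus> x \<in> carrier (sub A)" "x \<in> carrier (sub A)" "x \<oplus>\<^bsub>sub A\<^esub> (\<ominus> x) = \<zero>\<^bsub>sub A\<^esub>"
    using assms c by (auto simp: r_neg)
  then show ?thesis by (metis A.minus_equality A.a_comm)
qed

lemma sub_nat_pow: "x [^]\<^bsub>sub A\<^esub> (k::nat) = x [^] k"
  by (induction k) (auto simp: nat_pow_def)

lemma ideal_sub_iff:
  assumes "subring A R"
  shows "ideal I (sub A) \<longleftrightarrow> I \<subseteq> A \<and> \<zero> \<in> I \<and> (\<forall>x\<in>I. \<forall>y\<in>I. x \<oplus> y \<in> I) \<and> (\<forall>a\<in>A. \<forall>x\<in>I. a \<otimes> x \<in> I)"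
    (is "_ \<longleftrightarrow> ?r")
proof
  interpret A: cring "sub A" by (rule sub_cring[OF assms])
  note c[simp] = subring_closed[OF assms]
  assume "ideal I (sub A)"
  then interpret I: ideal I "sub A" .
  show ?r using I.Icarr I.zero_closed I.a_closed I.I_l_closed by auto
next
  interpret A: cring "sub A" by (rule sub_cring[OF assms])
  note c[simp] = subring_closed[OF assms]
  assume r: ?r
  have n: "\<ominus> x \<in> I" if "x \<in> I" for x
  proof -
    have "\<ominus> \<one> \<in> A" using c by blast
    then have "\<ominus> \<one> \<otimes> x \<in> I" using r that by blast
    moreover have "\<ominus> \<one> \<otimes> x = \<ominus> x" using c r that by (simp add: l_minus subset_iff)
    ultimately show ?thesis by simp
  qed
  show "ideal I (sub A)"
  proof (rule idealI)
    show "ring (sub A)" by (rule A.ring_axioms)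
    show "subgroup I (add_monoid (sub A))"
    proof (rule A.add.subgroupI)
      show "I \<subseteq> carrier (sub A)" using r by auto
      show "I \<noteq> {}" using r by auto
      show "\<ominus>\<^bsub>sub A\<^esub> x \<in> I" if "x \<in> I" for x
        using sub_a_inv[OF assms] r n that by auto
      show "x \<oplus>\<^bsub>sub A\<^esub> y \<in> I" if "x \<in> I" "y \<in> I" for x y using r that by auto
    qed
    show "x \<otimes>\<^bsub>sub A\<^esub> a \<in> I" if "a \<in> I" "x \<in> carrier (sub A)" for a x using r that by auto
    show "a \<otimes>\<^bsub>sub A\<^esub> x \<in> I" if "a \<in> I" "x \<in> carrier (sub A)" for a x
    proof -
      have "a \<otimes> x = x \<otimes> a" using r that c by (auto simp: m_comm)
      then show ?thesis using r that by auto
    qed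
  qed
qed

lemma ideal_subD:
  assumes "subring A R" "ideal I (sub A)"
  shows "I \<subseteq> A" "\<And>x. x \<in> I \<Longrightarrow> x \<in> A" "\<And>x. x \<in> I \<Longrightarrow> x \<in> carrier R" "\<zero> \<in> I"
    "\<And>x y. x \<in> I \<Longrightarrow> y \<in> I \<Longrightarrow> x \<oplus> y \<in> I"
    "\<And>a x. a \<in> A \<Longrightarrow> x \<in> I \<Longrightarrow> a \<otimes> x \<in> I" "\<And>a x. a \<in> A \<Longrightarrow> x \<in> I \<Longrightarrow> x \<otimes> a \<in> I"
    "\<And>x. x \<in> I \<Longrightarrow> \<ominus> x \<in> I" "\<And>x y. x \<in> I \<Longrightarrow> y \<in> I \<Longrightarrow> x \<ominus> y \<in> I"
proof -
  note c[simp] = subring_closed[OF assms(1)]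
  note r = assms(2)[unfolded ideal_sub_iff[OF assms(1)]]
  show 1: "I \<subseteq> A" "\<And>x. x \<in> I \<Longrightarrow> x \<in> A" "\<And>x. x \<in> I \<Longrightarrow> x \<in> carrier R" "\<zero> \<in> I"
    "\<And>x y. x \<in> I \<Longrightarrow> y \<in> I \<Longrightarrow> x \<oplus> y \<in> I"
    "\<And>a x. a \<in> A \<Longrightarrow> x \<in> I \<Longrightarrow> a \<otimes> x \<in> I" using r by (auto dest: subsetD)
  show "\<And>a x. a \<in> A \<Longrightarrow> x \<in> I \<Longrightarrow> x \<otimes> a \<in> I" by (metis 1(3,6) c(1) m_comm)
  show 2: "\<ominus> x \<in> I" if "x \<in> I" for x
  proof -
    have "\<ominus> \<one> \<otimes> x \<in> I" by (rule 1(6)) (simp_all add: that)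
    moreover have "\<ominus> \<one> \<otimes> x = \<ominus> x" using 1(3)[OF that] by (simp add: l_minus)
    ultimately show ?thesis by simp
  qed
  show "\<And>x y. x \<in> I \<Longrightarrow> y \<in> I \<Longrightarrow> x \<ominus> y \<in> I" by (simp add: a_minus_def 1(5) 2)
qed

lemma ideal_subI:
  assumes "subring A R" "I \<subseteq> A" "\<zero> \<in> I" "\<And>x y. x \<in> I \<Longrightarrow> y \<in> I \<Longrightarrow> x \<oplus> y \<in> I"
    "\<And>a x. a \<in> A \<Longrightarrow> x \<in> I \<Longrightarrow> a \<otimes> x \<in> I"
  shows "ideal I (sub A)"
  using assms ideal_sub_iff by auto

lemma primeideal_subI:
  assumes "subring A R" "ideal P (sub A)" "\<one> \<notin> P"
    "\<And>a b. a \<in> A \<Longrightarrow> b \<in> A \<Longrightarrow> a \<otimes> b \<in> P \<Longrightarrow> a \<in> P \<or> b \<in> P"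
  shows "primeideal P (sub A)"
  using assms subring_closed[OF assms(1)]
  by (intro primeidealI) (auto simp: sub_cring)

lemma primeideal_subD:
  assumes "subring A R" "primeideal P (sub A)"
  shows "ideal P (sub A)" "\<one> \<notin> P"
    "\<And>a b. a \<in> A \<Longrightarrow> b \<in> A \<Longrightarrow> a \<otimes> b \<in> P \<Longrightarrow> a \<in> P \<or> b \<in> P"
    "\<And>a (k::nat). a \<in> A \<Longrightarrow> a [^] k \<in> P \<Longrightarrow> a \<in> P"
proof -
  interpret P: primeideal P "sub A" by fact
  show 1: "ideal P (sub A)" "\<one> \<notin> P"
    "\<And>a b. a \<in> A \<Longrightarrow> b \<in> A \<Longrightarrow> a \<otimes> b \<in> P \<Longrightarrow> a \<in> P \<or> b \<in> P"
    subgoal by (rule P.ideal_axioms) subgoal using P.I_notcarr P.one_imp_carrier by auto subgoal using P.I_prime by simp done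
  note c[simp] = subring_closed[OF assms(1)]
  show "a \<in> P" if "a \<in> A" "a [^] k \<in> P" for a and k :: nat
    using that(2) 
  proof (induction k)
    case 0
    then show ?case using 1 by simp
  next
    case (Suc k)
    then show ?case using 1(3)[of "a [^] k" a] that(1) by auto
  qed
qed

lemma ideal_finsum:
  assumes "subring A R" "ideal I (sub A)" "\<And>i. i \<in> T \<Longrightarrow> f i \<in> I"
  shows "finsum R f T \<in> I"
proof (cases "finite T")
  case True
  note d = ideal_subD[OF assms(1,2)]
  from True assms(3) show "finsum R f T \<in> I"
  proof (induction T rule: finite_induct)
    case (insert i T)
    have "f \<in> T \<rightarrow> carrier R" "f i \<in> carrier R" using insert d(3) by auto
    then show ?case using insert d(5) by simp
  qed (simp add: d(4))
qed (simp add: finsum_infinite ideal_subD(4)[OF assms(1,2)])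

lemma carrier_ideal: "subring A R \<Longrightarrow> ideal A (sub A)"
  by (intro ideal_subI) (simp_all add: subring_closed)

lemma ideal_contract:
  assumes "subring A R" "subring B R" "A \<subseteq> B" "ideal I (sub B)"
  shows "ideal (I \<inter> A) (sub A)"
proof -
  note [simp] = subring_closed[OF assms(1)] ideal_subD(4,5,6)[OF assms(2,4)] subsetD[OF assms(3)]
  show ?thesis by (intro ideal_subI assms(1)) simp_all
qed

lemma prime_contract:
  assumes "subring A R" "subring B R" "A \<subseteq> B" "primeideal P (sub B)"
  shows "primeideal (P \<inter> A) (sub A)"
proof (intro primeideal_subI assms(1))
  note p = primeideal_subD[OF assms(2,4)]
  show "ideal (P \<inter> A) (sub A)" by (rule ideal_contract[OF assms(1-3) p(1)])
  show "\<one> \<notin> P \<inter> A" using p(2) by simp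
  show "a \<in> P \<inter> A \<or> b \<in> P \<inter> A" if "a \<in> A" "b \<in> A" "a \<otimes> b \<in> P \<inter> A" for a b
    using p(3)[of a b] that assms(3) by auto
qed

lemma ideal_sum:
  assumes "subring A R" "ideal I (sub A)" "ideal J (sub A)"
  shows "ideal {x \<oplus> y | x y. x \<in> I \<and> y \<in> J} (sub A)"
proof -
  note c[simp] = subring_closed[OF assms(1)]
  note i = ideal_subD[OF assms(1,2)] and j = ideal_subD[OF assms(1,3)]
  show ?thesis
  proof (intro ideal_subI assms(1))
    show "{x \<oplus> y | x y. x \<in> I \<and> y \<in> J} \<subseteq> A" by (auto simp: i(2) j(2))
    show "\<zero> \<in> {x \<oplus> y | x y. x \<in> I \<and> y \<in> J}" using i(4) j(4) by force
  next
    fix u v assume "u \<in> {x \<oplus> y | x y. x \<in> I \<and> y \<in> J}" "v \<in> {x \<oplus> y | x y. x \<in> I \<and> y \<in> J}"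
    then obtain x y x' y' where e: "u = x \<oplus> y" "v = x' \<oplus> y'" "x \<in> I" "x' \<in> I" "y \<in> J" "y' \<in> J" by auto
    have "x \<in> carrier R" "y \<in> carrier R" "x' \<in> carrier R" "y' \<in> carrier R" using e i(3) j(3) by simp_all
    then have "u \<oplus> v = (x \<oplus> x') \<oplus> (y \<oplus> y')" unfolding e by algebra
    then show "u \<oplus> v \<in> {x \<oplus> y | x y. x \<in> I \<and> y \<in> J}" using e i(5) j(5) by blast
  next
    fix a u assume a: "a \<in> A" "u \<in> {x \<oplus> y | x y. x \<in> I \<and> y \<in> J}"
    then obtain x y where e: "u = x \<oplus> y" "x \<in> I" "y \<in> J" by auto
    have "a \<otimes> u = a \<otimes> x \<oplus> a \<otimes> y" using e a i(3) j(3) by (simp add: r_distr)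
    then show "a \<otimes> u \<in> {x \<oplus> y | x y. x \<in> I \<and> y \<in> J}" using e i(6) j(6) a by blast
  qed
qed

lemma principal_ideal:
  assumes "subring A R" "x \<in> carrier R" "x \<in> A"
  shows "ideal {a \<otimes> x | a. a \<in> A} (sub A)"
proof -
  note c[simp] = subring_closed[OF assms(1)]
  show ?thesis
  proof (intro ideal_subI assms(1))
    show "{a \<otimes> x | a. a \<in> A} \<subseteq> A" using c assms by auto
    have "\<zero> = \<zero> \<otimes> x" using assms by simp
    then show "\<zero> \<in> {a \<otimes> x | a. a \<in> A}" using c(2) by blast
  next
    fix u v assume "u \<in> {a \<otimes> x | a. a \<in> A}" "v \<in> {a \<otimes> x | a. a \<in> A}"
    then obtain a b where e: "u = a \<otimes> x" "v = b \<otimes> x" "a \<in> A" "b \<in> A" by auto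
    then have "u \<oplus> v = (a \<oplus> b) \<otimes> x" "a \<oplus> b \<in> A" using assms by (simp_all add: l_distr)
    then show "u \<oplus> v \<in> {a \<otimes> x | a. a \<in> A}" by blast
  next
    fix a u assume a: "a \<in> A" "u \<in> {a \<otimes> x | a. a \<in> A}"
    then obtain b where e: "u = b \<otimes> x" "b \<in> A" by auto
    then have "a \<otimes> u = (a \<otimes> b) \<otimes> x" "a \<otimes> b \<in> A" using assms a by (simp_all add: m_assoc)
    then show "a \<otimes> u \<in> {a \<otimes> x | a. a \<in> A}" by blast
  qed
qed

section \<open>Maximal ideals, local subrings and the ascending chain condition\<close>

lemma exists_maximal:
  assumes "subring A R" "ideal I (sub A)" "\<one> \<notin> I"
  obtains M where "maximalideal M (sub A)" "I \<subseteq> M"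
proof -
  define S where "S = {J. ideal J (sub A) \<and> I \<subseteq> J \<and> \<one> \<notin> J}"
  have ne: "I \<in> S" using assms by (auto simp: S_def)
  have "\<exists>M\<in>S. \<forall>K\<in>S. M \<subseteq> K \<longrightarrow> K = M"
  proof (rule subset_Zorn)
    fix C assume C: "subset.chain S C"
    show "\<exists>U\<in>S. \<forall>K\<in>C. K \<subseteq> U"
    proof (cases "C = {}")
      case True
      then show ?thesis using ne by auto
    next
      case False
      have cs: "\<And>K. K \<in> C \<Longrightarrow> ideal K (sub A) \<and> I \<subseteq> K \<and> \<one> \<notin> K" using C by (auto simp: S_def subset.chain_def)
      have tot: "\<And>K L. K \<in> C \<Longrightarrow> L \<in> C \<Longrightarrow> K \<subseteq> L \<or> L \<subseteq> K" using C by (auto simp: subset.chain_def)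
      have "ideal (\<Union>C) (sub A)"
      proof (intro ideal_subI assms(1))
        show "\<Union>C \<subseteq> A" using cs ideal_subD(1)[OF assms(1)] by blast
        show "\<zero> \<in> \<Union>C" using cs False ideal_subD(4)[OF assms(1)] by blast
        show "x \<oplus> y \<in> \<Union>C" if xy: "x \<in> \<Union>C" "y \<in> \<Union>C" for x y
        proof -
          obtain K L where "x \<in> K" "y \<in> L" "K \<in> C" "L \<in> C" using xy by auto
          then obtain Z where "x \<in> Z" "y \<in> Z" "Z \<in> C" using tot by blast
          then show ?thesis using ideal_subD(5)[OF assms(1)] cs by blast
        qed
        show "a \<otimes> x \<in> \<Union>C" if "a \<in> A" "x \<in> \<Union>C" for a x
          using that ideal_subD(6)[OF assms(1)] cs by blast
      qed
      then have "\<Union>C \<in> S" unfolding S_def using cs False by blast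
      then show ?thesis by auto
    qed
  qed
  then obtain M where M: "M \<in> S" "\<And>K. K \<in> S \<Longrightarrow> M \<subseteq> K \<Longrightarrow> K = M" by auto
  have "maximalideal M (sub A)"
  proof (rule maximalidealI)
    show "ideal M (sub A)" using M by (auto simp: S_def)
    show "carrier (sub A) \<noteq> M" using M subring_closed(3)[OF assms(1)] by (auto simp: S_def)
    fix J assume J: "ideal J (sub A)" "M \<subseteq> J" "J \<subseteq> carrier (sub A)"
    show "J = M \<or> J = carrier (sub A)"
    proof (cases "\<one> \<in> J")
      case True
      then have "J = carrier (sub A)" using ideal.one_imp_carrier[OF J(1)] by simp
      then show ?thesis by simp
    next
      case False
      then have "J \<in> S" using J M by (auto simp: S_def)
      then show ?thesis using M(2) J by blast
    qed
  qed
  then show ?thesis using that M(1) by (auto simp: S_def)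
qed

lemma maximal_sub_prime:
  assumes "subring A R" "maximalideal M (sub A)"
  shows "primeideal M (sub A)"
  using cring.maximalideal_prime[OF sub_cring[OF assms(1)] assms(2)] .

lemma maximal_sub_subset:
  assumes "subring A R" "maximalideal M (sub A)" "ideal I (sub A)" "M \<subseteq> I" "\<one> \<notin> I"
  shows "I = M"
proof -
  interpret M: maximalideal M "sub A" by fact
  have "I \<noteq> A" using assms(5) subring_closed(3)[OF assms(1)] by auto
  then show ?thesis using M.I_maximal[OF assms(3,4)] ideal_subD(1)[OF assms(1,3)] by auto
qed

text \<open>An element outside the only maximal ideal generates an ideal that lies in no maximal
  ideal, so it is a unit of \<open>A\<close>; its inverse in \<open>A\<close> is the one formed in
  \<open>F\<close>.\<close>

lemma local_ring_max_ideal: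
  assumes "subring A R" "local_ring (sub A)"
  shows "maximalideal (max_ideal (sub A)) (sub A)"
    "maximalideal M (sub A) \<Longrightarrow> M = max_ideal (sub A)"
    "x \<in> A \<Longrightarrow> x \<notin> max_ideal (sub A) \<Longrightarrow> inv x \<in> A \<and> x \<noteq> \<zero>"
    "ideal I (sub A) \<Longrightarrow> \<one> \<notin> I \<Longrightarrow> I \<subseteq> max_ideal (sub A)"
proof -
  have ex: "\<exists>!M. maximalideal M (sub A)" using assms(2) by (simp add: local_ring_def)
  show m: "maximalideal (max_ideal (sub A)) (sub A)" unfolding max_ideal_def by (rule theI'[OF ex])
  show u: "M = max_ideal (sub A)" if "maximalideal M (sub A)" for M using ex m that by auto
  show s: "I \<subseteq> max_ideal (sub A)" if "ideal I (sub A)" "\<one> \<notin> I" for I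
    using exists_maximal[OF assms(1) that] u by metis
  note c[simp] = subring_closed[OF assms(1)]
  assume x: "x \<in> A" "x \<notin> max_ideal (sub A)"
  let ?I = "{a \<otimes> x | a. a \<in> A}"
  have I: "ideal ?I (sub A)" using principal_ideal[OF assms(1)] x by simp
  have "x = \<one> \<otimes> x" using x(1) by simp
  then have "x \<in> ?I" using c(3) by blast
  then have "\<one> \<in> ?I" using s[OF I] x by blast
  then obtain a where a: "a \<in> A" "\<one> = a \<otimes> x" by auto
  have "x \<noteq> \<zero>" using a by auto
  moreover have "a = \<one> \<otimes> inv x" using a(1) x(1) calculation a(2)[symmetric] by (subst eq_mult_inv_iff) (simp_all add: m_comm)
  ultimately show "inv x \<in> A \<and> x \<noteq> \<zero>" using a(1) field_inv(1)[of x] x(1) by simp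
qed

lemma noetherian_sub_chain:
  assumes "subring A R" "noetherian_ring (sub A)" "\<And>n::nat. ideal (I n) (sub A)" "\<And>n. I n \<subseteq> I (Suc n)"
  shows "\<exists>N. \<forall>n\<ge>N. I n = I N"
proof -
  interpret A: noetherian_ring "sub A" by fact
  have mono: "I m \<subseteq> I n" if "m \<le> n" for m n using that assms(4) by (rule lift_Suc_mono_le[rotated])
  have "subset.chain {J. ideal J (sub A)} (range I)"
    unfolding subset_chain_def
  proof (intro conjI ballI)
    show "range I \<subseteq> {J. ideal J (sub A)}" using assms(3) by auto
    fix J L assume "J \<in> range I" "L \<in> range I"
    then obtain m n where "J = I m" "L = I n" by auto
    then show "J \<subseteq> L \<or> L \<subseteq> J" using mono[of m n] mono[of n m] by (cases "m \<le> n") auto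
  qed
  then have "\<Union>(range I) \<in> range I" by (intro A.ideal_chain_is_trivial) auto
  then obtain N where N: "\<Union>(range I) = I N" by auto
  show ?thesis using mono[of N] N by blast
qed

end

section \<open>Localization and height\<close>

lemma sorted_psubset_last:
  assumes "sorted_wrt (\<subset>) ps" "p \<in> set ps"
  shows "p \<subseteq> last ps"
  using assms
proof (induction ps rule: rev_induct)
  case (snoc y ys)
  then show ?case by (auto simp: sorted_wrt_append)
qed simp

context field
begin

text \<open>The extension of \<open>I\<close> to the localization of \<open>A\<close> at
  \<open>P\<close>, described by denominators so that no inverse occurs. For \<open>I = A\<close> it
  is the local ring itself.\<close>

definition ext :: "'a set \<Rightarrow> 'a set \<Rightarrow> 'a set \<Rightarrow> 'a set" where
  "ext A P I = {x \<in> carrier R. \<exists>s\<in>A - P. s \<otimes> x \<in> I}"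

lemma extI: "x \<in> carrier R \<Longrightarrow> s \<in> A \<Longrightarrow> s \<notin> P \<Longrightarrow> s \<otimes> x \<in> I \<Longrightarrow> x \<in> ext A P I"
  by (auto simp: ext_def)

lemma extE:
  assumes "x \<in> ext A P I"
  obtains s where "x \<in> carrier R" "s \<in> A" "s \<notin> P" "s \<otimes> x \<in> I"
  using assms by (auto simp: ext_def)

lemma localization_at_eq_ext:
  assumes "subring A R" "\<zero> \<in> P"
  shows "localization_at R A P = ext A P A"
proof -
  note c[simp] = subring_closed[OF assms(1)]
  have nz: "s \<noteq> \<zero>" if "s \<in> A - P" for s using that assms(2) by auto
  show ?thesis
  proof (intro Set.set_eqI iffI)
    fix x assume "x \<in> localization_at R A P"
    then obtain y s where e: "x = y \<otimes> inv s" "y \<in> A" "s \<in> A" "s \<notin> P"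
      by (auto simp: localization_at_def localization_def)
    then have s: "s \<noteq> \<zero>" "s \<in> carrier R" using nz by auto
    then have x: "x \<in> carrier R" using e field_inv by simp
    then have "s \<otimes> x = y" using eq_mult_inv_iff[of x y s] e s by simp
    then show "x \<in> ext A P A" using x e(2-4) by (metis extI)
  next
    fix x assume "x \<in> ext A P A"
    then obtain s where e: "x \<in> carrier R" "s \<in> A" "s \<notin> P" "s \<otimes> x \<in> A" by (auto simp: ext_def)
    then have s: "s \<noteq> \<zero>" "s \<in> carrier R" using nz by auto
    then have "x = (s \<otimes> x) \<otimes> inv s" using eq_mult_inv_iff[of x "s \<otimes> x" s] e by simp
    then show "x \<in> localization_at R A P" using e
      by (auto simp: localization_at_def localization_def)
  qed
qed

lemma ext_mono: "I \<subseteq> J \<Longrightarrow> ext A P I \<subseteq> ext A P J"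
  by (auto simp: ext_def)

lemma prime_complement_mult:
  assumes "subring A R" "primeideal P (sub A)" "s \<in> A" "s \<notin> P" "t \<in> A" "t \<notin> P"
  shows "s \<otimes> t \<in> A" "s \<otimes> t \<notin> P"
  using primeideal_subD(3)[OF assms(1,2), of s t] assms subring_closed(5)[OF assms(1)] by auto

lemma ext_closed:
  assumes "subring A R" "primeideal P (sub A)" "ideal I (sub A)"
  shows "I \<subseteq> ext A P I" "\<zero> \<in> ext A P I" "x \<in> ext A P I \<Longrightarrow> y \<in> ext A P I \<Longrightarrow> x \<oplus> y \<in> ext A P I"
    "a \<in> ext A P A \<Longrightarrow> x \<in> ext A P I \<Longrightarrow> a \<otimes> x \<in> ext A P I"
proof -
  note c[simp] = subring_closed[OF assms(1)]
  note p = primeideal_subD[OF assms(1,2)]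
  note i = ideal_subD[OF assms(1,3)]
  show s: "I \<subseteq> ext A P I"
  proof
    fix x assume x: "x \<in> I"
    then show "x \<in> ext A P I" using extI[of x \<one> A P I] p(2) i(3) by simp
  qed
  then show "\<zero> \<in> ext A P I" using i(4) by auto
  show "x \<oplus> y \<in> ext A P I" if xy: "x \<in> ext A P I" "y \<in> ext A P I"
  proof -
    obtain s t where s: "x \<in> carrier R" "s \<in> A" "s \<notin> P" "s \<otimes> x \<in> I"
      and t: "y \<in> carrier R" "t \<in> A" "t \<notin> P" "t \<otimes> y \<in> I" using xy by (metis extE)
    have sc: "s \<in> carrier R" "t \<in> carrier R" using s t by auto
    have "s \<otimes> t \<otimes> (x \<oplus> y) = t \<otimes> (s \<otimes> x) \<oplus> s \<otimes> (t \<otimes> y)" using s(1) t(1) sc by algebra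
    also have "\<dots> \<in> I" using i(5,6) s t by simp
    finally show ?thesis
      using prime_complement_mult[OF assms(1,2) s(2,3) t(2,3)] s t by (intro extI[of _ "s \<otimes> t"]) auto
  qed
  show "a \<otimes> x \<in> ext A P I" if xy: "a \<in> ext A P A" "x \<in> ext A P I"
  proof -
    obtain s t where s: "a \<in> carrier R" "s \<in> A" "s \<notin> P" "s \<otimes> a \<in> A"
      and t: "x \<in> carrier R" "t \<in> A" "t \<notin> P" "t \<otimes> x \<in> I" using xy by (metis extE)
    have sc: "s \<in> carrier R" "t \<in> carrier R" using s t by auto
    have "s \<otimes> t \<otimes> (a \<otimes> x) = (s \<otimes> a) \<otimes> (t \<otimes> x)" using s(1) t(1) sc by algebra
    also have "\<dots> \<in> I" using i(6) s t by simp
    finally show ?thesis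
      using prime_complement_mult[OF assms(1,2) s(2,3) t(2,3)] s t by (intro extI[of _ "s \<otimes> t"]) auto
  qed
qed

lemma ext_subring:
  assumes "subring A R" "primeideal P (sub A)"
  shows "subring (ext A P A) R" "A \<subseteq> ext A P A"
proof -
  note e = ext_closed[OF assms carrier_ideal[OF assms(1)]]
  note c[simp] = subring_closed[OF assms(1)]
  show s: "A \<subseteq> ext A P A" by (rule e(1))
  show "subring (ext A P A) R"
  proof (rule subringI)
    show "ext A P A \<subseteq> carrier R" by (auto simp: ext_def)
    show "\<one> \<in> ext A P A" using s by auto
    show "\<ominus> h \<in> ext A P A" if "h \<in> ext A P A" for h
    proof -
      have "\<ominus> \<one> \<otimes> h \<in> ext A P A" by (rule e(4)) (use s that in auto)
      then show ?thesis using that by (simp add: ext_def l_minus)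
    qed
  qed (use e(3,4) in auto)
qed

lemma ext_ideal:
  assumes "subring A R" "primeideal P (sub A)" "ideal I (sub A)"
  shows "ideal (ext A P I) (sub (ext A P A))"
  using ext_closed[OF assms] ext_mono[OF ideal_subD(1)[OF assms(1,3)]]
  by (intro ideal_subI ext_subring[OF assms(1,2)]) auto

lemma ext_contract:
  assumes "subring A R" "primeideal P (sub A)" "primeideal Q (sub A)" "Q \<subseteq> P"
  shows "ext A P Q \<inter> A = Q"
proof -
  note q = primeideal_subD[OF assms(1,3)]
  have "x \<in> Q" if "x \<in> ext A P Q" "x \<in> A" for x
    using that q(3) assms(4) by (metis extE subsetD)
  then show ?thesis using ext_closed(1)[OF assms(1,2) q(1)] ideal_subD(1)[OF assms(1) q(1)] by auto
qed

lemma ext_prime: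
  assumes "subring A R" "primeideal P (sub A)" "primeideal Q (sub A)" "Q \<subseteq> P"
  shows "primeideal (ext A P Q) (sub (ext A P A))"
proof (rule primeideal_subI[OF ext_subring(1)[OF assms(1,2)] ext_ideal[OF assms(1,2) primeideal_subD(1)[OF assms(1,3)]]])
  note c[simp] = subring_closed[OF assms(1)]
  note q = primeideal_subD[OF assms(1,3)]
  show "\<one> \<notin> ext A P Q" using ext_contract[OF assms] q(2) c(3) by (metis IntI)
  show "a \<in> ext A P Q \<or> b \<in> ext A P Q" if ab: "a \<in> ext A P A" "b \<in> ext A P A" "a \<otimes> b \<in> ext A P Q" for a b
  proof -
    obtain s t u where s: "a \<in> carrier R" "s \<in> A" "s \<notin> P" "s \<otimes> a \<in> A"
      and t: "b \<in> carrier R" "t \<in> A" "t \<notin> P" "t \<otimes> b \<in> A"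
      and u: "u \<in> A" "u \<notin> P" "u \<otimes> (a \<otimes> b) \<in> Q" using ab by (metis extE)
    have cr: "s \<in> carrier R" "t \<in> carrier R" "u \<in> carrier R" using s t u by auto
    have "u \<otimes> ((s \<otimes> a) \<otimes> (t \<otimes> b)) = (s \<otimes> t) \<otimes> (u \<otimes> (a \<otimes> b))" using s(1) t(1) cr by algebra
    also have "\<dots> \<in> Q" using ideal_subD(6)[OF assms(1) q(1)] s t u by simp
    finally have "u \<otimes> ((s \<otimes> a) \<otimes> (t \<otimes> b)) \<in> Q" .
    then have "(s \<otimes> a) \<otimes> (t \<otimes> b) \<in> Q" using q(3)[of u "(s \<otimes> a) \<otimes> (t \<otimes> b)"] u assms(4) s t by auto
    then have "s \<otimes> a \<in> Q \<or> t \<otimes> b \<in> Q" using q(3) s t by auto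
    then show ?thesis using s t by (metis extI)
  qed
qed

lemma ext_inverse:
  assumes "subring A R" "primeideal P (sub A)" "s \<in> A" "s \<notin> P"
  shows "inv s \<in> ext A P A" "s \<noteq> \<zero>"
proof -
  note c[simp] = subring_closed[OF assms(1)]
  note p = primeideal_subD[OF assms(1,2)]
  show s: "s \<noteq> \<zero>" using assms(4) ideal_subD(4)[OF assms(1) p(1)] by auto
  show "inv s \<in> ext A P A" using field_inv[of s] s assms(3,4) by (intro extI[of _ s]) auto
qed

lemma ext_of_contract:
  assumes "subring A R" "primeideal P (sub A)" "ideal I (sub (ext A P A))"
  shows "ext A P (I \<inter> A) = I"
proof -
  note c[simp] = subring_closed[OF assms(1)]
  let ?L = "ext A P A"
  note L = ext_subring[OF assms(1,2)]
  note i = ideal_subD[OF L(1) assms(3)]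
  show ?thesis
  proof (intro Set.set_eqI iffI)
    fix x assume "x \<in> ext A P (I \<inter> A)"
    then obtain s where s: "x \<in> carrier R" "s \<in> A" "s \<notin> P" "s \<otimes> x \<in> I" by (auto elim: extE)
    note n = ext_inverse[OF assms(1,2) s(2,3)]
    have "inv s \<otimes> (s \<otimes> x) \<in> I" using i(6) n s by auto
    moreover have "inv s \<otimes> (s \<otimes> x) = x" using field_inv[of s] n s by (simp flip: m_assoc)
    ultimately show "x \<in> I" by simp
  next
    fix x assume x: "x \<in> I"
    then obtain s where s: "x \<in> carrier R" "s \<in> A" "s \<notin> P" "s \<otimes> x \<in> A" using i(2) by (metis extE)
    then have "s \<otimes> x \<in> I" using i(6)[of s x] x L(2) by auto
    then show "x \<in> ext A P (I \<inter> A)" using s by (intro extI) auto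
  qed
qed

text \<open>If \<open>x\<close> is in a proper ideal \<open>I\<close> and
  \<open>s \<otimes> x \<in> A\<close> with \<open>s\<close> outside \<open>P\<close>, then
  \<open>s \<otimes> x\<close> must be in \<open>P\<close>, since otherwise it would be a unit of
  the local ring belonging to \<open>I\<close>.\<close>

lemma ext_max:
  assumes "subring A R" "primeideal P (sub A)"
  shows "ideal I (sub (ext A P A)) \<Longrightarrow> \<one> \<notin> I \<Longrightarrow> I \<subseteq> ext A P P"
    "maximalideal (ext A P P) (sub (ext A P A))"
    "maximalideal M (sub (ext A P A)) \<Longrightarrow> M = ext A P P"
    "ideal I (sub (ext A P A)) \<Longrightarrow> \<one> \<notin> I \<Longrightarrow> I \<inter> A \<subseteq> P"
proof -
  note c[simp] = subring_closed[OF assms(1)]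
  let ?L = "ext A P A"
  note L = ext_subring[OF assms(1,2)]
  note Lc[simp] = subring_closed[OF L(1)]
  show s: "I \<subseteq> ext A P P" if I: "ideal I (sub (ext A P A))" "\<one> \<notin> I" for I
  proof
    fix x assume x: "x \<in> I"
    note i = ideal_subD[OF L(1) I(1)]
    obtain s where s: "x \<in> carrier R" "s \<in> A" "s \<notin> P" "s \<otimes> x \<in> A" using x i(2) by (metis extE)
    have "s \<otimes> x \<in> P"
    proof (rule ccontr)
      assume "s \<otimes> x \<notin> P"
      note n = ext_inverse[OF assms(1,2) s(4) this]
      have "s \<in> ?L" using L(2) s(2) by auto
      then have "s \<otimes> x \<in> I" using i(6) x by blast
      then have "inv (s \<otimes> x) \<otimes> (s \<otimes> x) \<in> I" using i(6) n(1) by blast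
      then show False using field_inv(3)[of "s \<otimes> x"] n s I(2) by auto
    qed
    then show "x \<in> ext A P P" using s by (metis extI)
  qed
  have pr: "primeideal (ext A P P) (sub ?L)" by (rule ext_prime[OF assms assms(2) order_refl])
  note p = primeideal_subD[OF L(1) pr]
  show m: "maximalideal (ext A P P) (sub (ext A P A))"
  proof (rule maximalidealI)
    show "ideal (ext A P P) (sub (ext A P A))" by (rule p(1))
    show "carrier (sub ?L) \<noteq> ext A P P" using p(2) Lc(3) by (metis partial_object.select_convs(1) partial_object.update_convs(1) partial_object.surjective)
    fix J assume J: "ideal J (sub (ext A P A))" "ext A P P \<subseteq> J" "J \<subseteq> carrier (sub (ext A P A))"
    show "J = ext A P P \<or> J = carrier (sub (ext A P A))"
      using s[OF J(1)] J(2) ideal.one_imp_carrier[OF J(1)] by auto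
  qed
  show "M = ext A P P" if "maximalideal M (sub (ext A P A))"
  proof -
    interpret M: maximalideal M "sub (ext A P A)" by fact
    have "\<one> \<notin> M" using M.I_notcarr M.one_imp_carrier by auto
    from maximal_sub_subset[OF L(1) that p(1) s[OF M.ideal_axioms this] p(2)] show ?thesis by simp
  qed
  show "I \<inter> A \<subseteq> P" if "ideal I (sub (ext A P A))" "\<one> \<notin> I"
    using s[OF that] ext_contract[OF assms assms(2) order_refl] by auto
qed

text \<open>Links the two descriptions of the maximal ideal of the local ring: the final statement
  writes it as the ideal generated by \<open>P\<close>, the proofs use
  \<open>ext A P P\<close>.\<close>

lemma ext_genideal:
  assumes "subring A R" "primeideal P (sub A)"
  shows "genideal (sub (ext A P A)) P = ext A P P"
proof -
  note p = primeideal_subD[OF assms]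
  note L = ext_subring[OF assms(1,2)]
  note Lc[simp] = subring_closed[OF L(1)]
  interpret L: cring "sub (ext A P A)" by (rule sub_cring[OF L(1)])
  have P: "P \<subseteq> ext A P P" "P \<subseteq> A" using ext_closed(1)[OF assms p(1)] ideal_subD(1)[OF assms(1) p(1)] by auto
  show ?thesis
  proof
    show "genideal (sub (ext A P A)) P \<subseteq> ext A P P"
      using L.genideal_minimal[OF ext_ideal[OF assms p(1)] P(1)] .
    have g: "ideal (genideal (sub (ext A P A)) P) (sub (ext A P A))"
      using L.genideal_ideal P L(2) by auto
    have "P \<subseteq> genideal (sub (ext A P A)) P \<inter> A" using L.genideal_self[of P] P L(2) by auto
    then show "ext A P P \<subseteq> genideal (sub (ext A P A)) P"
      using ext_of_contract[OF assms g] ext_mono by metis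
  qed
qed

text \<open>Extension and contraction match the primes of \<open>A\<close> inside \<open>P\<close>
  with the primes of the local ring. A chain there need not reach the maximal ideal, whereas
  \<open>height\<close> wants \<open>P\<close> as the last entry; if the contracted chain stops
  earlier, \<open>P\<close> is appended, which only lengthens it.\<close>

lemma height_eq_krull_dim:
  assumes "subring A R" "primeideal P (sub A)"
  shows "height (sub A) P = krull_dim (sub (ext A P A))"
proof (rule antisym)
  let ?L = "ext A P A"
  note L = ext_subring[OF assms(1,2)]
  show "height (sub A) P \<le> krull_dim (sub ?L)"
    unfolding height_def
  proof (rule SUP_least)
    fix ps assume "ps \<in> {ps. prime_chain (sub A) ps \<and> last ps = P}"
    then have ps: "ps \<noteq> []" "\<And>p. p \<in> set ps \<Longrightarrow> primeideal p (sub A)" "sorted_wrt (\<subset>) ps" "last ps = P"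
      by (auto simp: prime_chain_def)
    have le: "p \<subseteq> P" if "p \<in> set ps" for p using sorted_psubset_last[OF ps(3) that] ps(4) by simp
    have "sorted_wrt (\<subset>) (map (ext A P) ps)"
      unfolding sorted_wrt_map
    proof (rule sorted_wrt_mono_rel[OF _ ps(3)])
      fix p q assume pq: "p \<in> set ps" "q \<in> set ps" "p \<subset> q"
      have "ext A P p \<subseteq> ext A P q" using pq ext_mono by auto
      moreover have "ext A P p \<noteq> ext A P q"
        using ext_contract[OF assms ps(2)[OF pq(1)] le[OF pq(1)]] ext_contract[OF assms ps(2)[OF pq(2)] le[OF pq(2)]] pq(3) by (metis psubset_eq)
      ultimately show "ext A P p \<subset> ext A P q" by auto
    qed
    then have "prime_chain (sub ?L) (map (ext A P) ps)"
      unfolding prime_chain_def using ps(1) ext_prime[OF assms ps(2) le] by auto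
    then show "enat (length ps - 1) \<le> krull_dim (sub ?L)"
      unfolding krull_dim_def by (rule_tac SUP_upper2[of "map (ext A P) ps"]) auto
  qed
  show "krull_dim (sub ?L) \<le> height (sub A) P"
    unfolding krull_dim_def
  proof (rule SUP_least)
    fix ps assume "ps \<in> {ps. prime_chain (sub ?L) ps}"
    then have ps: "ps \<noteq> []" "\<And>p. p \<in> set ps \<Longrightarrow> primeideal p (sub ?L)" "sorted_wrt (\<subset>) ps"
      by (auto simp: prime_chain_def)
    let ?qs = "map (\<lambda>p. p \<inter> A) ps"
    have qp: "\<And>p. p \<in> set ?qs \<Longrightarrow> primeideal p (sub A)"
      using prime_contract[OF assms(1) L] ps(2) by auto
    have qle: "\<And>p. p \<in> set ?qs \<Longrightarrow> p \<subseteq> P"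
      using ext_max(4)[OF assms] primeideal_subD(1,2)[OF L(1) ps(2)] by auto
    have qs: "sorted_wrt (\<subset>) ?qs"
      unfolding sorted_wrt_map
    proof (rule sorted_wrt_mono_rel[OF _ ps(3)])
      fix p q assume pq: "p \<in> set ps" "q \<in> set ps" "p \<subset> q"
      have "p \<inter> A \<noteq> q \<inter> A"
        using ext_of_contract[OF assms primeideal_subD(1)[OF L(1) ps(2)[OF pq(1)]]]
          ext_of_contract[OF assms primeideal_subD(1)[OF L(1) ps(2)[OF pq(2)]]] pq(3) by (metis psubset_eq)
      then show "p \<inter> A \<subset> q \<inter> A" using pq(3) by auto
    qed
    show "enat (length ps - 1) \<le> height (sub A) P"
    proof (cases "last ?qs = P")
      case True
      then have "prime_chain (sub A) ?qs \<and> last ?qs = P" using qs qp ps(1) by (auto simp: prime_chain_def)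
      then show ?thesis unfolding height_def by (rule_tac SUP_upper2[of "?qs"]) auto
    next
      case False
      have "p \<subset> P" if "p \<in> set ?qs" for p
        using sorted_psubset_last[OF qs that] qle[of "last ?qs"] False ps(1) last_in_set[of ?qs] by auto
      then have "sorted_wrt (\<subset>) (?qs @ [P])" using qs by (simp add: sorted_wrt_append)
      then have "prime_chain (sub A) (?qs @ [P]) \<and> last (?qs @ [P]) = P"
        using qp assms(2) by (auto simp: prime_chain_def)
      then show ?thesis unfolding height_def by (rule_tac SUP_upper2[of "?qs @ [P]"]) auto
    qed
  qed
qed

lemma height_ge:
  assumes "prime_chain Q ps" "last ps = P"
  shows "enat (length ps - 1) \<le> height Q P"
  unfolding height_def using assms by (intro SUP_upper2[of ps]) auto

lemma height_le:
  assumes "\<And>ps. prime_chain Q ps \<Longrightarrow> last ps = P \<Longrightarrow> length ps \<le> Suc n"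
  shows "height Q P \<le> enat n"
  unfolding height_def using assms by (intro SUP_least) fastforce

end

section \<open>Adjoining an element to a Noetherian ring\<close>

context field
begin

lemma genideal_subE:
  assumes "subring A R" "G \<subseteq> A"
  shows "ideal (genideal (sub A) G) (sub A)" "G \<subseteq> genideal (sub A) G"
    "ideal I (sub A) \<Longrightarrow> G \<subseteq> I \<Longrightarrow> genideal (sub A) G \<subseteq> I"
proof -
  interpret A: cring "sub A" by (rule sub_cring[OF assms(1)])
  show "ideal (genideal (sub A) G) (sub A)" using A.genideal_ideal assms by simp
  show "G \<subseteq> genideal (sub A) G" using A.genideal_self assms by simp
  show "ideal I (sub A) \<Longrightarrow> G \<subseteq> I \<Longrightarrow> genideal (sub A) G \<subseteq> I" by (rule A.genideal_minimal)
qed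

text \<open>Values at \<open>x\<close> of polynomials of degree strictly below \<open>k\<close>, so
  that \<open>x [^] k\<close> is the next power to be added.\<close>

fun poly_values :: "'a set \<Rightarrow> 'a \<Rightarrow> nat \<Rightarrow> 'a set" where
  "poly_values A x 0 = {\<zero>}"
| "poly_values A x (Suc k) = {c \<otimes> x [^] k \<oplus> g | c g. c \<in> A \<and> g \<in> poly_values A x k}"

context
  fixes A :: "'a set" and x :: 'a
  assumes A: "subring A R" and x: "x \<in> carrier R"
begin

lemmas [simp] = subring_closed[OF A] x

lemma poly_values_carrier: "g \<in> poly_values A x k \<Longrightarrow> g \<in> carrier R"
  by (induction k arbitrary: g) auto

lemma poly_values_SucI:
  "c \<in> A \<Longrightarrow> g \<in> poly_values A x k \<Longrightarrow> f = c \<otimes> x [^] k \<oplus> g \<Longrightarrow> f \<in> poly_values A x (Suc k)"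
  by auto

lemma poly_values_zero: "\<zero> \<in> poly_values A x k"
proof (induction k)
  case (Suc k)
  show ?case by (rule poly_values_SucI[OF subring_closed(2)[OF A] Suc]) simp
qed simp

lemma poly_values_add: "g \<in> poly_values A x k \<Longrightarrow> h \<in> poly_values A x k \<Longrightarrow> g \<oplus> h \<in> poly_values A x k"
proof (induction k arbitrary: g h)
  case (Suc k)
  obtain c d u v where e: "c \<in> A" "d \<in> A" "u \<in> poly_values A x k" "v \<in> poly_values A x k"
    "g = c \<otimes> x [^] k \<oplus> u" "h = d \<otimes> x [^] k \<oplus> v" using Suc.prems by auto
  have cr: "c \<in> carrier R" "d \<in> carrier R" "u \<in> carrier R" "v \<in> carrier R" "x [^] k \<in> carrier R"
    using e poly_values_carrier by auto
  have "g \<oplus> h = (c \<oplus> d) \<otimes> x [^] k \<oplus> (u \<oplus> v)" unfolding e using cr by algebra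
  then show ?case by (rule poly_values_SucI[OF subring_closed(6)[OF A e(1,2)] Suc.IH[OF e(3,4)]])
qed simp

lemma poly_values_smult: "a \<in> A \<Longrightarrow> g \<in> poly_values A x k \<Longrightarrow> a \<otimes> g \<in> poly_values A x k"
proof (induction k arbitrary: g)
  case (Suc k)
  obtain c u where e: "c \<in> A" "u \<in> poly_values A x k"
    "g = c \<otimes> x [^] k \<oplus> u" using Suc.prems by auto
  have cr: "a \<in> carrier R" "c \<in> carrier R" "u \<in> carrier R" "x [^] k \<in> carrier R"
    using e poly_values_carrier Suc.prems by auto
  have "a \<otimes> g = (a \<otimes> c) \<otimes> x [^] k \<oplus> (a \<otimes> u)" unfolding e using cr by algebra
  then show ?case by (rule poly_values_SucI[OF subring_closed(5)[OF A Suc.prems(1) e(1)] Suc.IH[OF Suc.prems(1) e(2)]])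
qed simp

lemma poly_values_Suc: "poly_values A x k \<subseteq> poly_values A x (Suc k)"
proof
  fix g assume g: "g \<in> poly_values A x k"
  then show "g \<in> poly_values A x (Suc k)"
    by (rule poly_values_SucI[OF subring_closed(2)[OF A]]) (simp add: poly_values_carrier[OF g])
qed

lemma poly_values_mono: "i \<le> j \<Longrightarrow> poly_values A x i \<subseteq> poly_values A x j"
  using lift_Suc_mono_le[of "poly_values A x"] poly_values_Suc by blast

lemma poly_values_shift: "g \<in> poly_values A x k \<Longrightarrow> x \<otimes> g \<in> poly_values A x (Suc k)"
proof (induction k arbitrary: g)
  case 0
  then show ?case using poly_values_zero[of "Suc 0"] by simp
next
  case (Suc k)
  obtain c u where e: "c \<in> A" "u \<in> poly_values A x k"
    "g = c \<otimes> x [^] k \<oplus> u" using Suc.prems by auto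
  have cr: "c \<in> carrier R" "u \<in> carrier R" "x [^] k \<in> carrier R"
    using e poly_values_carrier by auto
  have "x \<otimes> g = c \<otimes> (x [^] k \<otimes> x) \<oplus> x \<otimes> u" unfolding e using cr x by algebra
  also have "x [^] k \<otimes> x = x [^] Suc k" by simp
  finally show ?case by (rule poly_values_SucI[OF e(1) Suc.IH[OF e(2)]])
qed

definition adjoin :: "'a set" where "adjoin = (\<Union>k. poly_values A x k)"

lemma adjoinI: "g \<in> poly_values A x k \<Longrightarrow> g \<in> adjoin"
  by (auto simp: adjoin_def)

lemma adjoinE:
  assumes "g \<in> adjoin"
  obtains k where "g \<in> poly_values A x k"
  using assms by (auto simp: adjoin_def)

lemma adjoin_add: "g \<in> adjoin \<Longrightarrow> h \<in> adjoin \<Longrightarrow> g \<oplus> h \<in> adjoin"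
proof -
  assume "g \<in> adjoin" "h \<in> adjoin"
  then obtain i j where "g \<in> poly_values A x i" "h \<in> poly_values A x j" by (auto simp: adjoin_def)
  then have "g \<in> poly_values A x (max i j)" "h \<in> poly_values A x (max i j)"
    using poly_values_mono[of i "max i j"] poly_values_mono[of j "max i j"] by auto
  then show ?thesis using poly_values_add by (auto simp: adjoin_def)
qed

lemma adjoin_smult: "a \<in> A \<Longrightarrow> g \<in> adjoin \<Longrightarrow> a \<otimes> g \<in> adjoin"
  using poly_values_smult by (auto simp: adjoin_def)

lemma adjoin_carrier: "g \<in> adjoin \<Longrightarrow> g \<in> carrier R"
  using poly_values_carrier by (auto simp: adjoin_def)

lemma adjoin_shift: "g \<in> adjoin \<Longrightarrow> x [^] (k::nat) \<otimes> g \<in> adjoin"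
proof (induction k)
  case (Suc k)
  have "x [^] Suc k \<otimes> g = x \<otimes> (x [^] k \<otimes> g)" using adjoin_carrier[OF Suc.prems] by (simp add: m_ac)
  moreover have "x \<otimes> (x [^] k \<otimes> g) \<in> adjoin"
    using Suc.IH[OF Suc.prems] by (metis adjoinE adjoinI poly_values_shift)
  ultimately show ?case by simp
qed (simp add: adjoin_carrier)

lemma adjoin_mult: "g \<in> poly_values A x k \<Longrightarrow> h \<in> adjoin \<Longrightarrow> g \<otimes> h \<in> adjoin"
proof (induction k arbitrary: g)
  case 0
  then show ?case using adjoinI[OF poly_values_zero] adjoin_carrier by simp
next
  case (Suc k)
  obtain c u where e: "c \<in> A" "u \<in> poly_values A x k"
    "g = c \<otimes> x [^] k \<oplus> u" using Suc.prems by auto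
  have cr: "c \<in> carrier R" "u \<in> carrier R" "x [^] k \<in> carrier R" "h \<in> carrier R"
    using e poly_values_carrier adjoin_carrier Suc.prems by auto
  have "g \<otimes> h = c \<otimes> (x [^] k \<otimes> h) \<oplus> u \<otimes> h" unfolding e using cr by algebra
  then show ?case
    using Suc.IH[OF e(2) Suc.prems(2)] adjoin_add adjoin_smult[OF e(1) adjoin_shift[OF Suc.prems(2)]] by simp
qed

lemma adjoin_base: "A \<subseteq> adjoin" "x \<in> adjoin"
proof -
  show A': "A \<subseteq> adjoin"
  proof
    fix a assume a: "a \<in> A"
    then have "a \<in> poly_values A x (Suc 0)" by (intro poly_values_SucI[OF a poly_values_zero]) simp
    then show "a \<in> adjoin" unfolding adjoin_def by blast
  qed
  then have "x [^] Suc 0 \<otimes> \<one> \<in> adjoin" using subring_closed(3)[OF A] by (intro adjoin_shift) auto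
  then show "x \<in> adjoin" by simp
qed

lemma adjoin_subring: "subring adjoin R"
proof (rule subringI)
  show "adjoin \<subseteq> carrier R" using adjoin_carrier by auto
  show "\<one> \<in> adjoin" using adjoin_base by auto
  show "\<ominus> h \<in> adjoin" if "h \<in> adjoin" for h
  proof -
    have "\<ominus> \<one> \<otimes> h \<in> adjoin" using that by (intro adjoin_smult) auto
    then show ?thesis using adjoin_carrier[OF that] by (simp add: l_minus)
  qed
  show "g \<otimes> h \<in> adjoin" if "g \<in> adjoin" "h \<in> adjoin" for g h
    using that adjoin_mult unfolding adjoin_def by blast
qed (rule adjoin_add)

lemma adjoin_minimal:
  assumes "subring S R" "A \<subseteq> S" "x \<in> S"
  shows "adjoin \<subseteq> S"
proof -
  note s = subring_closed[OF assms(1)]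
  have "poly_values A x k \<subseteq> S" for k
  proof (induction k)
    case (Suc k)
    then show ?case using s(5,6,8) assms(2,3) by (auto simp: subset_iff)
  qed (simp add: s(2))
  then show ?thesis by (auto simp: adjoin_def)
qed

text \<open>The powers of \<open>x\<close> need not be independent over \<open>A\<close>, so leading coefficients are not well defined;
  nevertheless the ideals \<open>lead I k\<close> determine \<open>I\<close> among the ideals contained in \<open>I\<close>.\<close>

definition lead :: "'a set \<Rightarrow> nat \<Rightarrow> 'a set" where
  "lead I k = {c \<in> A. \<exists>g \<in> poly_values A x k. c \<otimes> x [^] k \<oplus> g \<in> I}"

lemma lead_ideal:
  assumes "ideal I (sub adjoin)"
  shows "ideal (lead I k) (sub A)"
proof (rule ideal_subI[OF A])
  note i = ideal_subD[OF adjoin_subring assms]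
  show "lead I k \<subseteq> A" by (auto simp: lead_def)
  have "\<zero> \<otimes> x [^] k \<oplus> \<zero> = \<zero>" by simp
  then show "\<zero> \<in> lead I k" using i(4) poly_values_zero[of k] unfolding lead_def by (metis (mono_tags, lifting) mem_Collect_eq subring_closed(2)[OF A])
  show "c \<oplus> d \<in> lead I k" if cd: "c \<in> lead I k" "d \<in> lead I k" for c d
  proof -
    obtain u v where e: "c \<in> A" "d \<in> A" "u \<in> poly_values A x k" "v \<in> poly_values A x k"
      "c \<otimes> x [^] k \<oplus> u \<in> I" "d \<otimes> x [^] k \<oplus> v \<in> I" using cd by (auto simp: lead_def)
    have cr: "c \<in> carrier R" "d \<in> carrier R" "u \<in> carrier R" "v \<in> carrier R" "x [^] k \<in> carrier R"
      using e poly_values_carrier by auto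
    have "(c \<oplus> d) \<otimes> x [^] k \<oplus> (u \<oplus> v) = (c \<otimes> x [^] k \<oplus> u) \<oplus> (d \<otimes> x [^] k \<oplus> v)" using cr by algebra
    also have "\<dots> \<in> I" using e i(5) by simp
    finally show ?thesis using e poly_values_add[OF e(3,4)] subring_closed(6)[OF A] unfolding lead_def by blast
  qed
  show "a \<otimes> c \<in> lead I k" if ac: "a \<in> A" "c \<in> lead I k" for a c
  proof -
    obtain u where e: "c \<in> A" "u \<in> poly_values A x k"
      "c \<otimes> x [^] k \<oplus> u \<in> I" using ac by (auto simp: lead_def)
    have cr: "a \<in> carrier R" "c \<in> carrier R" "u \<in> carrier R" "x [^] k \<in> carrier R"
      using e ac poly_values_carrier by auto
    have "(a \<otimes> c) \<otimes> x [^] k \<oplus> (a \<otimes> u) = a \<otimes> (c \<otimes> x [^] k \<oplus> u)" using cr by algebra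
    also have "\<dots> \<in> I" using e i(6) ac(1) adjoin_base(1) by blast
    finally show ?thesis using e ac poly_values_smult[OF ac(1) e(2)] subring_closed(5)[OF A] unfolding lead_def by blast
  qed
qed

lemma lead_Suc:
  assumes "ideal I (sub adjoin)"
  shows "lead I k \<subseteq> lead I (Suc k)"
proof
  note i = ideal_subD[OF adjoin_subring assms]
  fix c assume "c \<in> lead I k"
  then obtain u where e: "c \<in> A" "u \<in> poly_values A x k"
    "c \<otimes> x [^] k \<oplus> u \<in> I" by (auto simp: lead_def)
  have cr: "c \<in> carrier R" "u \<in> carrier R" "x [^] k \<in> carrier R"
    using e poly_values_carrier by auto
  have "x \<otimes> (c \<otimes> x [^] k \<oplus> u) = c \<otimes> (x [^] k \<otimes> x) \<oplus> x \<otimes> u" using cr x by algebra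
  moreover have "x [^] k \<otimes> x = x [^] Suc k" by simp
  moreover have "x \<otimes> (c \<otimes> x [^] k \<oplus> u) \<in> I" using e i(6) adjoin_base(2) by blast
  ultimately have "c \<otimes> x [^] Suc k \<oplus> x \<otimes> u \<in> I" by argo
  then show "c \<in> lead I (Suc k)" using e poly_values_shift[OF e(2)] unfolding lead_def by blast
qed

text \<open>An element of \<open>I\<close> with top coefficient \<open>c\<close> at
  \<open>x [^] k\<close> differs from an element of \<open>J\<close> with the same top coefficient
  by an element of \<open>I\<close> in \<open>poly_values A x k\<close>, to which induction
  applies.\<close>

lemma lead_subset_imp:
  assumes "ideal I (sub adjoin)" "ideal J (sub adjoin)" "J \<subseteq> I" "\<And>k. lead I k \<subseteq> lead J k"
  shows "I \<subseteq> J"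
proof -
  note i = ideal_subD[OF adjoin_subring assms(1)]
  note j = ideal_subD[OF adjoin_subring assms(2)]
  have "f \<in> poly_values A x k \<Longrightarrow> f \<in> I \<Longrightarrow> f \<in> J" for f k
  proof (induction k arbitrary: f)
    case 0
    then show ?case using j by simp
  next
    case (Suc k)
    obtain c u where e: "c \<in> A" "u \<in> poly_values A x k"
      "f = c \<otimes> x [^] k \<oplus> u" using Suc.prems by auto
    then have "c \<in> lead I k" using Suc.prems by (auto simp: lead_def)
    then have "c \<in> lead J k" using assms(4) by auto
    then obtain v where v: "v \<in> poly_values A x k" "c \<otimes> x [^] k \<oplus> v \<in> J" by (auto simp: lead_def)
    have cr: "c \<in> carrier R" "u \<in> carrier R" "v \<in> carrier R" "x [^] k \<in> carrier R"
      using e v poly_values_carrier by auto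
    have "u \<ominus> v = f \<ominus> (c \<otimes> x [^] k \<oplus> v)" unfolding e using cr by algebra
    also have "\<dots> \<in> I" using i(9) Suc.prems v(2) assms(3) by auto
    finally have "u \<ominus> v \<in> I" .
    moreover have "u \<ominus> v = u \<oplus> \<ominus> \<one> \<otimes> v" using cr by (simp add: a_minus_def l_minus)
    moreover have "u \<oplus> \<ominus> \<one> \<otimes> v \<in> poly_values A x k"
      using e(2) v(1) by (intro poly_values_add poly_values_smult) auto
    ultimately have "u \<ominus> v \<in> J" using Suc.IH by simp
    then have "(u \<ominus> v) \<oplus> (c \<otimes> x [^] k \<oplus> v) \<in> J" using j(5) v by simp
    moreover have "(u \<ominus> v) \<oplus> (c \<otimes> x [^] k \<oplus> v) = f" unfolding e using cr by algebra
    ultimately show ?case by simp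
  qed
  then show ?thesis using i(2) by (metis adjoinE subsetI)
qed

text \<open>Hilbert's basis theorem. The ideals \<open>lead I k\<close> become stationary at some
  \<open>N\<close>; lifting finite generating sets of them for \<open>k \<le> N\<close> gives a
  finite set \<open>H\<close> whose ideal has the same leading ideals as \<open>I\<close>.\<close>

lemma adjoin_noetherian:
  assumes "noetherian_ring (sub A)"
  shows "noetherian_ring (sub adjoin)"
proof -
  interpret A: noetherian_ring "sub A" by fact
  interpret S: cring "sub adjoin" by (rule sub_cring[OF adjoin_subring])
  show ?thesis
  proof (rule S.noetherian_ringI)
    fix I assume I: "ideal I (sub adjoin)"
    note i = ideal_subD[OF adjoin_subring I]
    obtain N where N: "\<And>k. k \<ge> N \<Longrightarrow> lead I k = lead I N"
      using noetherian_sub_chain[OF A assms, of "lead I"] lead_ideal[OF I] lead_Suc[OF I] by blast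
    have "\<forall>k. \<exists>G. G \<subseteq> A \<and> finite G \<and> lead I k = genideal (sub A) G"
      using A.finetely_gen[OF lead_ideal[OF I]] by simp
    then obtain G where G: "\<And>k. G k \<subseteq> A" "\<And>k. finite (G k)" "\<And>k. lead I k = genideal (sub A) (G k)"
      by metis
    have "\<forall>k. \<forall>c\<in>G k. \<exists>g \<in> poly_values A x k. c \<otimes> x [^] k \<oplus> g \<in> I"
    proof (intro allI ballI)
      fix k c assume "c \<in> G k"
      then have "c \<in> lead I k" using genideal_subE(2)[OF A G(1)] G(3) by blast
      then show "\<exists>g \<in> poly_values A x k. c \<otimes> x [^] k \<oplus> g \<in> I" by (auto simp: lead_def)
    qed
    then obtain h where h: "\<And>k c. c \<in> G k \<Longrightarrow> h k c \<in> poly_values A x k"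
      "\<And>k c. c \<in> G k \<Longrightarrow> c \<otimes> x [^] k \<oplus> h k c \<in> I" by metis
    define H where "H = (\<Union>k\<le>N. (\<lambda>c. c \<otimes> x [^] k \<oplus> h k c) ` G k)"
    have fin: "finite H" using G(2) by (auto simp: H_def)
    have HI: "H \<subseteq> I" using h(2) by (auto simp: H_def)
    then have HS: "H \<subseteq> adjoin" using i(1) by auto
    let ?J = "genideal (sub adjoin) H"
    note J = genideal_subE[OF adjoin_subring HS]
    have JI: "?J \<subseteq> I" by (rule J(3)[OF I HI])
    have l1: "lead I k \<subseteq> lead ?J k" if "k \<le> N" for k
    proof -
      have "c \<in> lead ?J k" if c: "c \<in> G k" for c
      proof -
        have "c \<otimes> x [^] k \<oplus> h k c \<in> ?J" using J(2) \<open>k \<le> N\<close> c by (auto simp: H_def)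
        then show ?thesis using h(1)[OF c] G(1) c by (auto simp: lead_def)
      qed
      then show ?thesis using genideal_subE(3)[OF A G(1) lead_ideal[OF J(1)]] G(3) by blast
    qed
    have l2: "lead I k \<subseteq> lead ?J k" for k
    proof (cases "k \<le> N")
      case False
      then have "lead I k = lead I N" using False by (intro N) simp
      also have "\<dots> \<subseteq> lead ?J N" using l1 by simp
      also have "\<dots> \<subseteq> lead ?J k" using lift_Suc_mono_le[of "lead ?J" N k] lead_Suc[OF J(1)] False by simp
      finally show ?thesis .
    qed (rule l1)
    have "I = ?J" using lead_subset_imp[OF I J(1) JI l2] JI by auto
    then show "\<exists>H\<subseteq>carrier (sub adjoin). finite H \<and> I = genideal (sub adjoin) H"
      using HS fin by (intro exI[of _ H]) simp
  qed
qed

end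

text \<open>The ring is characterised as the least subring containing \<open>D\<close> and
  \<open>G\<close>, so that it can later be identified with a ring defined by
  \<open>generate_ring\<close>.\<close>

lemma noetherian_finite_type:
  assumes "subring D R" "noetherian_ring (sub D)" "finite G" "G \<subseteq> carrier R"
  shows "\<exists>A. subring A R \<and> noetherian_ring (sub A) \<and> D \<union> G \<subseteq> A \<and>
    (\<forall>S. subring S R \<longrightarrow> D \<union> G \<subseteq> S \<longrightarrow> A \<subseteq> S)"
  using assms(3,4)
proof (induction G rule: finite_induct)
  case empty
  then show ?case using assms(1,2) by (intro exI[of _ D]) auto
next
  case (insert x G)
  then obtain A where A: "subring A R" "noetherian_ring (sub A)" "D \<union> G \<subseteq> A"
    "\<And>S. subring S R \<Longrightarrow> D \<union> G \<subseteq> S \<Longrightarrow> A \<subseteq> S" by auto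
  have x: "x \<in> carrier R" using insert by auto
  show ?case
    using adjoin_subring[OF A(1) x] adjoin_noetherian[OF A(1) x A(2)] adjoin_base[OF A(1) x] A(3,4)
      adjoin_minimal[OF A(1) x]
    by (intro exI[of _ "adjoin A x"] conjI) (assumption, assumption, blast, simp)
qed

end

section \<open>Relations modulo the maximal ideal\<close>

context field
begin

section \<open>Krull's intersection theorem for the powers of one element\<close>

lemma ideal_colon:
  assumes "subring A R" "ideal I (sub A)" "z \<in> A"
  shows "ideal {d \<in> A. z \<otimes> d \<in> I} (sub A)"
proof (rule ideal_subI[OF assms(1)])
  note c[simp] = subring_closed[OF assms(1)]
  note i = ideal_subD[OF assms(1,2)]
  show "\<zero> \<in> {d \<in> A. z \<otimes> d \<in> I}" using assms(3) i(4) by simp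
  show "p \<oplus> q \<in> {d \<in> A. z \<otimes> d \<in> I}" if "p \<in> {d \<in> A. z \<otimes> d \<in> I}" "q \<in> {d \<in> A. z \<otimes> d \<in> I}" for p q
    using that i(5)[of "z \<otimes> p" "z \<otimes> q"] assms(3) by (simp add: r_distr)
  show "a \<otimes> p \<in> {d \<in> A. z \<otimes> d \<in> I}" if "a \<in> A" "p \<in> {d \<in> A. z \<otimes> d \<in> I}" for a p
    using that i(6)[of a "z \<otimes> p"] assms(3) by (simp add: m_lcomm)
qed auto

lemma local_unit_minus:
  assumes "subring A R" "local_ring (sub A)" "x \<in> max_ideal (sub A)"
  shows "inv (\<one> \<ominus> x) \<in> A" "\<one> \<ominus> x \<in> A" "\<one> \<ominus> x \<noteq> \<zero>"
proof -
  note c[simp] = subring_closed[OF assms(1)]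
  note m = local_ring_max_ideal[OF assms(1,2)]
  note p = primeideal_subD[OF assms(1) maximal_sub_prime[OF assms(1) m(1)]]
  note i = ideal_subD[OF assms(1) p(1)]
  show o: "\<one> \<ominus> x \<in> A" using i(2)[OF assms(3)] by simp
  have "\<one> \<ominus> x \<notin> max_ideal (sub A)"
  proof
    assume "\<one> \<ominus> x \<in> max_ideal (sub A)"
    then have "(\<one> \<ominus> x) \<oplus> x \<in> max_ideal (sub A)" using i(5) assms(3) by blast
    moreover have "(\<one> \<ominus> x) \<oplus> x = \<one>" using i(3)[OF assms(3)] by (simp add: a_minus_def a_assoc l_neg)
    ultimately show False using p(2) by simp
  qed
  then show "inv (\<one> \<ominus> x) \<in> A" "\<one> \<ominus> x \<noteq> \<zero>" using m(3)[OF o] by auto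
qed

text \<open>This is the intersection theorem in \<open>D/uD\<close> for the powers of
  \<open>x\<close>. It needs the chain condition twice: for the colon ideals
  \<open>uD : x^n\<close>, and for the ideals generated by successive coefficients
  \<open>c n\<close> modulo the stable colon ideal. The second makes
  \<open>(\<one> \<ominus> x \<otimes> d) \<otimes> c n\<close> an element of the colon ideal, and
  the factor in front is a unit.\<close>

lemma krull_intersection:
  assumes D: "subring D R" "local_ring (sub D)" "noetherian_ring (sub D)"
    and u: "u \<in> D" and x: "x \<in> max_ideal (sub D)"
    and e: "e \<in> D" "\<And>k::nat. \<exists>a\<in>D. \<exists>c\<in>D. e = a \<otimes> u \<oplus> c \<otimes> x [^] k"
  shows "\<exists>a\<in>D. e = a \<otimes> u"
proof -
  note c[simp] = subring_closed[OF D(1)]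
  note m = local_ring_max_ideal[OF D(1,2)]
  note p = primeideal_subD[OF D(1) maximal_sub_prime[OF D(1) m(1)]]
  note i = ideal_subD[OF D(1) p(1)]
  have [simp]: "x \<in> D" "u \<in> D" using i(2) x u by auto
  define U where "U = {a \<otimes> u | a. a \<in> D}"
  have Ui: "ideal U (sub D)" unfolding U_def by (rule principal_ideal[OF D(1)]) auto
  note U = ideal_subD[OF D(1) Ui]
  define Q where "Q n = {d \<in> D. x [^] (n::nat) \<otimes> d \<in> U}" for n
  have Qi: "ideal (Q n) (sub D)" for n unfolding Q_def by (rule ideal_colon[OF D(1) Ui]) simp
  have Qinc: "Q n \<subseteq> Q (Suc n)" for n
  proof
    fix d assume "d \<in> Q n"
    then have d: "d \<in> D" "x [^] n \<otimes> d \<in> U" by (auto simp: Q_def)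
    then have "x \<otimes> (x [^] n \<otimes> d) \<in> U" using U(6) by simp
    moreover have "x \<otimes> (x [^] n \<otimes> d) = x [^] Suc n \<otimes> d" using d by (simp add: m_ac)
    ultimately show "d \<in> Q (Suc n)" using d by (simp add: Q_def)
  qed
  obtain N where N: "\<And>n. n \<ge> N \<Longrightarrow> Q n = Q N"
    using noetherian_sub_chain[where I = Q, OF D(1,3) Qi Qinc] by auto
  obtain a c where ac: "\<And>k. a k \<in> D" "\<And>k. c k \<in> D" "\<And>k::nat. e = a k \<otimes> u \<oplus> c k \<otimes> x [^] k"
    using e(2) by metis
  \<comment> \<open>Subtracting the expansions of \<open>e\<close> for \<open>n\<close> and
    \<open>Suc n\<close> shows that \<open>x [^] n\<close> times this difference is a multiple of
    \<open>u\<close>.\<close>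
  have step: "c n \<ominus> x \<otimes> c (Suc n) \<in> Q N" if "n \<ge> N" for n
  proof -
    have cr: "a n \<in> carrier R" "c n \<in> carrier R" "a (Suc n) \<in> carrier R" "c (Suc n) \<in> carrier R" "x [^] n \<in> carrier R"
      "x \<in> carrier R" "u \<in> carrier R" using ac by auto
    have "x [^] n \<otimes> (c n \<ominus> x \<otimes> c (Suc n)) = (a n \<otimes> u \<oplus> c n \<otimes> x [^] n) \<ominus> (a (Suc n) \<otimes> u \<oplus> c (Suc n) \<otimes> (x [^] n \<otimes> x)) \<oplus> (a (Suc n) \<ominus> a n) \<otimes> u"
      using cr by algebra
    also have "x [^] n \<otimes> x = x [^] Suc n" by simp
    also have "(a n \<otimes> u \<oplus> c n \<otimes> x [^] n) \<ominus> (a (Suc n) \<otimes> u \<oplus> c (Suc n) \<otimes> (x [^] Suc n)) = \<zero>"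
      using ac(3)[of n] ac(3)[of "Suc n"] e(1) by (metis c(1) r_right_minus_eq)
    finally have "x [^] n \<otimes> (c n \<ominus> x \<otimes> c (Suc n)) = (a (Suc n) \<ominus> a n) \<otimes> u" using cr by simp
    then have "c n \<ominus> x \<otimes> c (Suc n) \<in> Q n" using ac by (auto simp: Q_def U_def)
    then show ?thesis using N[OF that] by simp
  qed
  note q = ideal_subD[OF D(1) Qi]
  \<comment> \<open>By \<open>step\<close>, \<open>c (N + n)\<close> is a multiple of
    \<open>c (N + Suc n)\<close> modulo \<open>Q N\<close>, so these ideals increase.\<close>
  define I where "I n = {y \<oplus> q | y q. y \<in> {d \<otimes> c (N + n) | d. d \<in> D} \<and> q \<in> Q N}" for n
  have Ii: "ideal (I n) (sub D)" for n unfolding I_def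
    by (intro ideal_sum[OF D(1)] principal_ideal[OF D(1)] Qi) (use ac in auto)
  have Iinc: "I n \<subseteq> I (Suc n)" for n
  proof
    fix z assume "z \<in> I n"
    then obtain d r where dr: "d \<in> D" "r \<in> Q N" "z = d \<otimes> c (N + n) \<oplus> r" by (auto simp: I_def)
    let ?s = "c (N + n) \<ominus> x \<otimes> c (Suc (N + n))"
    have s: "?s \<in> Q N" by (rule step) simp
    have cr: "c (N + n) \<in> carrier R" "c (Suc (N + n)) \<in> carrier R" "d \<in> carrier R" "r \<in> carrier R" "x \<in> carrier R"
      using ac(2) dr q(3) by auto
    have "z = (d \<otimes> x) \<otimes> c (N + Suc n) \<oplus> (d \<otimes> ?s \<oplus> r)" unfolding dr(3) add_Suc_right using cr by algebra
    moreover have "d \<otimes> ?s \<oplus> r \<in> Q N" using q(5,6) s dr by blast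
    moreover have "d \<otimes> x \<in> D" using dr by simp
    ultimately show "z \<in> I (Suc n)" unfolding I_def by blast
  qed
  obtain M where M: "\<And>n. n \<ge> M \<Longrightarrow> I n = I M"
    using noetherian_sub_chain[where I = I, OF D(1,3) Ii Iinc] by auto
  let ?n = "N + M"
  have "c (Suc ?n) = \<one> \<otimes> c (N + Suc M) \<oplus> \<zero>" using ac(2) by simp
  then have "c (Suc ?n) \<in> I (Suc M)" unfolding I_def using c(3) q(4) by blast
  moreover have "I (Suc M) = I M" by (rule M) simp
  ultimately have "c (Suc ?n) \<in> I M" by simp
  then obtain d r where dr: "d \<in> D" "r \<in> Q N" "c (Suc ?n) = d \<otimes> c ?n \<oplus> r" by (auto simp: I_def)
  let ?s = "c ?n \<ominus> x \<otimes> c (Suc ?n)"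
  have s: "?s \<in> Q N" by (rule step) simp
  have cr: "c ?n \<in> carrier R" "d \<in> carrier R" "r \<in> carrier R" "x \<in> carrier R"
    using ac(2) dr q(3) by auto
  have "(\<one> \<ominus> x \<otimes> d) \<otimes> c ?n = ?s \<oplus> x \<otimes> r" unfolding dr(3) using cr by algebra
  moreover have "?s \<oplus> x \<otimes> r \<in> Q N" using q(5,6) s dr by simp
  ultimately have 1: "(\<one> \<ominus> x \<otimes> d) \<otimes> c ?n \<in> Q N" by simp
  have "x \<otimes> d \<in> max_ideal (sub D)" using i(7) x dr by blast
  note w = local_unit_minus[OF D(1,2) this]
  have "inv (\<one> \<ominus> x \<otimes> d) \<otimes> ((\<one> \<ominus> x \<otimes> d) \<otimes> c ?n) \<in> Q N" using q(6) 1 w by blast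
  moreover have "inv (\<one> \<ominus> x \<otimes> d) \<otimes> ((\<one> \<ominus> x \<otimes> d) \<otimes> c ?n) = c ?n"
    using w field_inv[of "\<one> \<ominus> x \<otimes> d"] cr by (simp flip: m_assoc)
  moreover have "Q ?n = Q N" by (rule N) simp
  ultimately have "c ?n \<in> Q ?n" by simp
  then have "x [^] ?n \<otimes> c ?n \<in> U" by (simp add: Q_def)
  then obtain b where b: "b \<in> D" "x [^] ?n \<otimes> c ?n = b \<otimes> u" by (auto simp: U_def)
  have "e = a ?n \<otimes> u \<oplus> x [^] ?n \<otimes> c ?n" using ac(3)[of ?n] cr by (simp add: m_comm)
  then have "e = (a ?n \<oplus> b) \<otimes> u" using b ac(1) by (simp add: l_distr)
  then show ?thesis using c(6)[OF ac(1) b(1)] by blast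
qed

end

text \<open>Orders are taken modulo \<open>x\<close> and measured by powers of \<open>y\<close>, so
  the generators form an ordered pair; \<open>swap\<close> exchanges their roles.\<close>

locale two_generated_local = field +
  fixes D :: "'a set" and x y :: 'a
  assumes D: "subring D R" "local_ring (sub D)" "noetherian_ring (sub D)"
    and xy: "x \<in> D" "y \<in> D"
    and max: "max_ideal (sub D) = {x \<otimes> a \<oplus> y \<otimes> b | a b. a \<in> D \<and> b \<in> D}"
begin

lemmas D_closed [simp] = subring_closed[OF D(1)] xy

abbreviation \<mm> :: "'a set" where "\<mm> \<equiv> max_ideal (sub D)"

lemma max_prime: "primeideal \<mm> (sub D)"
  using maximal_sub_prime[OF D(1)] local_ring_max_ideal(1)[OF D(1,2)] by blast

lemmas max_primeD = primeideal_subD[OF D(1) max_prime]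
lemmas max_idealD = ideal_subD[OF D(1) max_primeD(1)]
lemmas non_max_unit = local_ring_max_ideal(3)[OF D(1,2)]

lemma xy_max: "x \<in> \<mm>" "y \<in> \<mm>"
proof -
  have "x = x \<otimes> \<one> \<oplus> y \<otimes> \<zero>" "y = x \<otimes> \<zero> \<oplus> y \<otimes> \<one>" by simp_all
  then show "x \<in> \<mm>" "y \<in> \<mm>" unfolding max using D_closed(2,3) by blast+
qed

text \<open>The product of the maximal ideal with \<open>I\<close>. As \<open>x\<close> and
  \<open>y\<close> generate the maximal ideal, two summands suffice.\<close>

definition max_mult :: "'a set \<Rightarrow> 'a set" where
  "max_mult I = {x \<otimes> a \<oplus> y \<otimes> b | a b. a \<in> I \<and> b \<in> I}"

lemma max_mult_ideal:
  assumes "ideal I (sub D)"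
  shows "ideal (max_mult I) (sub D)" "\<gamma> \<in> \<mm> \<Longrightarrow> g \<in> I \<Longrightarrow> \<gamma> \<otimes> g \<in> max_mult I"
proof -
  note i = ideal_subD[OF D(1) assms]
  show "ideal (max_mult I) (sub D)"
  proof (rule ideal_subI[OF D(1)])
    show "max_mult I \<subseteq> D" using i(2) by (auto simp: max_mult_def)
    have "\<zero> = x \<otimes> \<zero> \<oplus> y \<otimes> \<zero>" by simp
    then show "\<zero> \<in> max_mult I" unfolding max_mult_def using i(4) by blast
    show "p \<oplus> q \<in> max_mult I" if pq: "p \<in> max_mult I" "q \<in> max_mult I" for p q
    proof -
      obtain a b a' b' where e: "a \<in> I" "b \<in> I" "a' \<in> I" "b' \<in> I" "p = x \<otimes> a \<oplus> y \<otimes> b" "q = x \<otimes> a' \<oplus> y \<otimes> b'"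
        using pq by (auto simp: max_mult_def)
      have cr: "a \<in> carrier R" "b \<in> carrier R" "a' \<in> carrier R" "b' \<in> carrier R" "x \<in> carrier R" "y \<in> carrier R"
        using e i(3) by auto
      have "p \<oplus> q = x \<otimes> (a \<oplus> a') \<oplus> y \<otimes> (b \<oplus> b')" unfolding e using cr by algebra
      then show ?thesis unfolding max_mult_def using i(5) e by blast
    qed
    show "d \<otimes> p \<in> max_mult I" if dp: "d \<in> D" "p \<in> max_mult I" for d p
    proof -
      obtain a b where e: "a \<in> I" "b \<in> I" "p = x \<otimes> a \<oplus> y \<otimes> b"
        using dp by (auto simp: max_mult_def)
      have cr: "a \<in> carrier R" "b \<in> carrier R" "d \<in> carrier R" "x \<in> carrier R" "y \<in> carrier R"
        using e i(3) dp by auto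
      have "d \<otimes> p = x \<otimes> (d \<otimes> a) \<oplus> y \<otimes> (d \<otimes> b)" unfolding e using cr by algebra
      then show ?thesis unfolding max_mult_def using i(6) e dp by blast
    qed
  qed
  assume g: "\<gamma> \<in> \<mm>" "g \<in> I"
  then obtain a b where e: "a \<in> D" "b \<in> D" "\<gamma> = x \<otimes> a \<oplus> y \<otimes> b" by (auto simp: max)
  have cr: "a \<in> carrier R" "b \<in> carrier R" "g \<in> carrier R" "x \<in> carrier R" "y \<in> carrier R"
    using e i(3) g by auto
  have "\<gamma> \<otimes> g = x \<otimes> (a \<otimes> g) \<oplus> y \<otimes> (b \<otimes> g)" unfolding e using cr by algebra
  then show "\<gamma> \<otimes> g \<in> max_mult I" unfolding max_mult_def using i(6) e g by blast
qed

text \<open>Modulo \<open>x\<close> the ring \<open>D\<close> is a discrete valuation ring or an Artinian local ring, with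
  maximal ideal generated by \<open>y\<close>; \<open>attains I t\<close> says that \<open>I\<close> contains an element of order \<open>t\<close> modulo \<open>x\<close>.\<close>

definition attains :: "'a set \<Rightarrow> nat \<Rightarrow> bool" where
  "attains I t \<longleftrightarrow> (\<exists>h\<in>D. y [^] t \<oplus> x \<otimes> h \<in> I)"

text \<open>Let \<open>k\<close> be least such that \<open>e\<close> is not in
  \<open>x D + y^k D\<close>. Then \<open>k = Suc t\<close>, and the coefficient of
  \<open>y^t\<close> is a unit: if it lay in the ideal generated by \<open>x\<close> and
  \<open>y\<close>, one more factor \<open>y\<close> could be split off. Without such a
  \<open>k\<close>, Krull's theorem puts \<open>e\<close> in \<open>x D\<close>.\<close>

lemma order_mod_x:
  assumes "e \<in> D"
  shows "(\<exists>h\<in>D. e = x \<otimes> h) \<or> (\<exists>v\<in>D - \<mm>. \<exists>t. \<exists>h\<in>D. e = v \<otimes> y [^] (t::nat) \<oplus> x \<otimes> h)"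
proof (cases "\<forall>k::nat. \<exists>a\<in>D. \<exists>c\<in>D. e = a \<otimes> x \<oplus> c \<otimes> y [^] k")
  case True
  then have "\<exists>a\<in>D. e = a \<otimes> x" by (intro krull_intersection[OF D xy(1) xy_max(2) assms]) auto
  then show ?thesis by (auto simp: m_comm)
next
  case False
  define P where "P k \<longleftrightarrow> (\<exists>a\<in>D. \<exists>c\<in>D. e = a \<otimes> x \<oplus> c \<otimes> y [^] k)" for k :: nat
  have ex: "\<exists>k. \<not> P k" using False by (auto simp: P_def)
  define k where "k = (LEAST k. \<not> P k)"
  have k: "\<not> P k" unfolding k_def using LeastI_ex[OF ex] .
  have k': "P j" if "j < k" for j using not_less_Least that unfolding k_def by blast
  have "e = \<zero> \<otimes> x \<oplus> e \<otimes> y [^] (0::nat)" using assms by simp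
  then have "P 0" unfolding P_def using assms D_closed(2) by blast
  then obtain t where t: "k = Suc t" using k by (cases k) auto
  then obtain a c where ac: "a \<in> D" "c \<in> D" "e = a \<otimes> x \<oplus> c \<otimes> y [^] t" using k'[of t] by (auto simp: P_def)
  have "c \<notin> \<mm>"
  proof
    assume "c \<in> \<mm>"
    then obtain \<alpha> \<beta> where b: "\<alpha> \<in> D" "\<beta> \<in> D" "c = x \<otimes> \<alpha> \<oplus> y \<otimes> \<beta>" by (auto simp: max)
    have cr: "\<alpha> \<in> carrier R" "\<beta> \<in> carrier R" "a \<in> carrier R" "x \<in> carrier R" "y \<in> carrier R" "y [^] t \<in> carrier R"
      using ac b by auto
    have "e = (a \<oplus> \<alpha> \<otimes> y [^] t) \<otimes> x \<oplus> \<beta> \<otimes> (y [^] t \<otimes> y)" unfolding ac b using cr by algebra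
    then have "e = (a \<oplus> \<alpha> \<otimes> y [^] t) \<otimes> x \<oplus> \<beta> \<otimes> y [^] k" unfolding t by simp
    moreover have "a \<oplus> \<alpha> \<otimes> y [^] t \<in> D" using ac b by simp
    ultimately show False using k b unfolding P_def by blast
  qed
  moreover have "e = c \<otimes> y [^] t \<oplus> x \<otimes> a" using ac by (simp add: m_comm a_comm)
  ultimately show ?thesis using ac by blast
qed

lemma attainsI:
  assumes "ideal I (sub D)" "v \<in> D - \<mm>" "h \<in> D" "v \<otimes> y [^] t \<oplus> x \<otimes> h \<in> I"
  shows "attains I t"
proof -
  note i = ideal_subD[OF D(1) assms(1)]
  have v: "v \<in> D" "inv v \<in> D" "v \<noteq> \<zero>" "v \<in> carrier R" using non_max_unit[of v] assms(2) by auto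
  note iv = field_inv[OF v(4,3)]
  have cr: "v \<in> carrier R" "inv v \<in> carrier R" "y [^] t \<in> carrier R" "x \<in> carrier R" "h \<in> carrier R"
    using v iv assms by auto
  have "inv v \<otimes> (v \<otimes> y [^] t \<oplus> x \<otimes> h) = (inv v \<otimes> v) \<otimes> y [^] t \<oplus> x \<otimes> (inv v \<otimes> h)" using cr by algebra
  then have "inv v \<otimes> (v \<otimes> y [^] t \<oplus> x \<otimes> h) = y [^] t \<oplus> x \<otimes> (inv v \<otimes> h)" using iv cr by simp
  moreover have "inv v \<otimes> (v \<otimes> y [^] t \<oplus> x \<otimes> h) \<in> I" using i(6) v assms(4) by blast
  ultimately show ?thesis unfolding attains_def using v assms(3) D_closed(5) by (metis)
qed

text \<open>Linear dependence of the classes of the \<open>e j\<close> in \<open>I/\<mm>I\<close>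
  over the residue field, with coefficients lifted to \<open>D\<close>: a coefficient outside
  \<open>\<mm>\<close> is one that is nonzero in the residue field.\<close>

definition max_dependent :: "'a set \<Rightarrow> 'i set \<Rightarrow> ('i \<Rightarrow> 'a) \<Rightarrow> bool" where
  "max_dependent I T e \<longleftrightarrow> (\<exists>\<epsilon>. (\<forall>j\<in>T. \<epsilon> j \<in> D) \<and> (\<exists>j\<in>T. \<epsilon> j \<notin> \<mm>) \<and> (\<Oplus>j\<in>T. \<epsilon> j \<otimes> e j) \<in> max_mult I)"

text \<open>One step of Gaussian elimination in \<open>I/\<mm>I\<close>: subtracting multiples of a
  pivot \<open>e j0\<close> moves the coefficients of \<open>g\<close> into \<open>\<mm>\<close>, so
  the \<open>g\<close> terms vanish modulo \<open>\<mm>I\<close>. What remains is \<open>z\<close>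
  times a family in \<open>K\<close>, and \<open>z\<close> maps \<open>\<mm>K\<close> into
  \<open>\<mm>I\<close>.\<close>

lemma dependent_elimination:
  fixes T :: "'i set"
  assumes I: "ideal I (sub D)" and g: "g \<in> I" and T: "finite T" "T \<noteq> {}"
    and cd: "\<And>j. j \<in> T \<Longrightarrow> c j \<in> D" "\<And>j. j \<in> T \<Longrightarrow> d j \<in> K" "\<And>j. j \<in> T \<Longrightarrow> e j = c j \<otimes> g \<oplus> z \<otimes> d j"
    and K: "ideal K (sub D)" "z \<in> D" "\<And>u. u \<in> K \<Longrightarrow> z \<otimes> u \<in> I"
    and dep: "\<And>j0 \<delta>. j0 \<in> T \<Longrightarrow> (\<And>j. j \<in> T \<Longrightarrow> \<delta> j \<in> D) \<Longrightarrow> max_dependent K (T - {j0}) (\<lambda>j. d j \<ominus> \<delta> j \<otimes> d j0)"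
  shows "max_dependent I T e"
proof -
  note i = ideal_subD[OF D(1) I] and k = ideal_subD[OF D(1) K(1)]
  \<comment> \<open>The pivot is an index whose coefficient of \<open>g\<close> is a unit. If there
    is none, all coefficients are already in \<open>\<mm>\<close>, and any index serves with zero
    multipliers.\<close>
  obtain j0 \<delta> where j0: "j0 \<in> T" "\<And>j. j \<in> T \<Longrightarrow> \<delta> j \<in> D" "\<And>j. j \<in> T \<Longrightarrow> c j \<ominus> \<delta> j \<otimes> c j0 \<in> \<mm>"
  proof (cases "\<exists>j0\<in>T. c j0 \<notin> \<mm>")
    case True
    then obtain j0 where j0: "j0 \<in> T" "c j0 \<notin> \<mm>" by auto
    have v: "inv (c j0) \<in> D" "c j0 \<noteq> \<zero>" "c j0 \<in> D" using non_max_unit j0 cd by auto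
    then have 1: "c j0 \<in> carrier R" by simp
    show ?thesis
    proof (rule that[OF j0(1), of "\<lambda>j. c j \<otimes> inv (c j0)"])
      show "c j \<otimes> inv (c j0) \<in> D" if "j \<in> T" for j using v cd that by simp
      show "c j \<ominus> c j \<otimes> inv (c j0) \<otimes> c j0 \<in> \<mm>" if "j \<in> T" for j
      proof -
        have "c j \<otimes> inv (c j0) \<otimes> c j0 = c j" using field_inv[OF 1 v(2)] v cd(1)[OF that] by (simp add: m_assoc)
        then have "c j \<ominus> c j \<otimes> inv (c j0) \<otimes> c j0 = \<zero>" using cd(1)[OF that] by (simp add: a_minus_def r_neg)
        then show ?thesis using max_idealD(4) by simp
      qed
    qed
  next
    case False
    obtain j0 where j0: "j0 \<in> T" using T by auto
    show ?thesis
    proof (rule that[OF j0, of "\<lambda>j. \<zero>"])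
      show "c j \<ominus> \<zero> \<otimes> c j0 \<in> \<mm>" if "j \<in> T" for j
        using False cd(1)[OF that] cd(1)[OF j0] that by (simp add: a_minus_def)
    qed simp
  qed
  let ?T = "T - {j0}"
  define f where "f j = d j \<ominus> \<delta> j \<otimes> d j0" for j
  define \<gamma> where "\<gamma> j = c j \<ominus> \<delta> j \<otimes> c j0" for j
  have "max_dependent K ?T f" unfolding f_def using dep j0 by blast
  then obtain \<epsilon> where e: "\<And>j. j \<in> ?T \<Longrightarrow> \<epsilon> j \<in> D" "\<exists>j\<in>?T. \<epsilon> j \<notin> \<mm>" "(\<Oplus>j\<in>?T. \<epsilon> j \<otimes> f j) \<in> max_mult K"
    by (auto simp: max_dependent_def)
  have fK: "f j \<in> K" if "j \<in> T" for j unfolding f_def using k(6,9) cd(2) j0 that by simp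
  have gm: "\<gamma> j \<in> \<mm>" if "j \<in> T" for j unfolding \<gamma>_def using j0 that by simp
  define S where "S = (\<Oplus>j\<in>?T. \<epsilon> j \<otimes> \<delta> j)"
  have SD: "S \<in> D" unfolding S_def using e(1) j0(2) by (intro ideal_finsum[OF D(1) carrier_ideal[OF D(1)]]) auto
  \<comment> \<open>The coefficient of the pivot collects the multiples of \<open>e j0\<close> that
    were subtracted from the other members.\<close>
  define \<epsilon>' where "\<epsilon>' j = (if j = j0 then \<ominus> S else \<epsilon> j)" for j
  have e': "\<epsilon>' j \<in> D" if "j \<in> T" for j using that e(1) SD by (auto simp: \<epsilon>'_def)
  have ej0: "e j0 \<in> carrier R" "g \<in> carrier R" "z \<in> carrier R"
    using cd j0(1) g i(3) k(3) K(2) by auto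
  have eq: "\<epsilon> j \<otimes> e j = (\<epsilon> j \<otimes> \<gamma> j) \<otimes> g \<oplus> (z \<otimes> (\<epsilon> j \<otimes> f j) \<oplus> (\<epsilon> j \<otimes> \<delta> j) \<otimes> e j0)" if "j \<in> ?T" for j
  proof -
    have j: "j \<in> T" using that by simp
    have cr: "\<epsilon> j \<in> carrier R" "c j \<in> carrier R" "d j \<in> carrier R" "\<delta> j \<in> carrier R" "c j0 \<in> carrier R" "d j0 \<in> carrier R"
      using e(1)[OF that] cd(1,2) j0 j k(3) by auto
    show ?thesis unfolding cd(3)[OF j] cd(3)[OF j0(1)] f_def \<gamma>_def using cr ej0(2,3) by algebra
  qed
  have cl: "\<epsilon> j \<in> carrier R" "f j \<in> carrier R" "\<gamma> j \<in> carrier R" "\<delta> j \<in> carrier R" "e j \<in> carrier R" if "j \<in> ?T" for j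
    using e(1) fK gm j0(2) that k(3) max_idealD(3) cd(3) cd(1,2) ej0 by auto
  have fT: "finite ?T" using T by simp
  have "(\<Oplus>j\<in>T. \<epsilon>' j \<otimes> e j) = (\<Oplus>j\<in>insert j0 ?T. \<epsilon>' j \<otimes> e j)" using j0(1) by (simp add: insert_absorb)
  also have "\<dots> = \<epsilon>' j0 \<otimes> e j0 \<oplus> (\<Oplus>j\<in>?T. \<epsilon>' j \<otimes> e j)"
    by (rule finsum_insert[OF fT]) (use e' ej0 cl j0(1) in auto)
  also have "(\<Oplus>j\<in>?T. \<epsilon>' j \<otimes> e j) = (\<Oplus>j\<in>?T. (\<epsilon> j \<otimes> \<gamma> j) \<otimes> g \<oplus> (z \<otimes> (\<epsilon> j \<otimes> f j) \<oplus> (\<epsilon> j \<otimes> \<delta> j) \<otimes> e j0))"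
    by (rule finsum_cong') (use eq cl ej0 in \<open>auto simp: \<epsilon>'_def\<close>)
  also have "\<dots> = (\<Oplus>j\<in>?T. (\<epsilon> j \<otimes> \<gamma> j) \<otimes> g) \<oplus> ((\<Oplus>j\<in>?T. z \<otimes> (\<epsilon> j \<otimes> f j)) \<oplus> (\<Oplus>j\<in>?T. (\<epsilon> j \<otimes> \<delta> j) \<otimes> e j0))"
    using cl ej0 by (subst finsum_addf, auto)+
  also have "(\<Oplus>j\<in>?T. (\<epsilon> j \<otimes> \<gamma> j) \<otimes> g) = (\<Oplus>j\<in>?T. \<epsilon> j \<otimes> \<gamma> j) \<otimes> g"
    by (rule finsum_ldistr[OF fT, symmetric]) (use cl ej0 in auto)
  also have "(\<Oplus>j\<in>?T. z \<otimes> (\<epsilon> j \<otimes> f j)) = z \<otimes> (\<Oplus>j\<in>?T. \<epsilon> j \<otimes> f j)"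
    by (rule finsum_rdistr[OF fT, symmetric]) (use cl ej0 in auto)
  also have "(\<Oplus>j\<in>?T. (\<epsilon> j \<otimes> \<delta> j) \<otimes> e j0) = S \<otimes> e j0"
    unfolding S_def by (rule finsum_ldistr[OF fT, symmetric]) (use cl ej0 in auto)
  finally have sum: "(\<Oplus>j\<in>T. \<epsilon>' j \<otimes> e j) = \<epsilon>' j0 \<otimes> e j0 \<oplus> ((\<Oplus>j\<in>?T. \<epsilon> j \<otimes> \<gamma> j) \<otimes> g \<oplus> (z \<otimes> (\<Oplus>j\<in>?T. \<epsilon> j \<otimes> f j) \<oplus> S \<otimes> e j0))" .
  have Gm: "(\<Oplus>j\<in>?T. \<epsilon> j \<otimes> \<gamma> j) \<in> \<mm>"
    by (rule ideal_finsum[OF D(1) max_primeD(1)]) (use e(1) gm max_idealD(6) in auto)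
  obtain a b where ab: "a \<in> K" "b \<in> K" "(\<Oplus>j\<in>?T. \<epsilon> j \<otimes> f j) = x \<otimes> a \<oplus> y \<otimes> b" using e(3) by (auto simp: max_mult_def)
  have "z \<otimes> (x \<otimes> a \<oplus> y \<otimes> b) = x \<otimes> (z \<otimes> a) \<oplus> y \<otimes> (z \<otimes> b)"
  proof -
    have "a \<in> carrier R" "b \<in> carrier R" "x \<in> carrier R" "y \<in> carrier R" using ab k(3) by auto
    then show ?thesis using ej0 by algebra
  qed
  then have zm: "z \<otimes> (\<Oplus>j\<in>?T. \<epsilon> j \<otimes> f j) \<in> max_mult I" unfolding ab(3) max_mult_def using K(3) ab by blast
  have gg: "(\<Oplus>j\<in>?T. \<epsilon> j \<otimes> \<gamma> j) \<otimes> g \<in> max_mult I" by (rule max_mult_ideal(2)[OF I Gm g])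
  note mm = ideal_subD[OF D(1) max_mult_ideal(1)[OF I]]
  have "\<epsilon>' j0 \<otimes> e j0 \<oplus> ((\<Oplus>j\<in>?T. \<epsilon> j \<otimes> \<gamma> j) \<otimes> g \<oplus> (z \<otimes> (\<Oplus>j\<in>?T. \<epsilon> j \<otimes> f j) \<oplus> S \<otimes> e j0)) =
    (\<Oplus>j\<in>?T. \<epsilon> j \<otimes> \<gamma> j) \<otimes> g \<oplus> z \<otimes> (\<Oplus>j\<in>?T. \<epsilon> j \<otimes> f j)"
  proof -
    have gen: "(\<ominus> s) \<otimes> w \<oplus> (p \<oplus> (q \<oplus> s \<otimes> w)) = p \<oplus> q"
      if "p \<in> carrier R" "q \<in> carrier R" "s \<in> carrier R" "w \<in> carrier R" for p q s w
      using that by algebra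
    have "\<epsilon>' j0 = \<ominus> S" "S \<in> carrier R" using SD by (simp_all add: \<epsilon>'_def)
    then show ?thesis using gen[OF mm(3)[OF gg] mm(3)[OF zm] _ ej0(1), of S] by simp
  qed
  then have "(\<Oplus>j\<in>T. \<epsilon>' j \<otimes> e j) \<in> max_mult I" unfolding sum using mm(5) zm gg by simp
  moreover have "\<exists>j\<in>T. \<epsilon>' j \<notin> \<mm>" using e(2) by (auto simp: \<epsilon>'_def)
  ultimately show ?thesis unfolding max_dependent_def using e' by blast
qed

text \<open>Let \<open>g \<in> I\<close> have the least order \<open>t0\<close> modulo \<open>x\<close>.  As long as \<open>I : x\<^sup>k\<close> contains no element of
  order less than \<open>t0\<close>, one has \<open>I = g D + x\<^sup>k (I : x\<^sup>k)\<close>.  If this goes on forever, \<open>I = g D\<close> by Krull;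
  otherwise eliminating \<open>g\<close> costs one element and reduces to \<open>I : x\<^sup>k\<close>, which has smaller order.\<close>

lemma dependent_if_attains:
  fixes T :: "'i set"
  assumes "ideal I (sub D)" "attains I s" "finite T" "card T \<ge> s + 2" "\<And>j. j \<in> T \<Longrightarrow> e j \<in> I"
  shows "max_dependent I T e"
  using assms
proof (induction s arbitrary: I T e rule: less_induct)
  case (less s)
  note I = less.prems(1)
  note i = ideal_subD[OF D(1) I]
  define t0 where "t0 = (LEAST t. attains I t)"
  have t0: "attains I t0" "t0 \<le> s" unfolding t0_def using LeastI[of "attains I"] less.prems(2) Least_le by blast+
  obtain h0 where h0: "h0 \<in> D" "y [^] t0 \<oplus> x \<otimes> h0 \<in> I" using t0(1) by (auto simp: attains_def)
  define g where "g = y [^] t0 \<oplus> x \<otimes> h0"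
  have gI: "g \<in> I" using h0 by (simp add: g_def)
  define K where "K k = {d \<in> D. x [^] (k::nat) \<otimes> d \<in> I}" for k
  have Ki: "ideal (K k) (sub D)" for k unfolding K_def by (rule ideal_colon[OF D(1) I]) simp
  note k = ideal_subD[OF D(1) Ki]
  have gK: "g \<in> K k" for k using gI i(2,6) by (simp add: K_def)
  \<comment> \<open>The order \<open>t\<close> of \<open>d\<close> is at least \<open>t0\<close>, so
    a multiple of \<open>g\<close> with factor \<open>v y^(t - t0)\<close> cancels the power of
    \<open>y\<close>. The rest is divisible by \<open>x\<close>, and as \<open>g\<close> lies in
    \<open>K k\<close> too, the quotient lies in \<open>K (Suc k)\<close>.\<close>
  have step: "\<exists>c\<in>D. \<exists>d'\<in>K (Suc k). d = c \<otimes> g \<oplus> x \<otimes> d'"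
    if no: "\<And>t. t < t0 \<Longrightarrow> \<not> attains (K k) t" and d: "d \<in> K k" for k d
  proof -
    have sh: "d' \<in> K (Suc k)" if "d' \<in> D" "x \<otimes> d' \<in> K k" for d'
      using that by (simp add: K_def m_assoc)
    have dD: "d \<in> D" using k(2) d .
    consider h where "h \<in> D" "d = x \<otimes> h"
      | v t h where "v \<in> D - \<mm>" "h \<in> D" "d = v \<otimes> y [^] (t::nat) \<oplus> x \<otimes> h"
      using order_mod_x[OF dD] by blast
    then show ?thesis
    proof cases
      case 1
      then have "d = \<zero> \<otimes> g \<oplus> x \<otimes> h" using i(3)[OF gI] by simp
      moreover have "h \<in> K (Suc k)" using sh 1 d by simp
      ultimately show ?thesis using D_closed(2) by blast
    next
      case 2
      have "attains (K k) t" using attainsI[OF Ki 2(1,2)] 2(3) d by simp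
      then have le: "t0 \<le> t" using no by (meson not_le)
      define c where "c = v \<otimes> y [^] (t - t0)"
      define d' where "d' = h \<ominus> c \<otimes> h0"
      have D': "c \<in> D" "d' \<in> D" using 2 h0 by (simp_all add: c_def d'_def)
      have cr: "c \<in> carrier R" "x \<in> carrier R" "h \<in> carrier R" "h0 \<in> carrier R" "v \<in> carrier R" "y [^] t0 \<in> carrier R" "y [^] (t - t0) \<in> carrier R"
        using D' 2 h0 by simp_all
      have "y [^] t = y [^] (t - t0) \<otimes> y [^] t0" using le by (simp add: nat_pow_mult)
      then have "d = c \<otimes> y [^] t0 \<oplus> x \<otimes> h" using 2(3) cr by (simp add: m_assoc c_def)
      moreover have "c \<otimes> y [^] t0 \<oplus> x \<otimes> h = c \<otimes> g \<oplus> x \<otimes> d'" unfolding g_def d'_def using cr by algebra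
      ultimately have eq: "d = c \<otimes> g \<oplus> x \<otimes> d'" by simp
      have cr': "c \<in> carrier R" "g \<in> carrier R" "x \<in> carrier R" "d' \<in> carrier R"
        using D' i(3)[OF gI] by simp_all
      then have "x \<otimes> d' = (c \<otimes> g \<oplus> x \<otimes> d') \<ominus> c \<otimes> g" by algebra
      also have "\<dots> = d \<ominus> c \<otimes> g" using eq by simp
      also have "\<dots> \<in> K k" by (intro k(9) k(6) gK d D'(1))
      finally show ?thesis using eq sh[OF D'(2)] D' by blast
    qed
  qed
  have iter: "\<exists>c\<in>D. \<exists>d\<in>K n. u = c \<otimes> g \<oplus> x [^] n \<otimes> d"
    if "\<And>j t. j < n \<Longrightarrow> t < t0 \<Longrightarrow> \<not> attains (K j) t" "u \<in> I" for n u
    using that(1)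
  proof (induction n)
    case 0
    have "u = \<zero> \<otimes> g \<oplus> x [^] (0::nat) \<otimes> u" "u \<in> K 0" using i(3)[OF gI] that(2) i(2,3) by (simp_all add: K_def)
    then show ?case using D_closed(2) by blast
  next
    case (Suc n)
    then obtain c d where cd: "c \<in> D" "d \<in> K n" "u = c \<otimes> g \<oplus> x [^] n \<otimes> d" by (meson less_Suc_eq)
    obtain c' d' where cd': "c' \<in> D" "d' \<in> K (Suc n)" "d = c' \<otimes> g \<oplus> x \<otimes> d'"
      using step[OF _ cd(2)] Suc.prems by blast
    have cr: "c \<in> carrier R" "c' \<in> carrier R" "d' \<in> carrier R" "g \<in> carrier R" "x \<in> carrier R" "x [^] n \<in> carrier R"
      using cd cd' k(3) i(3)[OF gI] by auto
    have "u = (c \<oplus> x [^] n \<otimes> c') \<otimes> g \<oplus> (x [^] n \<otimes> x) \<otimes> d'" unfolding cd cd' using cr by algebra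
    then have "u = (c \<oplus> x [^] n \<otimes> c') \<otimes> g \<oplus> x [^] Suc n \<otimes> d'" by simp
    moreover have "c \<oplus> x [^] n \<otimes> c' \<in> D" using cd cd' by simp
    ultimately show ?case using cd'(2) by blast
  qed
  have Tne: "T \<noteq> {}" using less.prems(4) by auto
  show ?case
  proof (cases "\<exists>n t. t < t0 \<and> attains (K n) t")
    case True
    \<comment> \<open>At the first exponent where a smaller order \<open>t < t0\<close> appears,
      \<open>iter\<close> still applies. Elimination removes one member of the family while the
      order drops by at least one, so the inequality for the cardinality is preserved.\<close>
    define n where "n = (LEAST n. \<exists>t<t0. attains (K n) t)"
    have ex: "\<exists>t<t0. attains (K n) t" unfolding n_def using LeastI_ex[of "\<lambda>n. \<exists>t<t0. attains (K n) t"] True by blast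
    have no: "\<not> attains (K j) t" if "j < n" "t < t0" for j t
      using not_less_Least[of j "\<lambda>n. \<exists>t<t0. attains (K n) t"] that unfolding n_def by blast
    obtain t where t: "t < t0" "attains (K n) t" using ex by auto
    have "\<forall>j\<in>T. \<exists>c d. c \<in> D \<and> d \<in> K n \<and> e j = c \<otimes> g \<oplus> x [^] n \<otimes> d"
      using iter[OF no] less.prems(5) by blast
    then obtain c d where cd: "\<And>j. j \<in> T \<Longrightarrow> c j \<in> D" "\<And>j. j \<in> T \<Longrightarrow> d j \<in> K n"
      "\<And>j. j \<in> T \<Longrightarrow> e j = c j \<otimes> g \<oplus> x [^] n \<otimes> d j" by metis
    show ?thesis
    proof (rule dependent_elimination[OF I gI less.prems(3) Tne cd Ki])
      show "x [^] n \<in> D" by simp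
      show "x [^] n \<otimes> u \<in> I" if "u \<in> K n" for u using that by (simp add: K_def)
      fix j0 \<delta> assume j: "j0 \<in> T" "\<And>j. j \<in> T \<Longrightarrow> \<delta> j \<in> D"
      show "max_dependent (K n) (T - {j0}) (\<lambda>j. d j \<ominus> \<delta> j \<otimes> d j0)"
      proof (rule less.IH[OF _ Ki t(2)])
        show "t < s" using t t0 by simp
        show "finite (T - {j0})" using less.prems by simp
        show "t + 2 \<le> card (T - {j0})" using less.prems(3,4) j(1) t t0 by simp
        show "d j \<ominus> \<delta> j \<otimes> d j0 \<in> K n" if "j \<in> T - {j0}" for j
          using that cd(2) j k(6,9) by simp
      qed
    qed
  next
    case False
    \<comment> \<open>Now \<open>iter\<close> holds for every exponent, so Krull's theorem makes
      \<open>g\<close> a generator of \<open>I\<close>. The elimination below then leaves only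
      zeros, and these are dependent with all coefficients one, because at least one index is
      left.\<close>
    have "\<exists>c\<in>D. u = c \<otimes> g" if u: "u \<in> I" for u
    proof (rule krull_intersection[OF D i(2)[OF gI] xy_max(1) i(2)[OF u]])
      fix n :: nat
      obtain c d where cd: "c \<in> D" "d \<in> K n" "u = c \<otimes> g \<oplus> x [^] n \<otimes> d" using iter[OF _ u] False by blast
      then have "u = c \<otimes> g \<oplus> d \<otimes> x [^] n" using k(3) by (simp add: m_comm)
      then show "\<exists>c\<in>D. \<exists>d\<in>D. u = c \<otimes> g \<oplus> d \<otimes> x [^] n" using cd k(2) by blast
    qed
    then have "\<forall>j\<in>T. \<exists>c. c \<in> D \<and> e j = c \<otimes> g" using less.prems(5) by blast
    then obtain c where c: "\<And>j. j \<in> T \<Longrightarrow> c j \<in> D" "\<And>j. j \<in> T \<Longrightarrow> e j = c j \<otimes> g" by metis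
    show ?thesis
    proof (rule dependent_elimination[OF I gI less.prems(3) Tne c(1), where d = "\<lambda>j. \<zero>" and K = I and z = \<one>])
      show "e j = c j \<otimes> g \<oplus> \<one> \<otimes> \<zero>" if "j \<in> T" for j using c that i(3)[OF gI] by simp
      fix j0 \<delta> assume j: "j0 \<in> T" "\<And>j. j \<in> T \<Longrightarrow> \<delta> j \<in> D"
      have "T - {j0} \<noteq> {}" using less.prems(3,4) j(1) by (metis add_2_eq_Suc' card.empty card_Diff_singleton diff_Suc_1 not_less_eq_eq old.nat.distinct(1) Suc_le_D bot_nat_0.extremum)
      then have ne: "\<exists>j\<in>T - {j0}. \<one> \<notin> \<mm>" using max_primeD(2) by blast
      have "(\<Oplus>j\<in>T - {j0}. \<one> \<otimes> (\<zero> \<ominus> \<delta> j \<otimes> \<zero>)) = (\<Oplus>j\<in>T - {j0}. \<zero>)"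
        by (rule finsum_cong') (use j(2) in \<open>auto simp: a_minus_def\<close>)
      also have "\<dots> = \<zero>" by simp
      finally show "max_dependent I (T - {j0}) (\<lambda>j. \<zero> \<ominus> \<delta> j \<otimes> \<zero>)"
        unfolding max_dependent_def using ne ideal_subD(4)[OF D(1) max_mult_ideal(1)[OF I]]
        by (intro exI[of _ "\<lambda>j. \<one>"]) simp
    qed (use I i in auto)
  qed
qed

end

section \<open>The dimension of an affine chart\<close>

context abelian_monoid
begin

lemma finsum_Times:
  assumes "finite S" "finite T" "\<And>i j. i \<in> S \<Longrightarrow> j \<in> T \<Longrightarrow> f i j \<in> carrier G"
  shows "(\<Oplus>p\<in>S \<times> T. f (fst p) (snd p)) = (\<Oplus>i\<in>S. \<Oplus>j\<in>T. f i j)"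
  using assms(1,3)
proof (induction S rule: finite_induct)
  case empty
  then show ?case by simp
next
  case (insert i S)
  have "(\<Oplus>p\<in>insert i S \<times> T. f (fst p) (snd p)) = (\<Oplus>p\<in>Pair i ` T \<union> S \<times> T. f (fst p) (snd p))"
    by (rule arg_cong[of _ _ "finsum G _"]) auto
  also have "\<dots> = (\<Oplus>p\<in>Pair i ` T. f (fst p) (snd p)) \<oplus> (\<Oplus>p\<in>S \<times> T. f (fst p) (snd p))"
    by (rule finsum_Un_disjoint) (use insert assms(2) in auto)
  also have "(\<Oplus>p\<in>Pair i ` T. f (fst p) (snd p)) = (\<Oplus>j\<in>T. f i j)"
    by (subst finsum_reindex) (use insert in \<open>auto simp: inj_on_def\<close>)
  also have "(\<Oplus>p\<in>S \<times> T. f (fst p) (snd p)) = (\<Oplus>i\<in>S. \<Oplus>j\<in>T. f i j)" using insert by blast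
  also have "(\<Oplus>j\<in>T. f i j) \<oplus> \<dots> = (\<Oplus>i\<in>insert i S. \<Oplus>j\<in>T. f i j)"
    by (rule finsum_insert[symmetric]) (use insert in auto)
  finally show ?case .
qed

end

context field
begin

text \<open>Modulo \<open>P\<close> the sum starts at \<open>j0\<close>, and \<open>z [^] j0\<close>
  can be cancelled because \<open>z\<close> is not in the prime \<open>P\<close>. The remaining sum
  is congruent to \<open>c j0\<close> modulo \<open>z\<close>, which lies in
  \<open>P'\<close>.\<close>

lemma trailing_coefficient:
  fixes N j0 :: nat
  assumes A: "subring A R" and P: "primeideal P (sub A)" and P': "primeideal P' (sub A)" "P \<subseteq> P'"
    and z: "z \<in> P'" "z \<notin> P" and c: "\<And>j. j < N \<Longrightarrow> c j \<in> A"
    and sum: "(\<Oplus>j\<in>{..<N}. c j \<otimes> z [^] j) \<in> P"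
    and j0: "j0 < N" "\<And>j. j < j0 \<Longrightarrow> c j \<in> P"
  shows "c j0 \<in> P'"
proof -
  note [simp] = subring_closed[OF A]
  note p = primeideal_subD[OF A P] and p' = primeideal_subD[OF A P'(1)]
  note i = ideal_subD[OF A p(1)] and i' = ideal_subD[OF A p'(1)]
  have [simp]: "z \<in> A" using z i' by simp
  have cr: "c j \<in> carrier R" if "j < N" for j using c[OF that] by simp
  have cancel: "(p \<oplus> q) \<ominus> p = q" if "p \<in> carrier R" "q \<in> carrier R" for p q
    using that by algebra
  let ?L = "\<Oplus>j\<in>{..<j0}. c j \<otimes> z [^] j" and ?H = "\<Oplus>j\<in>{j0..<N}. c j \<otimes> z [^] j"
  have "(\<Oplus>j\<in>{..<N}. c j \<otimes> z [^] j) = (\<Oplus>j\<in>{..<j0} \<union> {j0..<N}. c j \<otimes> z [^] j)"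
    by (rule arg_cong[of _ _ "finsum R _"]) (use j0 in auto)
  also have "\<dots> = ?L \<oplus> ?H" by (rule finsum_Un_disjoint) (use j0 cr in auto)
  finally have LH: "?L \<oplus> ?H \<in> P" using sum by simp
  have L: "?L \<in> P" by (rule ideal_finsum[OF A p(1)]) (use j0 i(7) in auto)
  define w where "w = (\<Oplus>j\<in>{j0..<N}. c j \<otimes> z [^] (j - j0))"
  have wA: "w \<in> A" unfolding w_def by (rule ideal_finsum[OF A carrier_ideal[OF A]]) (use c in auto)
  have "?H = (\<Oplus>j\<in>{j0..<N}. z [^] j0 \<otimes> (c j \<otimes> z [^] (j - j0)))"
  proof (rule finsum_cong')
    fix j assume j: "j \<in> {j0..<N}"
    have "z [^] j = z [^] j0 \<otimes> z [^] (j - j0)" using j by (simp add: nat_pow_mult)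
    then show "c j \<otimes> z [^] j = z [^] j0 \<otimes> (c j \<otimes> z [^] (j - j0))" using j cr[of j] by (simp add: m_lcomm)
  qed (use cr in auto)
  also have "\<dots> = z [^] j0 \<otimes> w" unfolding w_def by (rule finsum_rdistr[symmetric]) (use cr in auto)
  finally have H: "?H = z [^] j0 \<otimes> w" .
  have "(?L \<oplus> z [^] j0 \<otimes> w) \<ominus> ?L \<in> P" using i(9) LH L unfolding H by blast
  moreover have "(?L \<oplus> z [^] j0 \<otimes> w) \<ominus> ?L = z [^] j0 \<otimes> w"
  proof -
    have "?L \<in> carrier R" "z [^] j0 \<otimes> w \<in> carrier R" using L i(3) wA by simp_all
    then show ?thesis by (rule cancel)
  qed
  ultimately have "z [^] j0 \<otimes> w \<in> P" by simp
  then have wP: "w \<in> P" using p(3)[of "z [^] j0" w] p(4)[of z j0] z wA by auto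
  let ?r = "\<Oplus>j\<in>{j0<..<N}. c j \<otimes> z [^] (j - j0)"
  have rP: "?r \<in> P'"
  proof (rule ideal_finsum[OF A p'(1)])
    fix j assume j: "j \<in> {j0<..<N}"
    then obtain k where k: "j - j0 = Suc k" by (metis Suc_diff_Suc greaterThanLessThan_iff)
    have "z [^] (j - j0) \<in> P'" unfolding k using z(1) i'(6) by simp
    then show "c j \<otimes> z [^] (j - j0) \<in> P'" using i'(6) c j by simp
  qed
  have "w = (\<Oplus>j\<in>insert j0 {j0<..<N}. c j \<otimes> z [^] (j - j0))" unfolding w_def
    by (rule arg_cong[of _ _ "finsum R _"]) (use j0 in auto)
  also have "\<dots> = c j0 \<otimes> z [^] (j0 - j0) \<oplus> ?r" by (rule finsum_insert) (use cr j0 in auto)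
  finally have w: "w = c j0 \<oplus> ?r" using cr j0(1) by simp
  have "(c j0 \<oplus> ?r) \<ominus> ?r \<in> P'" using i'(9) rP wP P'(2) unfolding w by blast
  moreover have "(c j0 \<oplus> ?r) \<ominus> ?r = c j0"
  proof -
    have "c j0 \<in> carrier R" "?r \<in> carrier R" using rP i'(3) cr j0 by simp_all
    then show ?thesis using cancel[of ?r "c j0"] by (simp add: a_comm)
  qed
  ultimately show ?thesis by simp
qed

end

context two_generated_local
begin

lemma swap: "two_generated_local R D y x"
proof (intro two_generated_local.intro two_generated_local_axioms.intro field_axioms D xy)
  show "max_ideal (sub D) = {y \<otimes> a \<oplus> x \<otimes> b | a b. a \<in> D \<and> b \<in> D}"
  proof -
    have "x \<otimes> a \<oplus> y \<otimes> b = y \<otimes> b \<oplus> x \<otimes> a" if "a \<in> D" "b \<in> D" for a b using that by (simp add: a_comm)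
    then show ?thesis unfolding max by (metis (no_types, opaque_lifting))
  qed
qed

lemma attains_mono: "attains I s \<Longrightarrow> I \<subseteq> I' \<Longrightarrow> attains I' s"
  by (auto simp: attains_def)

text \<open>If \<open>x\<close> is not in \<open>p\<close> and no element of \<open>p\<close> has a
  finite order modulo \<open>x\<close>, then each element of \<open>p\<close> is \<open>x\<close>
  times an element of \<open>p\<close>. It is then divisible by all powers of \<open>x\<close> and
  vanishes by Krull's theorem.\<close>

lemma attains_nonzero_prime:
  assumes "primeideal p (sub D)" "p \<noteq> {\<zero>}"
  obtains s where "attains p s" | s where "two_generated_local.attains R D y x p s"
proof -
  interpret sw: two_generated_local R D y x by (rule swap)
  note p = primeideal_subD[OF D(1) assms(1)] and i = ideal_subD[OF D(1) p(1)]
  show ?thesis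
  proof (cases "x \<in> p")
    case True
    \<comment> \<open>With the generators exchanged, \<open>x\<close> itself has order one modulo
      \<open>y\<close>.\<close>
    then have "x [^] (1::nat) \<oplus> y \<otimes> \<zero> \<in> p" by simp
    then have "sw.attains p 1" unfolding sw.attains_def using D_closed(2) by blast
    then show ?thesis by (rule that(2))
  next
    case False
    show ?thesis
    proof (rule ccontr)
      assume "\<not> thesis"
      then have no: "\<not> attains p s" for s using that(1) by blast
      have step: "\<exists>h\<in>p. f = x \<otimes> h" if f: "f \<in> p" for f
      proof -
        have "\<exists>h\<in>D. f = x \<otimes> h" using order_mod_x[OF i(2)[OF f]] attainsI[OF p(1)] no f by metis
        then show ?thesis using p(3)[of x] False f by auto
      qed
      have pow: "\<exists>h\<in>p. f = h \<otimes> x [^] k" if f: "f \<in> p" for f and k :: nat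
      proof (induction k)
        case 0
        then show ?case using f i(3) by (intro bexI[of _ f]) auto
      next
        case (Suc k)
        then obtain h where h: "h \<in> p" "f = h \<otimes> x [^] k" by auto
        obtain h' where h': "h' \<in> p" "h = x \<otimes> h'" using step[OF h(1)] by auto
        have "f = h' \<otimes> x [^] Suc k" using h h' i(3) by (simp add: m_ac)
        then show ?case using h' by blast
      qed
      have "f = \<zero>" if f: "f \<in> p" for f
      proof -
        have "\<exists>a\<in>D. f = a \<otimes> \<zero>"
        proof (rule krull_intersection[OF D D_closed(2) xy_max(1) i(2)[OF f]])
          fix k :: nat
          obtain h where h: "h \<in> p" "f = h \<otimes> x [^] k" using pow[OF f] by auto
          then have "f = \<zero> \<otimes> \<zero> \<oplus> h \<otimes> x [^] k" using i(3) by simp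
          then show "\<exists>a\<in>D. \<exists>c\<in>D. f = a \<otimes> \<zero> \<oplus> c \<otimes> x [^] k" using i(2)[OF h(1)] D_closed(2) by blast
        qed
        then show ?thesis by auto
      qed
      then have "p = {\<zero>}" using i(4) by blast
      then show False using assms(2) by simp
    qed
  qed
qed

text \<open>Elements \<open>z\<^sub>j\<close> of \<open>A\<close> with common denominator \<open>b\<^sup>n\<close> have numerators in the contraction \<open>I\<close> of
  \<open>b\<^sup>n A + Q\<close>; a relation between numerators modulo \<open>\<mm>I\<close> becomes one between the \<open>z\<^sub>j\<close> modulo \<open>\<mm>A + Q\<close>.\<close>

lemma relation_modulo_prime:
  fixes T :: "'i set" and n :: nat
  assumes A: "subring A R" "D \<subseteq> A" and b: "b \<in> D" "b \<notin> Q" and Q: "primeideal Q (sub A)"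
    and P: "ideal P (sub A)" "Q \<subseteq> P" "\<mm> \<subseteq> P"
    and att: "attains {d \<in> D. \<exists>a\<in>A. d \<ominus> b [^] n \<otimes> a \<in> Q} s"
    and T: "finite T" "card T \<ge> s + 2" and z: "\<And>j. j \<in> T \<Longrightarrow> z j \<in> A" "\<And>j. j \<in> T \<Longrightarrow> b [^] n \<otimes> z j \<in> D"
  shows "\<exists>\<epsilon>. (\<forall>j\<in>T. \<epsilon> j \<in> D) \<and> (\<exists>j\<in>T. \<epsilon> j \<notin> \<mm>) \<and> (\<Oplus>j\<in>T. \<epsilon> j \<otimes> z j) \<in> P"
proof -
  note [simp] = subring_closed[OF A(1)]
  note q = primeideal_subD[OF A(1) Q] and iq = ideal_subD[OF A(1) primeideal_subD(1)[OF A(1) Q]]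
  note ip = ideal_subD[OF A(1) P(1)]
  have DA: "d \<in> D \<Longrightarrow> d \<in> A" for d using A(2) by auto
  have bA: "b [^] n \<in> A" "b \<in> A" using DA[OF b(1)] by simp_all
  let ?I = "{d \<in> D. \<exists>a\<in>A. d \<ominus> b [^] n \<otimes> a \<in> Q}"
  have I: "ideal ?I (sub D)"
  proof (rule ideal_subI[OF D(1)])
    have "\<zero> \<ominus> b [^] n \<otimes> \<zero> = \<zero>" using bA by (simp add: a_minus_def)
    then have "\<zero> \<ominus> b [^] n \<otimes> \<zero> \<in> Q" using iq(4) by simp
    then show "\<zero> \<in> ?I" using subring_closed(2)[OF A(1)] D_closed(2) by blast
    show "d \<oplus> d' \<in> ?I" if "d \<in> ?I" "d' \<in> ?I" for d d'
    proof -
      obtain a a' where a: "d \<in> D" "d' \<in> D" "a \<in> A" "a' \<in> A" "d \<ominus> b [^] n \<otimes> a \<in> Q" "d' \<ominus> b [^] n \<otimes> a' \<in> Q"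
        using \<open>d \<in> ?I\<close> \<open>d' \<in> ?I\<close> by auto
      have cr: "d \<in> carrier R" "d' \<in> carrier R" "a \<in> carrier R" "a' \<in> carrier R" "b [^] n \<in> carrier R"
        using a bA by simp_all
      have "(d \<oplus> d') \<ominus> b [^] n \<otimes> (a \<oplus> a') = (d \<ominus> b [^] n \<otimes> a) \<oplus> (d' \<ominus> b [^] n \<otimes> a')" using cr by algebra
      then have "(d \<oplus> d') \<ominus> b [^] n \<otimes> (a \<oplus> a') \<in> Q" using iq(5)[OF a(5,6)] by simp
      moreover have "a \<oplus> a' \<in> A" "d \<oplus> d' \<in> D" using a by simp_all
      ultimately show ?thesis by blast
    qed
    show "c \<otimes> d \<in> ?I" if "c \<in> D" "d \<in> ?I" for c d
    proof -
      obtain a where a: "d \<in> D" "a \<in> A" "d \<ominus> b [^] n \<otimes> a \<in> Q" using \<open>d \<in> ?I\<close> by auto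
      have cr: "d \<in> carrier R" "c \<in> carrier R" "a \<in> carrier R" "b [^] n \<in> carrier R"
        using a bA \<open>c \<in> D\<close> by simp_all
      have "c \<otimes> d \<ominus> b [^] n \<otimes> (c \<otimes> a) = c \<otimes> (d \<ominus> b [^] n \<otimes> a)" using cr by algebra
      then have "c \<otimes> d \<ominus> b [^] n \<otimes> (c \<otimes> a) \<in> Q" using iq(6)[OF DA[OF \<open>c \<in> D\<close>] a(3)] by simp
      moreover have "c \<otimes> a \<in> A" "c \<otimes> d \<in> D" using a DA[OF \<open>c \<in> D\<close>] \<open>c \<in> D\<close> by simp_all
      ultimately show ?thesis by blast
    qed
  qed auto
  have "max_dependent ?I T (\<lambda>j. b [^] n \<otimes> z j)"
  proof (rule dependent_if_attains[OF I att T])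
    fix j assume j: "j \<in> T"
    have "b [^] n \<otimes> z j \<ominus> b [^] n \<otimes> z j = \<zero>" using bA z(1)[OF j] by (simp add: a_minus_def r_neg)
    then have "b [^] n \<otimes> z j \<ominus> b [^] n \<otimes> z j \<in> Q" using iq(4) by simp
    then show "b [^] n \<otimes> z j \<in> ?I" using z[OF j] by blast
  qed
  then obtain \<epsilon> where e: "\<And>j. j \<in> T \<Longrightarrow> \<epsilon> j \<in> D" "\<exists>j\<in>T. \<epsilon> j \<notin> \<mm>"
    "(\<Oplus>j\<in>T. \<epsilon> j \<otimes> (b [^] n \<otimes> z j)) \<in> max_mult ?I" by (auto simp: max_dependent_def)
  then obtain d d' where d: "d \<in> ?I" "d' \<in> ?I" "(\<Oplus>j\<in>T. \<epsilon> j \<otimes> (b [^] n \<otimes> z j)) = x \<otimes> d \<oplus> y \<otimes> d'"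
    unfolding max_mult_def by blast
  then obtain a a' where a: "a \<in> A" "a' \<in> A" "d \<ominus> b [^] n \<otimes> a \<in> Q" "d' \<ominus> b [^] n \<otimes> a' \<in> Q" "d \<in> D" "d' \<in> D" by auto
  define S where "S = (\<Oplus>j\<in>T. \<epsilon> j \<otimes> z j)"
  have SA: "S \<in> A" unfolding S_def
    by (rule ideal_finsum[OF A(1) carrier_ideal[OF A(1)]]) (use DA e(1) z in auto)
  have zc: "z j \<in> carrier R" if "j \<in> T" for j using z(1)[OF that] by simp
  have ec: "\<epsilon> j \<in> carrier R" if "j \<in> T" for j using e(1)[OF that] by simp
  have bc: "b [^] n \<in> carrier R" using bA by simp
  have "(\<Oplus>j\<in>T. \<epsilon> j \<otimes> (b [^] n \<otimes> z j)) = (\<Oplus>j\<in>T. b [^] n \<otimes> (\<epsilon> j \<otimes> z j))"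
    by (rule finsum_cong') (use zc ec bc in \<open>auto simp: m_lcomm\<close>)
  also have "\<dots> = b [^] n \<otimes> S" unfolding S_def by (rule finsum_rdistr[OF T(1), symmetric]) (use zc ec bc in auto)
  finally have bS: "b [^] n \<otimes> S = x \<otimes> d \<oplus> y \<otimes> d'" using d(3) by simp
  \<comment> \<open>Dividing the relation between numerators by \<open>b [^] n\<close> would give
    \<open>S = w\<close> if \<open>d\<close> and \<open>d'\<close> were exactly
    \<open>b [^] n\<close> times \<open>a\<close> and \<open>a'\<close>. They are so modulo
    \<open>Q\<close>, and \<open>b\<close> can be cancelled modulo \<open>Q\<close>.\<close>
  define w where "w = x \<otimes> a \<oplus> y \<otimes> a'"
  have xyA: "x \<in> A" "y \<in> A" using DA xy by simp_all
  have cr: "a \<in> carrier R" "a' \<in> carrier R" "d \<in> carrier R" "d' \<in> carrier R" "x \<in> carrier R" "y \<in> carrier R" "S \<in> carrier R"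
    using a SA xyA by simp_all
  have "b [^] n \<otimes> (S \<ominus> w) = (b [^] n \<otimes> S) \<ominus> b [^] n \<otimes> (x \<otimes> a \<oplus> y \<otimes> a')" unfolding w_def using cr bc by algebra
  also have "\<dots> = x \<otimes> (d \<ominus> b [^] n \<otimes> a) \<oplus> y \<otimes> (d' \<ominus> b [^] n \<otimes> a')" unfolding bS using cr bc by algebra
  also have "\<dots> \<in> Q" by (intro iq(5) iq(6) xyA a(3,4))
  finally have bQ: "b [^] n \<otimes> (S \<ominus> w) \<in> Q" .
  have wA: "w \<in> A" unfolding w_def using xyA a by simp
  have "S \<ominus> w \<in> Q" using q(3)[OF bA(1) _ bQ] q(4)[of b n] bA(2) b(2) SA wA by auto
  then have 1: "S \<ominus> w \<in> P" using P(2) by auto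
  have 2: "w \<in> P" unfolding w_def using P(3) xy_max by (intro ip(5) ip(7) a(1,2)) auto
  have "(S \<ominus> w) \<oplus> w \<in> P" by (rule ip(5)[OF 1 2])
  moreover have "(S \<ominus> w) \<oplus> w = S" using cr(7) ip(3)[OF 2] by algebra
  ultimately have "S \<in> P" by simp
  then show ?thesis using e unfolding S_def by blast
qed

end

text \<open>An affine chart \<open>A\<close> of a blowup of \<open>D\<close> along an \<open>\<mm>\<close>-primary ideal which extends to \<open>b A\<close>.\<close>

locale affine_chart = two_generated_local +
  fixes A :: "'a set" and b :: 'a and c :: nat
  assumes dim_D: "krull_dim (sub D) = 2"
    and A: "subring A R" "D \<subseteq> A"
    and b: "b \<in> \<mm>" "b \<noteq> \<zero>"
    and denominator: "z \<in> A \<Longrightarrow> \<exists>r::nat. b [^] r \<otimes> z \<in> D"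
    and power_x: "\<exists>u\<in>A. x [^] c = b \<otimes> u" and power_y: "\<exists>u\<in>A. y [^] c = b \<otimes> u"
begin

lemmas A_closed [simp] = subring_closed[OF A(1)]

lemma b_mem [simp]: "b \<in> D" "b \<in> A"
  using max_idealD(2)[OF b(1)] A(2) by auto

lemma D_sub_A: "d \<in> D \<Longrightarrow> d \<in> A"
  using A(2) by auto

text \<open>Powers of both generators of \<open>\<mm>\<close> are multiples of \<open>b\<close> in
  \<open>A\<close>, so a prime containing \<open>b\<close> contains \<open>x\<close> and
  \<open>y\<close>.\<close>

lemma max_sub_prime:
  assumes "primeideal P (sub A)" "b \<in> P"
  shows "\<mm> \<subseteq> P" "P \<inter> D = \<mm>"
proof -
  note p = primeideal_subD[OF A(1) assms(1)] and i = ideal_subD[OF A(1) primeideal_subD(1)[OF A(1) assms(1)]]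
  have xyA: "x \<in> A" "y \<in> A" using D_sub_A xy by simp_all
  have "x [^] c \<in> P" "y [^] c \<in> P" using power_x power_y i(7)[OF _ assms(2)] by auto
  then have "x \<in> P" "y \<in> P" using p(4) xyA by auto
  then show m: "\<mm> \<subseteq> P" unfolding max using i(5,7) D_sub_A by auto
  have "ideal (P \<inter> D) (sub D)" by (rule ideal_contract[OF D(1) A p(1)])
  then have "P \<inter> D \<subseteq> \<mm>" using local_ring_max_ideal(4)[OF D(1,2)] p(2) by simp
  then show "P \<inter> D = \<mm>" using m max_idealD(2) by auto
qed

lemma numerator_pow:
  assumes "z \<in> A" "b [^] (r::nat) \<otimes> z \<in> D" "j * r \<le> n"
  shows "b [^] n \<otimes> z [^] (j::nat) \<in> D"
proof -
  have "b [^] n = b [^] (n - r * j) \<otimes> b [^] (r * j)" using assms(3) by (simp add: nat_pow_mult mult.commute)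
  also have "b [^] (r * j) = (b [^] r) [^] j" by (simp add: nat_pow_pow)
  finally have "b [^] n \<otimes> z [^] j = b [^] (n - r * j) \<otimes> (b [^] r \<otimes> z) [^] j"
    using assms(1) by (simp add: nat_pow_distrib m_assoc)
  then show ?thesis using assms(2) by simp
qed

lemma common_denominator:
  assumes "z \<in> A" "z' \<in> A"
  obtains r :: nat where "b [^] r \<otimes> z \<in> D" "b [^] r \<otimes> z' \<in> D"
proof -
  obtain r r' where r: "b [^] (r::nat) \<otimes> z \<in> D" "b [^] (r'::nat) \<otimes> z' \<in> D" using denominator assms by blast
  have "b [^] (r + r') \<otimes> z = b [^] r' \<otimes> (b [^] r \<otimes> z)" "b [^] (r + r') \<otimes> z' = b [^] r \<otimes> (b [^] r' \<otimes> z')"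
    using assms by (simp_all add: nat_pow_mult[symmetric] m_ac)
  then show ?thesis using r that[of "r + r'"] by simp
qed

text \<open>The class of \<open>z\<close> modulo \<open>P\<close> is transcendental over the residue
  field of \<open>D\<close>: in a relation, the coefficients before the first unit lie in
  \<open>P\<close>, so that this unit would lie in \<open>P'\<close>, whose contraction to
  \<open>D\<close> is \<open>\<mm>\<close>.\<close>

lemma no_unit_relation:
  fixes N :: nat
  assumes P: "primeideal P (sub A)" "\<mm> \<subseteq> P" and P': "primeideal P' (sub A)" "P \<subseteq> P'"
    and z: "z \<in> P'" "z \<notin> P" and e: "\<And>j. j < N \<Longrightarrow> \<epsilon> j \<in> D" "j < N" "\<epsilon> j \<notin> \<mm>"
    and sum: "(\<Oplus>j\<in>{..<N}. \<epsilon> j \<otimes> z [^] j) \<in> P"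
  shows False
proof -
  define j0 where "j0 = (LEAST j. j < N \<and> \<epsilon> j \<notin> \<mm>)"
  have j0: "j0 < N" "\<epsilon> j0 \<notin> \<mm>"
    using LeastI[of "\<lambda>j. j < N \<and> \<epsilon> j \<notin> \<mm>" j] e unfolding j0_def by auto
  have less: "\<epsilon> i \<in> P" if "i < j0" for i
    using not_less_Least[of i "\<lambda>j. j < N \<and> \<epsilon> j \<notin> \<mm>"] that j0(1) P(2) unfolding j0_def[symmetric] by auto
  have "\<epsilon> j0 \<in> P'"
    by (rule trailing_coefficient[OF A(1) P(1) P' z _ sum j0(1) less]) (use e(1) D_sub_A in auto)
  moreover have "b \<in> P'" using b(1) P(2) P'(2) by auto
  ultimately show False using max_sub_prime(2)[OF P'(1)] e(1)[OF j0(1)] j0(2) by auto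
qed

text \<open>Inverting \<open>b\<close> makes \<open>A\<close> and \<open>D\<close> equal, so primes
  of \<open>A\<close> without \<open>b\<close> contract to \<open>D\<close> with strict inclusions
  preserved. If \<open>b\<close> were outside \<open>P2\<close>, then zero, the contractions of
  \<open>P1\<close> and \<open>P2\<close>, and \<open>\<mm>\<close>, which contains
  \<open>b\<close>, would form a chain too long for dimension two.\<close>

lemma b_in_second_prime:
  assumes "primeideal P1 (sub A)" "primeideal P2 (sub A)" "P1 \<noteq> {\<zero>}" "P1 \<subset> P2"
  shows "b \<in> P2"
proof (rule ccontr)
  assume nb: "b \<notin> P2"
  note p1 = primeideal_subD[OF A(1) assms(1)] and i1 = ideal_subD[OF A(1) primeideal_subD(1)[OF A(1) assms(1)]]
  note p2 = primeideal_subD[OF A(1) assms(2)] and i2 = ideal_subD[OF A(1) primeideal_subD(1)[OF A(1) assms(2)]]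
  have bn: "b [^] (r::nat) \<notin> P2" for r using p2(4)[of b r] nb by auto
  let ?c = "[{\<zero>}, P1 \<inter> D, P2 \<inter> D, \<mm>]"
  obtain z1 where z1: "z1 \<in> P1" "z1 \<noteq> \<zero>" using assms(3) i1(4) by auto
  obtain r1 where r1: "b [^] (r1::nat) \<otimes> z1 \<in> D" using denominator i1(2)[OF z1(1)] by blast
  have "b [^] r1 \<otimes> z1 \<noteq> \<zero>" using z1 i1(3)[OF z1(1)] bn[of r1] i2(4) integral by fastforce
  moreover have "b [^] r1 \<otimes> z1 \<in> P1" using i1(6) z1(1) by simp
  ultimately have s1: "{\<zero>} \<subset> P1 \<inter> D" using r1 i1(4) by auto
  obtain z2 where z2: "z2 \<in> P2" "z2 \<notin> P1" using assms(4) by auto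
  obtain r2 where r2: "b [^] (r2::nat) \<otimes> z2 \<in> D" using denominator i2(2)[OF z2(1)] by blast
  have "b [^] r2 \<otimes> z2 \<notin> P1" using p1(3)[of "b [^] r2" z2] bn[of r2] assms(4) i2(2)[OF z2(1)] z2(2) by auto
  moreover have "b [^] r2 \<otimes> z2 \<in> P2" using i2(6) z2(1) by simp
  ultimately have s2: "P1 \<inter> D \<subset> P2 \<inter> D" using r2 assms(4) by auto
  have "ideal (P2 \<inter> D) (sub D)" by (rule ideal_contract[OF D(1) A p2(1)])
  then have "P2 \<inter> D \<subseteq> \<mm>" using local_ring_max_ideal(4)[OF D(1,2)] p2(2) by simp
  then have s3: "P2 \<inter> D \<subset> \<mm>" using b(1) nb by auto
  have "primeideal {\<zero>} (sub D)"
  proof -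
    interpret D: domain "sub D" by (rule subring_is_domain[OF D(1)])
    show ?thesis using D.zeroprimeideal by simp
  qed
  then have "prime_chain (sub D) ?c" unfolding prime_chain_def
    using prime_contract[OF D(1) A assms(1)] prime_contract[OF D(1) A assms(2)] max_prime s1 s2 s3
    by auto
  then have "enat 3 \<le> krull_dim (sub D)" unfolding krull_dim_def by (intro SUP_upper2[of ?c]) auto
  then show False using dim_D by (simp add: numeral_eq_enat)
qed

lemma prime_chain_bound:
  assumes P: "primeideal P1 (sub A)" "primeideal P2 (sub A)" "primeideal P3 (sub A)"
    and ne: "P1 \<noteq> {\<zero>}" and ss: "P1 \<subset> P2" "P2 \<subset> P3"
  shows False
proof -
  note p1 = primeideal_subD[OF A(1) P(1)] and i1 = ideal_subD[OF A(1) primeideal_subD(1)[OF A(1) P(1)]]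
  note i2 = ideal_subD[OF A(1) primeideal_subD(1)[OF A(1) P(2)]]
  note i3 = ideal_subD[OF A(1) primeideal_subD(1)[OF A(1) P(3)]]
  have b2: "b \<in> P2" by (rule b_in_second_prime[OF P(1,2) ne ss(1)])
  note m2 = max_sub_prime[OF P(2) b2]
  obtain z3 where z3: "z3 \<in> P3" "z3 \<notin> P2" using ss by auto
  have z3A: "z3 \<in> A" using i3(2) z3 by simp
  show False
  proof (cases "b \<in> P1")
    case False
    let ?p = "P1 \<inter> D"
    have pp: "primeideal ?p (sub D)" by (rule prime_contract[OF D(1) A P(1)])
    have pne: "?p \<noteq> {\<zero>}"
    proof -
      obtain z1 where z1: "z1 \<in> P1" "z1 \<noteq> \<zero>" using ne i1(4) by auto
      obtain r1 where r1: "b [^] (r1::nat) \<otimes> z1 \<in> D" using denominator i1(2)[OF z1(1)] by blast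
      have "b [^] r1 \<notin> P1" using p1(4)[of b r1] False by auto
      then have "b [^] r1 \<otimes> z1 \<noteq> \<zero>" using z1 i1(3)[OF z1(1)] i1(4) integral by fastforce
      moreover have "b [^] r1 \<otimes> z1 \<in> P1" using i1(6) z1(1) by simp
      ultimately show ?thesis using r1 by auto
    qed
    obtain r where r: "b [^] (r::nat) \<otimes> z3 \<in> D" using denominator z3A by blast
    \<comment> \<open>The contraction of \<open>P1\<close> lies in the contraction of
      \<open>b^n A + P1\<close> for every \<open>n\<close>, so an order \<open>s\<close> found in it
      serves for all \<open>n\<close>. Hence \<open>n\<close> may be chosen after \<open>s\<close>,
      large enough for the denominators of \<open>s + 2\<close> powers of \<open>z3\<close>.\<close>
    have sub: "?p \<subseteq> {d \<in> D. \<exists>a\<in>A. d \<ominus> b [^] n \<otimes> a \<in> P1}" for n :: nat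
    proof
      fix d assume d: "d \<in> ?p"
      then have "d \<ominus> b [^] n \<otimes> \<zero> = d" by (simp add: a_minus_def)
      then have "d \<ominus> b [^] n \<otimes> \<zero> \<in> P1" using d by simp
      then show "d \<in> {d \<in> D. \<exists>a\<in>A. d \<ominus> b [^] n \<otimes> a \<in> P1}" using d A_closed(2) by blast
    qed
    have num: "b [^] (r * N) \<otimes> z3 [^] j \<in> D" if "j \<in> {..<N}" for j N :: nat
      using that by (intro numerator_pow[OF z3A r]) (simp add: mult.commute)
    have "\<exists>N \<epsilon>. (\<forall>j\<in>{..<N::nat}. \<epsilon> j \<in> D) \<and> (\<exists>j\<in>{..<N}. \<epsilon> j \<notin> \<mm>) \<and> (\<Oplus>j\<in>{..<N}. \<epsilon> j \<otimes> z3 [^] j) \<in> P2"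
    proof (rule attains_nonzero_prime[OF pp pne])
      fix s assume "attains ?p s"
      from relation_modulo_prime[OF A _ False P(1) primeideal_subD(1)[OF A(1) P(2)] _ m2(1) attains_mono[OF this sub],
          where T = "{..<s + 2}" and z = "\<lambda>j. z3 [^] j" and n = "r * (s + 2)"]
      show ?thesis using num[of _ "s + 2"] z3A ss by (intro exI[of _ "s + 2"]) auto
    next
      fix s assume at: "two_generated_local.attains R D y x ?p s"
      interpret sw: two_generated_local R D y x by (rule swap)
      from sw.relation_modulo_prime[OF A _ False P(1) primeideal_subD(1)[OF A(1) P(2)] _ m2(1) sw.attains_mono[OF at sub],
          where T = "{..<s + 2}" and z = "\<lambda>j. z3 [^] j" and n = "r * (s + 2)"]
      show ?thesis using num[of _ "s + 2"] z3A ss by (intro exI[of _ "s + 2"]) auto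
    qed
    then obtain N \<epsilon> where e: "\<forall>j\<in>{..<N::nat}. \<epsilon> j \<in> D" "\<exists>j\<in>{..<N}. \<epsilon> j \<notin> \<mm>" "(\<Oplus>j\<in>{..<N}. \<epsilon> j \<otimes> z3 [^] j) \<in> P2"
      by blast
    then obtain j where j: "j < N" "\<epsilon> j \<notin> \<mm>" by auto
    have "\<epsilon> j \<in> D" if "j < N" for j using e(1) that by simp
    note this j e(3)
    from no_unit_relation[OF P(2) m2(1) P(3) psubset_imp_subset[OF ss(2)] z3 this] show False .
  next
    case True
    note m1 = max_sub_prime[OF P(1) True]
    obtain z2 where z2: "z2 \<in> P2" "z2 \<notin> P1" using ss by auto
    have z2A: "z2 \<in> A" using i2(2) z2 by simp
    obtain r where r: "b [^] (r::nat) \<otimes> z2 \<in> D" "b [^] r \<otimes> z3 \<in> D" using common_denominator[OF z2A z3A] .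
    \<comment> \<open>For exponents below \<open>N\<close>, the powers of \<open>z2\<close> and of
      \<open>z3\<close> each have denominator \<open>b^(r N)\<close>, hence the products have
      denominator \<open>b^n\<close> with \<open>n = 2 r N\<close>. An element of order
      \<open>c n\<close> is available in \<open>b^n A \<inter> D\<close>, so more than
      \<open>c n + 1\<close> products are needed; this choice gives
      \<open>N^2 = c n + 2 N\<close>.\<close>
    define N where "N = 2 * r * c + 2"
    define n where "n = 2 * (r * N)"
    let ?T = "{..<N} \<times> {..<N}"
    let ?z = "\<lambda>p. z2 [^] fst p \<otimes> z3 [^] snd p"
    have zero: "primeideal {\<zero>} (sub A)"
    proof -
      interpret A: domain "sub A" by (rule subring_is_domain[OF A(1)])
      show ?thesis using A.zeroprimeideal by simp
    qed
    have att: "attains {d \<in> D. \<exists>a\<in>A. d \<ominus> b [^] n \<otimes> a \<in> {\<zero>}} (c * n)"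
    proof -
      obtain u where u: "u \<in> A" "y [^] c = b \<otimes> u" using power_y by auto
      have yD: "y [^] (c * n) \<in> D" by simp
      have "y [^] (c * n) = (y [^] c) [^] n" by (simp add: nat_pow_pow)
      also have "\<dots> = b [^] n \<otimes> u [^] n" using u by (simp add: nat_pow_distrib)
      finally have "y [^] (c * n) \<ominus> b [^] n \<otimes> u [^] n = \<zero>" using u by (simp add: a_minus_def r_neg)
      then have "y [^] (c * n) \<oplus> x \<otimes> \<zero> \<in> {d \<in> D. \<exists>a\<in>A. d \<ominus> b [^] n \<otimes> a \<in> {\<zero>}}"
        using yD A_closed(8)[OF u(1), of n] by auto
      then show ?thesis unfolding attains_def using D_closed(2) by blast
    qed
    have "N * N = 2 * r * c * N + 2 * N" by (simp add: N_def algebra_simps)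
    also have "2 * r * c * N = c * n" by (simp add: n_def)
    finally have "card ?T \<ge> c * n + 2" by (simp add: card_cartesian_product N_def)
    moreover have "b [^] n \<otimes> ?z p \<in> D" if "p \<in> ?T" for p
    proof -
      have "b [^] (r * N) \<otimes> z2 [^] fst p \<in> D" "b [^] (r * N) \<otimes> z3 [^] snd p \<in> D"
        using that by (auto intro!: numerator_pow[OF z2A r(1)] numerator_pow[OF z3A r(2)] simp: mult.commute)
      then have "(b [^] (r * N) \<otimes> z2 [^] fst p) \<otimes> (b [^] (r * N) \<otimes> z3 [^] snd p) \<in> D" by simp
      moreover have "(b [^] (r * N) \<otimes> z2 [^] fst p) \<otimes> (b [^] (r * N) \<otimes> z3 [^] snd p) = b [^] n \<otimes> ?z p"
      proof -
        have "b [^] n = b [^] (r * N) \<otimes> b [^] (r * N)" by (simp add: n_def nat_pow_mult mult_2)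
        then show ?thesis using z2A z3A by (simp add: m_ac)
      qed
      ultimately show ?thesis by simp
    qed
    ultimately have "\<exists>\<epsilon>. (\<forall>p\<in>?T. \<epsilon> p \<in> D) \<and> (\<exists>p\<in>?T. \<epsilon> p \<notin> \<mm>) \<and> (\<Oplus>p\<in>?T. \<epsilon> p \<otimes> ?z p) \<in> P1"
      by (intro relation_modulo_prime[OF A b_mem(1) _ zero primeideal_subD(1)[OF A(1) P(1)] _ m1(1) att])
        (simp_all add: b(2) i1(4) z2A z3A)
    then obtain \<epsilon> where e0: "\<forall>p\<in>?T. \<epsilon> p \<in> D" and e': "\<exists>p\<in>?T. \<epsilon> p \<notin> \<mm>" "(\<Oplus>p\<in>?T. \<epsilon> p \<otimes> ?z p) \<in> P1"
      by (elim exE conjE)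
    note e = bspec[OF e0]
    have ec: "\<epsilon> (i, j) \<in> A" if "i < N" "j < N" for i j using that e[of "(i, j)"] D_sub_A by simp
    define C where "C i = (\<Oplus>j\<in>{..<N}. \<epsilon> (i, j) \<otimes> z3 [^] j)" for i
    have CA: "C i \<in> A" if "i < N" for i unfolding C_def
      by (rule ideal_finsum[OF A(1) carrier_ideal[OF A(1)]]) (use ec z3A that in auto)
    have "(\<Oplus>p\<in>?T. \<epsilon> p \<otimes> ?z p) = (\<Oplus>p\<in>?T. \<epsilon> (fst p, snd p) \<otimes> (z2 [^] fst p \<otimes> z3 [^] snd p))" by simp
    also have "\<dots> = (\<Oplus>i\<in>{..<N}. \<Oplus>j\<in>{..<N}. \<epsilon> (i, j) \<otimes> (z2 [^] i \<otimes> z3 [^] j))"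
      by (rule finsum_Times) (use ec z2A z3A in auto)
    also have "\<dots> = (\<Oplus>i\<in>{..<N}. C i \<otimes> z2 [^] i)"
    proof (rule finsum_cong')
      fix i assume i: "i \<in> {..<N}"
      have "(\<Oplus>j\<in>{..<N}. \<epsilon> (i, j) \<otimes> (z2 [^] i \<otimes> z3 [^] j)) = (\<Oplus>j\<in>{..<N}. (\<epsilon> (i, j) \<otimes> z3 [^] j) \<otimes> z2 [^] i)"
        by (rule finsum_cong') (use ec i z2A z3A in \<open>auto simp: m_ac\<close>)
      also have "\<dots> = C i \<otimes> z2 [^] i" unfolding C_def
        by (rule finsum_ldistr[symmetric]) (use ec i z2A z3A in auto)
      finally show "(\<Oplus>j\<in>{..<N}. \<epsilon> (i, j) \<otimes> (z2 [^] i \<otimes> z3 [^] j)) = C i \<otimes> z2 [^] i" .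
    qed (use CA z2A in auto)
    finally have sum: "(\<Oplus>i\<in>{..<N}. C i \<otimes> z2 [^] i) \<in> P1" using e'(2) by simp
    \<comment> \<open>The first power of \<open>z2\<close> with a unit among its coefficients. All
      earlier \<open>C i\<close> lie in \<open>P1\<close>, so \<open>C i0\<close> lies in
      \<open>P2\<close> and is a forbidden relation for \<open>z3\<close> modulo
      \<open>P2\<close>.\<close>
    define i0 where "i0 = (LEAST i. i < N \<and> (\<exists>j<N. \<epsilon> (i, j) \<notin> \<mm>))"
    have i0: "i0 < N" "\<exists>j<N. \<epsilon> (i0, j) \<notin> \<mm>"
      using LeastI_ex[of "\<lambda>i. i < N \<and> (\<exists>j<N. \<epsilon> (i, j) \<notin> \<mm>)"] e'(1) unfolding i0_def by auto
    have less: "C i \<in> P1" if "i < i0" for i unfolding C_def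
    proof (rule ideal_finsum[OF A(1) p1(1)])
      fix j assume "j \<in> {..<N}"
      then have "\<epsilon> (i, j) \<in> P1"
        using not_less_Least[of i "\<lambda>i. i < N \<and> (\<exists>j<N. \<epsilon> (i, j) \<notin> \<mm>)"] that i0(1) m1(1) unfolding i0_def[symmetric] by auto
      then show "\<epsilon> (i, j) \<otimes> z3 [^] j \<in> P1" using i1(7) z3A by simp
    qed
    have "C i0 \<in> P2"
      by (rule trailing_coefficient[OF A(1) P(1,2) _ z2 CA sum i0(1) less]) (use ss in auto)
    then have "(\<Oplus>j\<in>{..<N}. \<epsilon> (i0, j) \<otimes> z3 [^] j) \<in> P2" by (simp add: C_def)
    then show False
      using no_unit_relation[OF P(2) m2(1) P(3) _ z3, of N "\<lambda>j. \<epsilon> (i0, j)"] i0 e ss by auto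
  qed
qed

end

section \<open>The intersection of the local rings at the points of height two\<close>

text \<open>All that is retained of the chart: \<open>D\<close>, \<open>J\<close> and the model do
  not occur in what follows. \<open>fraction\<close> says that \<open>F\<close> is the quotient
  field of \<open>A\<close>, \<open>chain_bound\<close> limits heights to two, and
  \<open>regular\<close> provides a principal maximal ideal for the local ring at a prime of height
  one.\<close>

locale regular_surface = field +
  fixes A :: "'a set"
  assumes A: "subring A R" "noetherian_ring (sub A)"
    and fraction: "f \<in> carrier R \<Longrightarrow> \<exists>a\<in>A. a \<noteq> \<zero> \<and> a \<otimes> f \<in> A"
    and chain_bound: "primeideal P1 (sub A) \<Longrightarrow> primeideal P2 (sub A) \<Longrightarrow> primeideal P3 (sub A) \<Longrightarrow>
      P1 \<noteq> {\<zero>} \<Longrightarrow> P1 \<subset> P2 \<Longrightarrow> P2 \<subset> P3 \<Longrightarrow> False"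
    and regular: "primeideal P (sub A) \<Longrightarrow> regular_local_ring (sub (ext A P A))"
begin

lemmas A_closed [simp] = subring_closed[OF A(1)]

definition surface_points :: "'a set set" where
  "surface_points = {M. maximalideal M (sub A) \<and> height (sub A) M = 2}"

definition points_ring :: "'a set" where
  "points_ring = carrier R \<inter> \<Inter>{ext A M A | M. M \<in> surface_points}"

section \<open>Maximal ideals of \<open>A\<close> according to their height\<close>

lemma height_le_2: "height (sub A) P \<le> 2"
proof -
  have "length ps \<le> Suc 2" if "prime_chain (sub A) ps" for ps
  proof (rule ccontr)
    assume "\<not> ?thesis"
    then obtain p0 p1 p2 p3 qs where ps: "ps = p0 # p1 # p2 # p3 # qs"
      by (cases ps; cases "tl ps"; cases "tl (tl ps)"; cases "tl (tl (tl ps))") auto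
    then have p: "primeideal p0 (sub A)" "primeideal p1 (sub A)" "primeideal p2 (sub A)" "primeideal p3 (sub A)"
      "p0 \<subset> p1" "p1 \<subset> p2" "p2 \<subset> p3" using that by (auto simp: prime_chain_def)
    have "\<zero> \<in> p0" using ideal_subD(4)[OF A(1) primeideal_subD(1)[OF A(1) p(1)]] .
    then have "p1 \<noteq> {\<zero>}" using p(5) by auto
    then show False using chain_bound[OF p(2-4) _ p(6,7)] by simp
  qed
  then have "height (sub A) P \<le> enat 2" by (intro height_le) simp
  then show ?thesis by (simp add: numeral_eq_enat)
qed

text \<open>A chain of length two below \<open>P\<close> contains a nonzero prime strictly inside
  \<open>P\<close>; a maximal ideal strictly above \<open>P\<close> would then contradict
  \<open>chain_bound\<close>.\<close>

lemma height_2D: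
  assumes "primeideal P (sub A)" "height (sub A) P = 2"
  shows "maximalideal P (sub A)" "P \<noteq> {\<zero>}"
proof -
  have "\<exists>ps. prime_chain (sub A) ps \<and> last ps = P \<and> \<not> length ps \<le> Suc 1"
  proof (rule ccontr)
    assume "\<not> ?thesis"
    then have "height (sub A) P \<le> enat 1" by (intro height_le) blast
    then show False using assms(2) by (simp add: numeral_eq_enat)
  qed
  then obtain ps where ps: "prime_chain (sub A) ps" "last ps = P" "length ps > 2" by auto
  then obtain qs p0 p1 where "ps = qs @ [p0, p1, P]"
    by (metis (no_types, opaque_lifting) append_butlast_last_id append_assoc append_Cons append_Nil length_append_singleton
        less_Suc_eq_0_disj list.size(3) not_less_eq numeral_2_eq_2 length_butlast Suc_diff_Suc One_nat_def diff_Suc_1 gr_implies_not0 length_0_conv)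
  then have p: "primeideal p0 (sub A)" "primeideal p1 (sub A)" "p0 \<subset> p1" "p1 \<subset> P"
    using ps(1) by (auto simp: prime_chain_def sorted_wrt_append)
  have z: "\<zero> \<in> p0" using ideal_subD(4)[OF A(1) primeideal_subD(1)[OF A(1) p(1)]] .
  then show "P \<noteq> {\<zero>}" using p by auto
  obtain N where N: "maximalideal N (sub A)" "P \<subseteq> N"
    using exists_maximal[OF A(1)] primeideal_subD(1,2)[OF A(1) assms(1)] by metis
  have "N = P"
  proof (rule ccontr)
    assume "N \<noteq> P"
    then have "P \<subset> N" using N by auto
    moreover have "p1 \<noteq> {\<zero>}" using z p by auto
    ultimately show False using chain_bound[OF p(2) assms(1) maximal_sub_prime[OF A(1) N(1)] _ p(4)] by simp
  qed
  then show "maximalideal P (sub A)" using N by simp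
qed

lemma zero_prime: "primeideal {\<zero>} (sub A)"
proof -
  interpret A: domain "sub A" by (rule subring_is_domain[OF A(1)])
  show ?thesis using A.zeroprimeideal by simp
qed

lemma prime_zero_mem: "primeideal P (sub A) \<Longrightarrow> \<zero> \<in> P"
  using ideal_subD(4)[OF A(1) primeideal_subD(1)[OF A(1)]] .

lemma curve_point:
  assumes N: "maximalideal N (sub A)" "N \<noteq> {\<zero>}" "N \<notin> surface_points"
  shows "height (sub A) N = 1" "primeideal P (sub A) \<Longrightarrow> P \<subseteq> N \<Longrightarrow> P \<noteq> {\<zero>} \<Longrightarrow> P = N"
proof -
  have Np: "primeideal N (sub A)" by (rule maximal_sub_prime[OF A(1) N(1)])
  have ne: "height (sub A) N \<noteq> 2" using N by (auto simp: surface_points_def)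
  have zN: "{\<zero>} \<subset> N" using prime_zero_mem[OF Np] N(2) by auto
  have "prime_chain (sub A) [{\<zero>}, N]" using zero_prime Np zN by (auto simp: prime_chain_def)
  from height_ge[OF this, of N] have ge: "1 \<le> height (sub A) N" by (simp add: one_enat_def)
  show "height (sub A) N = 1"
    using ge height_le_2[of N] ne by (cases "height (sub A) N") (auto simp: numeral_eq_enat one_enat_def)
  assume P: "primeideal P (sub A)" "P \<subseteq> N" "P \<noteq> {\<zero>}"
  show "P = N"
  proof (rule ccontr)
    assume "P \<noteq> N"
    then have s: "P \<subset> N" "{\<zero>} \<subset> P" using P prime_zero_mem[OF P(1)] by auto
    have "prime_chain (sub A) [{\<zero>}, P, N]" using zero_prime Np P(1) zN s by (auto simp: prime_chain_def)
    from height_ge[OF this, of N] have "2 \<le> height (sub A) N" by (simp add: numeral_eq_enat numeral_2_eq_2)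
    then show False using height_le_2[of N] ne by simp
  qed
qed

text \<open>Such an element \<open>u\<close> of \<open>N\<inverse>\<close> shows that \<open>N\<close> is invertible, since \<open>N N\<inverse>\<close> is then larger than \<open>N\<close>.\<close>

lemma curve_point_inverse:
  assumes N: "maximalideal N (sub A)" "N \<noteq> {\<zero>}" "N \<notin> surface_points"
  obtains u m where "u \<in> carrier R" "\<And>n. n \<in> N \<Longrightarrow> u \<otimes> n \<in> A" "m \<in> N" "u \<otimes> m \<notin> N"
proof -
  have Np: "primeideal N (sub A)" by (rule maximal_sub_prime[OF A(1) N(1)])
  note p = primeideal_subD[OF A(1) Np] and i = ideal_subD[OF A(1) primeideal_subD(1)[OF A(1) Np]]
  let ?L = "ext A N A"
  note L = ext_subring[OF A(1) Np]
  note [simp] = subring_closed[OF L(1)]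
  have reg: "regular_local_ring (sub ?L)" by (rule regular[OF Np])
  have dim: "krull_dim (sub ?L) = 1" using height_eq_krull_dim[OF A(1) Np] curve_point(1)[OF N] by simp
  \<comment> \<open>Height one means that the regular local ring at \<open>N\<close> has dimension
    one, so its maximal ideal has a single generator \<open>w\<close>.\<close>
  obtain G where G: "G \<subseteq> ?L" "finite G" "enat (card G) = 1" "genideal (sub ?L) G = max_ideal (sub ?L)"
    using reg dim by (auto simp: regular_local_ring_def)
  then obtain w where w: "G = {w}" by (auto simp: one_enat_def card_1_singleton_iff)
  have loc: "local_ring (sub ?L)" using reg by (simp add: regular_local_ring_def)
  have mx: "max_ideal (sub ?L) = ext A N N"
    using local_ring_max_ideal(1)[OF L(1) loc] ext_max(3)[OF A(1) Np] by blast
  have wL: "w \<in> ?L" using G w by simp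
  have sub: "ext A N N \<subseteq> {a \<otimes> w | a. a \<in> ?L}"
  proof -
    have "w = \<one> \<otimes> w" using wL by simp
    then have "{w} \<subseteq> {a \<otimes> w | a. a \<in> ?L}" using subring_closed(3)[OF L(1)] by blast
    from genideal_subE(3)[OF L(1) _ principal_ideal[OF L(1)] this] show ?thesis using G(4) wL unfolding w mx by simp
  qed
  have "w \<in> ext A N N" using genideal_subE(2)[OF L(1) G(1)] G(4) w mx by auto
  then obtain s where s: "w \<in> carrier R" "s \<in> A" "s \<notin> N" "s \<otimes> w \<in> N" by (rule extE)
  define z where "z = s \<otimes> w"
  have zN: "z \<in> N" using s by (simp add: z_def)
  have zc: "z \<in> carrier R" using i(3)[OF zN] .
  have each: "\<exists>t\<in>A - N. \<exists>c\<in>A. t \<otimes> n = c \<otimes> z" if n: "n \<in> N" for n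
  proof -
    have "n \<in> ext A N N" using ext_closed(1)[OF A(1) Np p(1)] n by auto
    then obtain a where a: "a \<in> ?L" "n = a \<otimes> w" using sub by auto
    obtain t where t: "a \<in> carrier R" "t \<in> A" "t \<notin> N" "t \<otimes> a \<in> A" using a(1) by (rule extE)
    have cr: "s \<in> carrier R" "t \<in> carrier R" using s t by simp_all
    have "(s \<otimes> t) \<otimes> n = (t \<otimes> a) \<otimes> z" unfolding a(2) z_def using cr t(1) s(1) by algebra
    then show ?thesis using prime_complement_mult[OF A(1) Np s(2,3) t(2,3)] t(4) by blast
  qed
  obtain H where H: "H \<subseteq> A" "finite H" "N = genideal (sub A) H"
    using noetherian_ring.finetely_gen[OF A(2) p(1)] by auto
  have HN: "H \<subseteq> N" using genideal_subE(2)[OF A(1) H(1)] H(3) by simp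
  \<comment> \<open>A single denominator \<open>t\<close> outside \<open>N\<close> is wanted for all
    of \<open>N\<close>. It is built for finite sets and applied to the generators of
    \<open>N\<close>.\<close>
  have "\<exists>t\<in>A - N. \<forall>n\<in>H'. \<exists>c\<in>A. t \<otimes> n = c \<otimes> z" if "finite H'" "H' \<subseteq> N" for H'
    using that
  proof (induction H' rule: finite_induct)
    case empty
    then show ?case using A_closed(3) p(2) by blast
  next
    case (insert h H')
    then obtain t where t: "t \<in> A" "t \<notin> N" "\<And>n. n \<in> H' \<Longrightarrow> \<exists>c\<in>A. t \<otimes> n = c \<otimes> z" by auto
    obtain t' c' where t': "t' \<in> A" "t' \<notin> N" "c' \<in> A" "t' \<otimes> h = c' \<otimes> z" using each[of h] insert.prems by auto
    have "\<exists>c\<in>A. (t \<otimes> t') \<otimes> n = c \<otimes> z" if n: "n \<in> insert h H'" for n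
    proof (cases "n = h")
      case True
      have cr: "h \<in> carrier R" "t \<in> carrier R" "t' \<in> carrier R" using insert.prems i(3) t t' by auto
      have "(t \<otimes> t') \<otimes> n = t \<otimes> (t' \<otimes> h)" using cr True by (simp add: m_assoc)
      also have "\<dots> = (t \<otimes> c') \<otimes> z" unfolding t'(4) using cr t' zc by (simp add: m_assoc)
      finally show ?thesis using t(1) t'(3) A_closed(5) by blast
    next
      case False
      then obtain c where c: "c \<in> A" "t \<otimes> n = c \<otimes> z" using t(3) n by auto
      have cr: "n \<in> carrier R" "t \<in> carrier R" "t' \<in> carrier R" using insert.prems n i(3) t t' by auto
      have "(t \<otimes> t') \<otimes> n = t' \<otimes> (t \<otimes> n)" using cr by (simp add: m_ac)
      also have "\<dots> = (t' \<otimes> c) \<otimes> z" unfolding c(2) using cr c zc by (simp add: m_assoc)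
      finally show ?thesis using t'(1) c(1) A_closed(5) by blast
    qed
    then show ?case using prime_complement_mult[OF A(1) Np t(1,2) t'(1,2)] by blast
  qed
  from this[OF H(2) HN] obtain t where t: "t \<in> A" "t \<notin> N" "\<And>n. n \<in> H \<Longrightarrow> \<exists>c\<in>A. t \<otimes> n = c \<otimes> z" by auto
  have all: "\<exists>c\<in>A. t \<otimes> n = c \<otimes> z" if n: "n \<in> N" for n
  proof -
    have "ideal {n \<in> A. t \<otimes> n \<in> {c \<otimes> z | c. c \<in> A}} (sub A)"
      by (intro ideal_colon[OF A(1) principal_ideal[OF A(1)]]) (use zc zN i t in auto)
    moreover have "H \<subseteq> {n \<in> A. t \<otimes> n \<in> {c \<otimes> z | c. c \<in> A}}" using t(3) H(1) by auto
    ultimately have "N \<subseteq> {n \<in> A. t \<otimes> n \<in> {c \<otimes> z | c. c \<in> A}}"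
      using genideal_subE(3)[OF A(1) H(1)] H(3) by blast
    then show ?thesis using n by auto
  qed
  have tc: "t \<in> carrier R" "t \<noteq> \<zero>" using t i(4) by auto
  have z0: "z \<noteq> \<zero>"
  proof
    assume "z = \<zero>"
    then have "n = \<zero>" if "n \<in> N" for n
      using all[OF that] i(3)[OF that] tc by (auto simp: integral_iff)
    then show False using N(2) i(4) by blast
  qed
  note iz = field_inv[OF zc z0]
  \<comment> \<open>From \<open>t N \<subseteq> z A\<close> the fraction \<open>t/z\<close> maps
    \<open>N\<close> into \<open>A\<close>, and it maps \<open>z \<in> N\<close> to
    \<open>t\<close>, which is not in \<open>N\<close>.\<close>
  show ?thesis
  proof (rule that[of "t \<otimes> inv z" z])
    show "t \<otimes> inv z \<in> carrier R" using tc iz by simp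
    show "t \<otimes> inv z \<otimes> n \<in> A" if n: "n \<in> N" for n
    proof -
      obtain c where c: "c \<in> A" "t \<otimes> n = c \<otimes> z" using all[OF n] by auto
      have nc: "n \<in> carrier R" "c \<in> carrier R" using i(3) n c by auto
      have "t \<otimes> inv z \<otimes> n = inv z \<otimes> (t \<otimes> n)" using nc tc iz by (simp add: m_ac)
      also have "\<dots> = c \<otimes> (z \<otimes> inv z)" unfolding c(2) using nc iz(1) zc by (simp add: m_ac)
      also have "\<dots> = c" using iz nc by simp
      finally show ?thesis using c by simp
    qed
    show "z \<in> N" by (rule zN)
    have "t \<otimes> inv z \<otimes> z = t" using tc iz zc by (simp add: m_assoc)
    then show "t \<otimes> inv z \<otimes> z \<notin> N" using t by simp
  qed
qed

section \<open>The intersection ring and its primes\<close>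

lemma surface_pointD:
  assumes "M \<in> surface_points"
  shows "maximalideal M (sub A)" "primeideal M (sub A)" "height (sub A) M = 2" "M \<noteq> {\<zero>}"
  using assms maximal_sub_prime[OF A(1)] height_2D(2) by (auto simp: surface_points_def)

lemma points_ring_subring: "subring points_ring R" "A \<subseteq> points_ring"
proof -
  have e: "subring (ext A M A) R" "A \<subseteq> ext A M A" if "M \<in> surface_points" for M
    using ext_subring[OF A(1) surface_pointD(2)[OF that]] .
  have "points_ring = \<Inter>(insert (carrier R) {ext A M A | M. M \<in> surface_points})" by (auto simp: points_ring_def)
  also have "subring \<dots> R" by (rule subring_Inter) (use carrier_is_subring e in auto)
  finally show "subring points_ring R" .
  show "A \<subseteq> points_ring" using e by (auto simp: points_ring_def)
qed

lemmas points_ring_closed [simp] = subring_closed[OF points_ring_subring(1)]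

lemma points_ring_sub_ext: "M \<in> surface_points \<Longrightarrow> points_ring \<subseteq> ext A M A"
  by (auto simp: points_ring_def)

lemma A_sub_points_ring: "a \<in> A \<Longrightarrow> a \<in> points_ring"
  using points_ring_subring(2) by auto

text \<open>A maximal ideal \<open>N\<close> of height one generates the unit ideal of \<open>\<Inter>A\<^sub>M\<close>, because \<open>N\<inverse> \<subseteq> A\<^sub>M\<close>
  for \<open>M \<noteq> N\<close>.\<close>

lemma curve_point_not_contracted:
  assumes N: "maximalideal N (sub A)" "N \<noteq> {\<zero>}" "N \<notin> surface_points"
    and q: "ideal q (sub points_ring)" "q \<inter> A = N"
  shows False
proof -
  obtain u m where u: "u \<in> carrier R" "\<And>n. n \<in> N \<Longrightarrow> u \<otimes> n \<in> A" "m \<in> N" "u \<otimes> m \<notin> N"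
    using curve_point_inverse[OF N] by metis
  \<comment> \<open>Distinct maximal ideals: some \<open>s \<in> N\<close> lies outside
    \<open>M\<close>, and \<open>s\<close> is a denominator of \<open>u\<close> because
    \<open>u\<close> maps \<open>N\<close> into \<open>A\<close>.\<close>
  have "u \<in> ext A M A" if M: "M \<in> surface_points" for M
  proof -
    note m = surface_pointD[OF M]
    have "\<not> N \<subseteq> M"
    proof
      assume "N \<subseteq> M"
      then have "M = N" using maximal_sub_subset[OF A(1) N(1)] primeideal_subD(1,2)[OF A(1) m(2)] by blast
      then show False using M N by simp
    qed
    then obtain s where "s \<in> N" "s \<notin> M" by auto
    moreover have "s \<in> A" "s \<otimes> u \<in> A"
      using q(2) \<open>s \<in> N\<close> u(1) u(2)[OF \<open>s \<in> N\<close>] by (auto simp: m_comm)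
    ultimately show ?thesis using u(1) by (intro extI) auto
  qed
  then have "u \<in> points_ring" using u(1) by (auto simp: points_ring_def)
  moreover have "m \<in> q" using u(3) q(2) by auto
  ultimately have "u \<otimes> m \<in> q" using ideal_subD(6)[OF points_ring_subring(1) q(1)] by simp
  then show False using u(2)[OF u(3)] u(4) q(2) by auto
qed

text \<open>Let \<open>N\<close> be a maximal ideal over the contraction of \<open>q\<close>. If
  \<open>N\<close> has height two, \<open>f\<close> has a denominator even outside \<open>N\<close>.
  Otherwise suppose that all denominators are in \<open>q\<close>; since there is a nonzero one, the
  contraction is nonzero, hence equal to \<open>N\<close>, which
  \<open>curve_point_not_contracted\<close> forbids.\<close>

lemma points_ring_denominator:
  assumes q: "primeideal q (sub points_ring)" and f: "f \<in> points_ring"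
  shows "\<exists>s\<in>A. s \<notin> q \<and> s \<otimes> f \<in> A"
proof (rule ccontr)
  assume no: "\<not> ?thesis"
  have P: "primeideal (q \<inter> A) (sub A)" by (rule prime_contract[OF A(1) points_ring_subring q])
  have fc: "f \<in> carrier R" using f by simp
  obtain N where N: "maximalideal N (sub A)" "q \<inter> A \<subseteq> N"
    using exists_maximal[OF A(1)] primeideal_subD(1,2)[OF A(1) P] by metis
  show False
  proof (cases "N \<in> surface_points")
    case True
    then have "f \<in> ext A N A" using points_ring_sub_ext f by auto
    then obtain s where "s \<in> A" "s \<notin> N" "s \<otimes> f \<in> A" by (rule extE)
    then show False using no N(2) by auto
  next
    case False
    obtain a where a: "a \<in> A" "a \<noteq> \<zero>" "a \<otimes> f \<in> A" using fraction[OF fc] by auto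
    then have "a \<in> q \<inter> A" using no by auto
    then have ne: "q \<inter> A \<noteq> {\<zero>}" "N \<noteq> {\<zero>}" using a(2) N(2) by auto
    have "q \<inter> A = N" by (rule curve_point(2)[OF N(1) ne(2) False P N(2) ne(1)])
    then show False using curve_point_not_contracted[OF N(1) ne(2) False primeideal_subD(1)[OF points_ring_subring(1) q]] by simp
  qed
qed

text \<open>For \<open>f\<close> with \<open>s \<otimes> f\<close> in the intersection ring,
  denominators in \<open>A\<close> of both \<open>s\<close> and \<open>s \<otimes> f\<close>, taken
  outside \<open>q\<close>, combine to a denominator of \<open>f\<close> in
  \<open>A\<close>.\<close>

lemma points_ring_localization:
  assumes q: "primeideal q (sub points_ring)"
  shows "ext points_ring q points_ring = ext A (q \<inter> A) A"
proof -
  note p = primeideal_subD[OF points_ring_subring(1) q]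
  show ?thesis
  proof
    show "ext points_ring q points_ring \<subseteq> ext A (q \<inter> A) A"
    proof
      fix f assume "f \<in> ext points_ring q points_ring"
      then obtain s where s: "f \<in> carrier R" "s \<in> points_ring" "s \<notin> q" "s \<otimes> f \<in> points_ring" by (rule extE)
      obtain t where t: "t \<in> A" "t \<notin> q" "t \<otimes> s \<in> A" using points_ring_denominator[OF q s(2)] by auto
      obtain t' where t': "t' \<in> A" "t' \<notin> q" "t' \<otimes> (s \<otimes> f) \<in> A" using points_ring_denominator[OF q s(4)] by auto
      let ?r = "t' \<otimes> (t \<otimes> s)"
      have r: "?r \<in> A" using t t' by simp
      have "t \<otimes> s \<notin> q" using p(3)[of t s] t s A_sub_points_ring by auto
      then have rq: "?r \<notin> q" using p(3)[of t' "t \<otimes> s"] t t' A_sub_points_ring by auto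
      have cr: "t \<in> carrier R" "t' \<in> carrier R" "s \<in> carrier R" using t t' s by simp_all
      have "?r \<otimes> f = t \<otimes> (t' \<otimes> (s \<otimes> f))" using cr s(1) by algebra
      also have "\<dots> \<in> A" using t t' by simp
      finally show "f \<in> ext A (q \<inter> A) A" using s(1) r rq by (intro extI[of _ ?r]) auto
    qed
    show "ext A (q \<inter> A) A \<subseteq> ext points_ring q points_ring"
      using A_sub_points_ring by (auto simp: ext_def)
  qed
qed

lemma surface_point_prime:
  assumes "M \<in> surface_points"
  shows "primeideal (ext A M M \<inter> points_ring) (sub points_ring)" "ext A M M \<inter> points_ring \<inter> A = M"
    "ext points_ring (ext A M M \<inter> points_ring) points_ring = ext A M A"
proof -
  note m = surface_pointD[OF assms]
  note L = ext_subring[OF A(1) m(2)]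
  show p: "primeideal (ext A M M \<inter> points_ring) (sub points_ring)"
    by (rule prime_contract[OF points_ring_subring(1) L(1) points_ring_sub_ext[OF assms] ext_prime[OF A(1) m(2) m(2) order_refl]])
  show "ext A M M \<inter> points_ring \<inter> A = M"
    using ext_contract[OF A(1) m(2) m(2) order_refl] points_ring_subring(2) by auto
  then show "ext points_ring (ext A M M \<inter> points_ring) points_ring = ext A M A"
    using points_ring_localization[OF p] by simp
qed

text \<open>Without points of height two the intersection is \<open>F\<close>, whose maximal ideal
  has height zero; hence the assumption \<open>ne\<close>. The height is computed from the equality
  of the local rings at \<open>q\<close> and at its contraction.\<close>

lemma points_ring_maximal:
  assumes ne: "surface_points \<noteq> {}" and q: "maximalideal q (sub points_ring)"
  shows "q \<inter> A \<in> surface_points" "height (sub points_ring) q = 2"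
proof -
  have qp: "primeideal q (sub points_ring)" by (rule maximal_sub_prime[OF points_ring_subring(1) q])
  note p = primeideal_subD[OF points_ring_subring(1) qp] and i = ideal_subD[OF points_ring_subring(1) primeideal_subD(1)[OF points_ring_subring(1) qp]]
  have P: "primeideal (q \<inter> A) (sub A)" by (rule prime_contract[OF A(1) points_ring_subring qp])
  obtain N where N: "maximalideal N (sub A)" "q \<inter> A \<subseteq> N"
    using exists_maximal[OF A(1)] primeideal_subD(1,2)[OF A(1) P] by metis
  have into: "q \<subseteq> ext A M M \<inter> points_ring" if M: "M \<in> surface_points" "q \<inter> A \<subseteq> M" for M
  proof
    fix f assume f: "f \<in> q"
    then have "f \<in> ext A M A" using points_ring_sub_ext[OF M(1)] i(2) by auto
    then obtain s where s: "f \<in> carrier R" "s \<in> A" "s \<notin> M" "s \<otimes> f \<in> A" by (rule extE)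
    then have "s \<otimes> f \<in> q \<inter> A" using i(6) f A_sub_points_ring by simp
    then show "f \<in> ext A M M \<inter> points_ring" using s M(2) i(2)[OF f] by (intro IntI extI) auto
  qed
  have eq: "q = ext A M M \<inter> points_ring" if M: "M \<in> surface_points" "q \<inter> A \<subseteq> M" for M
    using maximal_sub_subset[OF points_ring_subring(1) q _ into[OF M]] primeideal_subD(1,2)[OF points_ring_subring(1) surface_point_prime(1)[OF M(1)]]
    by blast
  show PW: "q \<inter> A \<in> surface_points"
  proof (cases "N \<in> surface_points")
    case True
    then show ?thesis using eq[OF True N(2)] surface_point_prime(2)[OF True] by simp
  next
    case False
    have "q \<inter> A = {\<zero>}"
    proof (rule ccontr)
      assume ne: "q \<inter> A \<noteq> {\<zero>}"
      then have Nne: "N \<noteq> {\<zero>}" using N(2) prime_zero_mem[OF P] by auto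
      have "q \<inter> A = N" by (rule curve_point(2)[OF N(1) Nne False P N(2) ne])
      then show False using curve_point_not_contracted[OF N(1) Nne False p(1)] by simp
    qed
    \<comment> \<open>The zero ideal is contained in every surface point, so any of them can be used
      in \<open>eq\<close>.\<close>
    moreover obtain M where M: "M \<in> surface_points" using ne by auto
    ultimately have "q \<inter> A \<subseteq> M" using prime_zero_mem[OF surface_pointD(2)[OF M]] by auto
    then have "q \<inter> A = M" using eq[OF M] surface_point_prime(2)[OF M] by simp
    then show ?thesis using M by simp
  qed
  have "height (sub points_ring) q = krull_dim (sub (ext points_ring q points_ring))" by (rule height_eq_krull_dim[OF points_ring_subring(1) qp])
  also have "\<dots> = height (sub A) (q \<inter> A)"
    unfolding points_ring_localization[OF qp] by (rule height_eq_krull_dim[OF A(1) P, symmetric])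
  finally show "height (sub points_ring) q = 2" using surface_pointD(3)[OF PW] by simp
qed

end

section \<open>Flatness\<close>

lemma keys_diff_subset: "Poly_Mapping.keys a \<subseteq> S \<Longrightarrow> Poly_Mapping.keys b \<subseteq> S \<Longrightarrow> Poly_Mapping.keys (a - b :: 'k \<Rightarrow>\<^sub>0 int) \<subseteq> S"
  using keys_diff[of a b] by blast

locale subring_extension = field +
  fixes A B :: "'a set"
  assumes A: "subring A R" and B: "subring B R" and AB: "A \<subseteq> B"
begin

lemmas A_closed = subring_closed[OF A]
lemmas B_closed [simp] = subring_closed[OF B]

lemma A_sub_B [simp]: "a \<in> A \<Longrightarrow> a \<in> B"
  using AB by auto

abbreviation "M \<equiv> subset_module R B"
abbreviation "relations N \<equiv> tensor_relations (sub A) N M"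
abbreviation "formal_sums N \<equiv> free_Abelian_group (carrier N \<times> B)"

lemma M_simps [simp]: "carrier M = B" "x \<oplus>\<^bsub>M\<^esub> y = x \<oplus> y" "r \<odot>\<^bsub>M\<^esub> y = r \<otimes> y" "\<zero>\<^bsub>M\<^esub> = \<zero>"
  by (simp_all add: subset_module_def)

lemma M_module: "module (sub A) M"
proof (rule moduleI)
  show "cring (sub A)" by (rule sub_cring[OF A])
  show "abelian_group M"
  proof (rule abelian_groupI)
    fix x assume "x \<in> carrier M"
    then show "\<exists>y\<in>carrier M. y \<oplus>\<^bsub>M\<^esub> x = \<zero>\<^bsub>M\<^esub>" by (intro bexI[of _ "\<ominus> x"]) (simp_all add: l_neg)
  qed (simp_all add: a_ac)
qed (simp_all add: l_distr r_distr m_assoc A_closed)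

context
  fixes N :: "('a, 'n) module"
  assumes N: "module (sub A) N"
begin

interpretation N: module "sub A" N by (rule N)

section \<open>Relations of the tensor product and denominators of formal sums\<close>

definition generators :: "(('n \<times> 'a) \<Rightarrow>\<^sub>0 int) set" where
  "generators = {frag_of (x \<oplus>\<^bsub>N\<^esub> x', y) - frag_of (x, y) - frag_of (x', y) | x x' y.
         x \<in> carrier N \<and> x' \<in> carrier N \<and> y \<in> B} \<union>
      {frag_of (x, y \<oplus> y') - frag_of (x, y) - frag_of (x, y') | x y y'.
         x \<in> carrier N \<and> y \<in> B \<and> y' \<in> B} \<union>
      {frag_of (r \<odot>\<^bsub>N\<^esub> x, y) - frag_of (x, r \<otimes> y) | r x y.
         r \<in> A \<and> x \<in> carrier N \<and> y \<in> B}"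

lemma relations_eq: "relations N = generate (formal_sums N) generators"
  by (simp add: tensor_relations_def generators_def)

lemma generators_keys: "g \<in> generators \<Longrightarrow> Poly_Mapping.keys g \<subseteq> carrier N \<times> B"
  unfolding generators_def
  by (elim UnE CollectE exE conjE) (hypsubst, intro keys_diff_subset; simp add: N.smult_closed)+

lemma generators_carrier: "generators \<subseteq> carrier (formal_sums N)"
  using generators_keys by auto

lemma relations_subgroup: "subgroup (relations N) (formal_sums N)"
  unfolding relations_eq using group.generate_is_subgroup[OF group_free_Abelian_group generators_carrier] .

lemma relations_keys: "c \<in> relations N \<Longrightarrow> Poly_Mapping.keys c \<subseteq> carrier N \<times> B"
  using subsetD[OF subgroup.subset[OF relations_subgroup], of c] by simp

lemma relations_zero: "0 \<in> relations N"
  using subgroup.one_closed[OF relations_subgroup] by simp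

lemma relations_add: "a \<in> relations N \<Longrightarrow> b \<in> relations N \<Longrightarrow> a + b \<in> relations N"
  using subgroup.m_closed[OF relations_subgroup] by simp

lemma relations_uminus: "a \<in> relations N \<Longrightarrow> - a \<in> relations N"
  using subgroup.m_inv_closed[OF relations_subgroup] relations_keys by fastforce

lemma relations_diff: "a \<in> relations N \<Longrightarrow> b \<in> relations N \<Longrightarrow> a - b \<in> relations N"
  using relations_add[OF _ relations_uminus] by fastforce

lemma relations_generators:
  "x \<in> carrier N \<Longrightarrow> x' \<in> carrier N \<Longrightarrow> y \<in> B \<Longrightarrow> frag_of (x \<oplus>\<^bsub>N\<^esub> x', y) - frag_of (x, y) - frag_of (x', y) \<in> relations N"
  "x \<in> carrier N \<Longrightarrow> y \<in> B \<Longrightarrow> y' \<in> B \<Longrightarrow> frag_of (x, y \<oplus> y') - frag_of (x, y) - frag_of (x, y') \<in> relations N"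
  "r \<in> A \<Longrightarrow> x \<in> carrier N \<Longrightarrow> y \<in> B \<Longrightarrow> frag_of (r \<odot>\<^bsub>N\<^esub> x, y) - frag_of (x, r \<otimes> y) \<in> relations N"
proof -
  have "g \<in> generators \<Longrightarrow> g \<in> relations N" for g
    unfolding relations_eq by (rule generate.incl)
  then show "x \<in> carrier N \<Longrightarrow> x' \<in> carrier N \<Longrightarrow> y \<in> B \<Longrightarrow> frag_of (x \<oplus>\<^bsub>N\<^esub> x', y) - frag_of (x, y) - frag_of (x', y) \<in> relations N"
    "x \<in> carrier N \<Longrightarrow> y \<in> B \<Longrightarrow> y' \<in> B \<Longrightarrow> frag_of (x, y \<oplus> y') - frag_of (x, y) - frag_of (x, y') \<in> relations N"
    "r \<in> A \<Longrightarrow> x \<in> carrier N \<Longrightarrow> y \<in> B \<Longrightarrow> frag_of (r \<odot>\<^bsub>N\<^esub> x, y) - frag_of (x, r \<otimes> y) \<in> relations N"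
    unfolding generators_def by blast+
qed

text \<open>Closure under differences is enough: a negative is a difference from zero, and a sum is
  the difference with a negative.\<close>

lemma relations_induct [consumes 1, case_names zero left right balanced diff]:
  assumes "c \<in> relations N" and zero: "Q 0"
    and left: "\<And>x x' y. x \<in> carrier N \<Longrightarrow> x' \<in> carrier N \<Longrightarrow> y \<in> B \<Longrightarrow> Q (frag_of (x \<oplus>\<^bsub>N\<^esub> x', y) - frag_of (x, y) - frag_of (x', y))"
    and right: "\<And>x y y'. x \<in> carrier N \<Longrightarrow> y \<in> B \<Longrightarrow> y' \<in> B \<Longrightarrow> Q (frag_of (x, y \<oplus> y') - frag_of (x, y) - frag_of (x, y'))"
    and balanced: "\<And>r x y. r \<in> A \<Longrightarrow> x \<in> carrier N \<Longrightarrow> y \<in> B \<Longrightarrow> Q (frag_of (r \<odot>\<^bsub>N\<^esub> x, y) - frag_of (x, r \<otimes> y))"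
    and diff: "\<And>a b. Q a \<Longrightarrow> Q b \<Longrightarrow> Q (a - b)"
  shows "Q c"
proof -
  have g: "Q g" if "g \<in> generators" for g
    using that unfolding generators_def by (elim UnE CollectE exE conjE) (simp_all add: left right balanced)
  have neg: "Q (- a)" if "Q a" for a using diff[OF zero that] by simp
  have add: "Q (a + b)" if "Q a" "Q b" for a b using diff[OF that(1) neg[OF that(2)]] by simp
  from assms(1)[unfolded relations_eq] show ?thesis
  proof (induction rule: generate.induct)
    case one
    then show ?case using zero by simp
  next
    case (incl h)
    then show ?case by (rule g)
  next
    case (inv h)
    then show ?case using neg[OF g[OF inv]] generators_keys[OF inv] by simp
  next
    case (eng h1 h2)
    then show ?case using add by simp
  qed
qed

text \<open>Multiplication by \<open>d\<close> on the second factor, that is, the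
  \<open>B\<close>-module structure of the tensor product on representatives. It is additive in
  \<open>d\<close> only modulo relations.\<close>

definition act :: "'a \<Rightarrow> ('n \<times> 'a \<Rightarrow>\<^sub>0 int) \<Rightarrow> 'n \<times> 'a \<Rightarrow>\<^sub>0 int" where
  "act d = frag_extend (\<lambda>(n, b). frag_of (n, d \<otimes> b))"

lemma act_of [simp]: "act d (frag_of (n, b)) = frag_of (n, d \<otimes> b)"
  by (simp add: act_def)

lemma act_zero [simp]: "act d 0 = 0"
  by (simp add: act_def)

lemma act_diff: "act d (a - b) = act d a - act d b"
  by (simp add: act_def frag_extend_diff)

lemma act_relations:
  assumes "d \<in> B" "c \<in> relations N"
  shows "act d c \<in> relations N"
  using assms(2)
proof (induction rule: relations_induct)
  case zero
  then show ?case by (simp add: relations_zero)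
next
  case (left x x' y)
  then show ?case using assms(1) by (simp add: act_diff relations_generators)
next
  case (right x y y')
  then show ?case using assms(1) by (simp add: act_diff relations_generators r_distr)
next
  case (balanced r x y)
  have "d \<otimes> (r \<otimes> y) = r \<otimes> (d \<otimes> y)" using balanced assms(1) by (simp add: m_lcomm A_closed)
  then show ?case using balanced assms(1) by (simp add: act_diff relations_generators)
next
  case (diff a b)
  then show ?case by (simp add: act_diff relations_diff)
qed

lemma act_add:
  assumes "d \<in> B" "d' \<in> B" "Poly_Mapping.keys c \<subseteq> carrier N \<times> B"
  shows "act (d \<oplus> d') c - act d c - act d' c \<in> relations N"
  using assms(3)
proof (induction rule: frag_induction)
  case zero
  then show ?case by (simp add: relations_zero)
next
  case (one p)
  then show ?case using assms(1,2) relations_generators(2)[of "fst p" "d \<otimes> snd p" "d' \<otimes> snd p"]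
    by (cases p) (simp add: l_distr)
next
  case (diff a b)
  have "act (d \<oplus> d') (a - b) - act d (a - b) - act d' (a - b) =
    (act (d \<oplus> d') a - act d a - act d' a) - (act (d \<oplus> d') b - act d b - act d' b)"
    by (simp add: act_diff)
  then show ?case using relations_diff[OF diff] by simp
qed

lemma act_mult:
  assumes "d \<in> B" "d' \<in> B" "Poly_Mapping.keys c \<subseteq> carrier N \<times> B"
  shows "act (d \<otimes> d') c = act d (act d' c)"
  using assms(3)
proof (induction rule: frag_induction)
  case (one p)
  then show ?case using assms(1,2) by (cases p) (simp add: m_assoc)
qed (simp_all add: act_diff)

lemma act_one:
  assumes "Poly_Mapping.keys c \<subseteq> carrier N \<times> B"
  shows "act \<one> c = c"
  using assms
proof (induction rule: frag_induction)
  case (one p)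
  then show ?case by (cases p) simp
qed (simp_all add: act_diff)

lemma act_null:
  assumes "Poly_Mapping.keys c \<subseteq> carrier N \<times> B"
  shows "act \<zero> c \<in> relations N"
proof -
  have "act (\<zero> \<oplus> \<zero>) c - act \<zero> c - act \<zero> c \<in> relations N" using assms by (intro act_add) auto
  then have "- act \<zero> c \<in> relations N" by simp
  then show ?thesis using relations_uminus by fastforce
qed

text \<open>Makes membership in the relations a local question on \<open>B\<close>: a formal sum is
  a relation once this ideal is contained in no maximal ideal of \<open>B\<close>.\<close>

lemma annihilator_ideal:
  assumes "Poly_Mapping.keys c \<subseteq> carrier N \<times> B"
  shows "ideal {d \<in> B. act d c \<in> relations N} (sub B)"
proof (rule ideal_subI[OF B])
  show "\<zero> \<in> {d \<in> B. act d c \<in> relations N}" using act_null[OF assms] by simp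
  show "d \<oplus> d' \<in> {d \<in> B. act d c \<in> relations N}"
    if "d \<in> {d \<in> B. act d c \<in> relations N}" "d' \<in> {d \<in> B. act d c \<in> relations N}" for d d'
  proof -
    have "(act (d \<oplus> d') c - act d c - act d' c) + act d c + act d' c \<in> relations N"
      using that act_add[OF _ _ assms] by (intro relations_add) auto
    then show ?thesis using that by simp
  qed
  show "e \<otimes> d \<in> {d \<in> B. act d c \<in> relations N}"
    if "e \<in> B" "d \<in> {d \<in> B. act d c \<in> relations N}" for e d
    using that act_mult[OF _ _ assms] act_relations by auto
qed auto

text \<open>\<open>s\<otimes>(n \<otimes> b) = (s b) n \<otimes> 1\<close> when \<open>s b \<in> A\<close>; \<open>clear_denominator s\<close> maps a formal sum to the
  element of \<open>N\<close> obtained in this way.  It is meaningful only on sums of pairs \<open>(n, b)\<close> with \<open>s b \<in> A\<close>;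
  other pairs are sent to zero.\<close>

definition clear_denominator :: "'a \<Rightarrow> ('n \<times> 'a \<Rightarrow>\<^sub>0 int) \<Rightarrow> 'n" where
  "clear_denominator s = (SOME h. h \<in> hom (formal_sums N) (add_monoid N) \<and>
     (\<forall>n\<in>carrier N. \<forall>b\<in>B. s \<otimes> b \<in> A \<longrightarrow> h (frag_of (n, b)) = (s \<otimes> b) \<odot>\<^bsub>N\<^esub> n))"

abbreviation "cleared s \<equiv> carrier N \<times> {b \<in> B. s \<otimes> b \<in> A}"

lemma clear_denominator:
  "clear_denominator s \<in> hom (formal_sums N) (add_monoid N)"
  "n \<in> carrier N \<Longrightarrow> b \<in> B \<Longrightarrow> s \<otimes> b \<in> A \<Longrightarrow> clear_denominator s (frag_of (n, b)) = (s \<otimes> b) \<odot>\<^bsub>N\<^esub> n"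
proof -
  let ?f = "\<lambda>(n, b). if s \<otimes> b \<in> A then (s \<otimes> b) \<odot>\<^bsub>N\<^esub> n else \<zero>\<^bsub>N\<^esub>"
  have "?f ` (carrier N \<times> B) \<subseteq> carrier (add_monoid N)" by (auto simp: N.smult_closed)
  then have "\<exists>h. h \<in> hom (formal_sums N) (add_monoid N) \<and> (\<forall>x\<in>carrier N \<times> B. h (frag_of x) = ?f x)"
    by (rule comm_group.free_Abelian_group_universal[OF N.a_comm_group]) blast
  then obtain h where h: "h \<in> hom (formal_sums N) (add_monoid N)"
    "\<And>x. x \<in> carrier N \<times> B \<Longrightarrow> h (frag_of x) = ?f x" by blast
  then have ex: "h \<in> hom (formal_sums N) (add_monoid N) \<and>
     (\<forall>n\<in>carrier N. \<forall>b\<in>B. s \<otimes> b \<in> A \<longrightarrow> h (frag_of (n, b)) = (s \<otimes> b) \<odot>\<^bsub>N\<^esub> n)" by simp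
  have c: "clear_denominator s \<in> hom (formal_sums N) (add_monoid N) \<and>
     (\<forall>n\<in>carrier N. \<forall>b\<in>B. s \<otimes> b \<in> A \<longrightarrow> clear_denominator s (frag_of (n, b)) = (s \<otimes> b) \<odot>\<^bsub>N\<^esub> n)"
    unfolding clear_denominator_def by (rule someI[of _ h]) (rule ex)
  then show "clear_denominator s \<in> hom (formal_sums N) (add_monoid N)" by simp
  show "n \<in> carrier N \<Longrightarrow> b \<in> B \<Longrightarrow> s \<otimes> b \<in> A \<Longrightarrow> clear_denominator s (frag_of (n, b)) = (s \<otimes> b) \<odot>\<^bsub>N\<^esub> n"
    using c by blast
qed

lemma clear_denominator_hom:
  "Poly_Mapping.keys c \<subseteq> carrier N \<times> B \<Longrightarrow> clear_denominator s c \<in> carrier N"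
  "clear_denominator s 0 = \<zero>\<^bsub>N\<^esub>"
  "Poly_Mapping.keys a \<subseteq> carrier N \<times> B \<Longrightarrow> Poly_Mapping.keys b \<subseteq> carrier N \<times> B \<Longrightarrow>
    clear_denominator s (a - b) = clear_denominator s a \<ominus>\<^bsub>N\<^esub> clear_denominator s b"
proof -
  interpret h: group_hom "formal_sums N" "add_monoid N" "clear_denominator s"
    by (intro group_hom.intro group_hom_axioms.intro) (simp_all add: clear_denominator(1) comm_group.axioms(2)[OF N.a_comm_group])
  show c: "Poly_Mapping.keys c \<subseteq> carrier N \<times> B \<Longrightarrow> clear_denominator s c \<in> carrier N" for c
    using h.hom_closed[of c] by simp
  show "clear_denominator s 0 = \<zero>\<^bsub>N\<^esub>" using h.hom_one by simp
  assume k: "Poly_Mapping.keys a \<subseteq> carrier N \<times> B" "Poly_Mapping.keys b \<subseteq> carrier N \<times> B"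
  have d: "Poly_Mapping.keys (a - b) \<subseteq> carrier N \<times> B" by (rule keys_diff_subset[OF k])
  have "clear_denominator s (a - b + b) = clear_denominator s (a - b) \<oplus>\<^bsub>N\<^esub> clear_denominator s b"
    using h.hom_mult[of "a - b" b] k d by simp
  then have "clear_denominator s a \<ominus>\<^bsub>N\<^esub> clear_denominator s b =
      (clear_denominator s (a - b) \<oplus>\<^bsub>N\<^esub> clear_denominator s b) \<ominus>\<^bsub>N\<^esub> clear_denominator s b" by simp
  also have "\<dots> = clear_denominator s (a - b)" using c[OF d] c[OF k(2)]
    by (simp add: N.M.minus_eq N.M.a_assoc N.M.r_neg)
  finally show "clear_denominator s (a - b) = clear_denominator s a \<ominus>\<^bsub>N\<^esub> clear_denominator s b" by simp
qed

lemma clear_denominator_act: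
  assumes s: "s \<in> A" and c: "Poly_Mapping.keys c \<subseteq> cleared s"
  shows "act s c - frag_of (clear_denominator s c, \<one>) \<in> relations N"
proof -
  \<comment> \<open>The support condition is carried along in the induction because
    \<open>clear_denominator_hom\<close> requires it for differences.\<close>
  have "Poly_Mapping.keys c \<subseteq> carrier N \<times> B \<and> act s c - frag_of (clear_denominator s c, \<one>) \<in> relations N"
    using c
  proof (induction rule: frag_induction)
    case zero
    have "frag_of (\<zero>\<^bsub>N\<^esub> \<oplus>\<^bsub>N\<^esub> \<zero>\<^bsub>N\<^esub>, \<one>) - frag_of (\<zero>\<^bsub>N\<^esub>, \<one>) - frag_of (\<zero>\<^bsub>N\<^esub>, \<one>) \<in> relations N"
      by (rule relations_generators) auto
    then show ?case by (simp add: clear_denominator_hom)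
  next
    case (one p)
    then obtain n b where p: "p = (n, b)" "n \<in> carrier N" "b \<in> B" "s \<otimes> b \<in> A" by auto
    have "frag_of ((s \<otimes> b) \<odot>\<^bsub>N\<^esub> n, \<one>) - frag_of (n, (s \<otimes> b) \<otimes> \<one>) \<in> relations N"
      using p by (intro relations_generators) auto
    from relations_uminus[OF this] show ?case using p s by (simp add: clear_denominator(2))
  next
    case (diff a b)
    then have k: "Poly_Mapping.keys a \<subseteq> carrier N \<times> B" "Poly_Mapping.keys b \<subseteq> carrier N \<times> B" by auto
    let ?u = "clear_denominator s a" and ?v = "clear_denominator s b"
    have uv: "?u \<in> carrier N" "?v \<in> carrier N" using k clear_denominator_hom(1) by auto
    have "frag_of ((?u \<ominus>\<^bsub>N\<^esub> ?v) \<oplus>\<^bsub>N\<^esub> ?v, \<one>) - frag_of (?u \<ominus>\<^bsub>N\<^esub> ?v, \<one>) - frag_of (?v, \<one>) \<in> relations N"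
      using uv by (intro relations_generators) auto
    moreover have "(?u \<ominus>\<^bsub>N\<^esub> ?v) \<oplus>\<^bsub>N\<^esub> ?v = ?u" using uv by (simp add: N.M.minus_eq N.M.a_assoc N.M.l_neg)
    ultimately have 1: "frag_of (?u, \<one>) - frag_of (?u \<ominus>\<^bsub>N\<^esub> ?v, \<one>) - frag_of (?v, \<one>) \<in> relations N" by simp
    have "(act s a - frag_of (?u, \<one>)) - (act s b - frag_of (?v, \<one>)) +
      (frag_of (?u, \<one>) - frag_of (?u \<ominus>\<^bsub>N\<^esub> ?v, \<one>) - frag_of (?v, \<one>)) \<in> relations N"
      using relations_add[OF relations_diff 1] diff by blast
    then show ?case using k keys_diff_subset[OF k] by (simp add: act_diff clear_denominator_hom(3))
  qed
  then show ?thesis by simp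
qed

lemma cleared_mult:
  assumes "s \<in> A" "t \<in> A" "Poly_Mapping.keys c \<subseteq> cleared s"
  shows "Poly_Mapping.keys c \<subseteq> cleared (t \<otimes> s)"
proof -
  have "t \<otimes> s \<otimes> b \<in> A" if "b \<in> B" "s \<otimes> b \<in> A" for b
    using that assms A_closed(5)[of t "s \<otimes> b"] by (simp add: m_assoc A_closed)
  then show ?thesis using assms(3) by auto
qed

lemma clear_denominator_mult:
  assumes "s \<in> A" "t \<in> A" "Poly_Mapping.keys c \<subseteq> cleared s"
  shows "clear_denominator (t \<otimes> s) c = t \<odot>\<^bsub>N\<^esub> clear_denominator s c"
proof -
  have "Poly_Mapping.keys c \<subseteq> carrier N \<times> B \<and> clear_denominator (t \<otimes> s) c = t \<odot>\<^bsub>N\<^esub> clear_denominator s c"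
    using assms(3)
  proof (induction rule: frag_induction)
    case zero
    then show ?case using assms by (simp add: clear_denominator_hom)
  next
    case (one p)
    then obtain n b where p: "p = (n, b)" "n \<in> carrier N" "b \<in> B" "s \<otimes> b \<in> A" by auto
    have e: "t \<otimes> s \<otimes> b = t \<otimes> (s \<otimes> b)" using p assms by (simp add: m_assoc A_closed)
    have "t \<otimes> s \<otimes> b \<in> A" unfolding e using p assms A_closed(5) by simp
    then have "clear_denominator (t \<otimes> s) (frag_of p) = (t \<otimes> (s \<otimes> b)) \<odot>\<^bsub>N\<^esub> n"
      using p e by (simp add: clear_denominator(2))
    also have "\<dots> = t \<odot>\<^bsub>N\<^esub> ((s \<otimes> b) \<odot>\<^bsub>N\<^esub> n)" using N.smult_assoc1[of t "s \<otimes> b" n] p assms by simp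
    finally show ?case using p by (simp add: clear_denominator(2))
  next
    case (diff a b)
    then have k: "Poly_Mapping.keys a \<subseteq> carrier N \<times> B" "Poly_Mapping.keys b \<subseteq> carrier N \<times> B" by auto
    have uv: "clear_denominator s a \<in> carrier N" "clear_denominator s b \<in> carrier N" using k clear_denominator_hom(1) by auto
    show ?case using k keys_diff_subset[OF k] diff uv assms(2)
      by (simp add: clear_denominator_hom(3) N.M.minus_eq N.smult_r_distr N.smult_r_minus)
  qed
  then show ?thesis by simp
qed

text \<open>Dividing the cleared element by \<open>s\<close> represents the image of
  \<open>c\<close> in the localization of \<open>N\<close> at the contraction of \<open>q\<close>,
  where relations become zero. Each generator involves at most two elements of \<open>B\<close> and
  is cleared by one \<open>s\<close> outside \<open>q\<close>; for a difference the product of the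
  two denominators is used.\<close>

lemma relation_vanishes:
  assumes q: "primeideal q (sub B)" and den: "\<And>f. f \<in> B \<Longrightarrow> \<exists>s\<in>A. s \<notin> q \<and> s \<otimes> f \<in> A"
    and c: "c \<in> relations N"
  shows "\<exists>s\<in>A. s \<notin> q \<and> Poly_Mapping.keys c \<subseteq> cleared s \<and> clear_denominator s c = \<zero>\<^bsub>N\<^esub>"
  using c
proof (induction rule: relations_induct)
  case zero
  then show ?case using A_closed(3) primeideal_subD(2)[OF B q] by (intro bexI[of _ \<one>]) (simp_all add: clear_denominator_hom)
next
  case (left x x' y)
  obtain s where s: "s \<in> A" "s \<notin> q" "s \<otimes> y \<in> A" using den[OF left(3)] by auto
  have k: "Poly_Mapping.keys (frag_of (x \<oplus>\<^bsub>N\<^esub> x', y) - frag_of (x, y)) \<subseteq> cleared s"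
    "Poly_Mapping.keys (frag_of (x, y)) \<subseteq> cleared s" "Poly_Mapping.keys (frag_of (x', y)) \<subseteq> cleared s"
    subgoal by (intro keys_diff_subset) (use left s in auto)
    using left s by auto
  have k': "Poly_Mapping.keys (frag_of (x \<oplus>\<^bsub>N\<^esub> x', y) - frag_of (x, y)) \<subseteq> carrier N \<times> B"
    using left by (intro keys_diff_subset) auto
  have "clear_denominator s (frag_of (x \<oplus>\<^bsub>N\<^esub> x', y) - frag_of (x, y) - frag_of (x', y)) = \<zero>\<^bsub>N\<^esub>"
    using left s k' N.smult_closed[of "s \<otimes> y" x] N.smult_closed[of "s \<otimes> y" x']
    by (simp add: clear_denominator_hom(3) clear_denominator(2) N.smult_r_distr)
      (simp add: N.M.minus_eq N.M.a_ac N.M.r_neg N.M.r_neg1 N.M.r_neg2)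
  then show ?case using s keys_diff_subset[OF k(1,3)] by blast
next
  case (right x y y')
  obtain s1 where s1: "s1 \<in> A" "s1 \<notin> q" "s1 \<otimes> y \<in> A" using den[OF right(2)] by auto
  obtain s2 where s2: "s2 \<in> A" "s2 \<notin> q" "s2 \<otimes> y' \<in> A" using den[OF right(3)] by auto
  define s where "s = s1 \<otimes> s2"
  have cr: "s1 \<in> carrier R" "s2 \<in> carrier R" "y \<in> carrier R" "y' \<in> carrier R" using s1 s2 right A_closed by auto
  have s: "s \<in> A" "s \<notin> q"
    using s1 s2 primeideal_subD(3)[OF B q, of s1 s2] A_closed by (auto simp: s_def)
  have "s \<otimes> y = s2 \<otimes> (s1 \<otimes> y)" "s \<otimes> y' = s1 \<otimes> (s2 \<otimes> y')" unfolding s_def using cr by (simp_all add: m_ac)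
  then have sy: "s \<otimes> y \<in> A" "s \<otimes> y' \<in> A" using s1 s2 A_closed(5) by simp_all
  have syy: "s \<otimes> (y \<oplus> y') = s \<otimes> y \<oplus> s \<otimes> y'" "s \<otimes> y \<oplus> s \<otimes> y' \<in> A" using cr sy s A_closed by (simp_all add: r_distr)
  have k: "Poly_Mapping.keys (frag_of (x, y \<oplus> y') - frag_of (x, y)) \<subseteq> cleared s"
    "Poly_Mapping.keys (frag_of (x, y')) \<subseteq> cleared s"
    subgoal by (intro keys_diff_subset) (use right sy syy in auto)
    using right sy by auto
  have k': "Poly_Mapping.keys (frag_of (x, y \<oplus> y') - frag_of (x, y)) \<subseteq> carrier N \<times> B"
    using right by (intro keys_diff_subset) auto
  have d: "(s \<otimes> y \<oplus> s \<otimes> y') \<odot>\<^bsub>N\<^esub> x = (s \<otimes> y) \<odot>\<^bsub>N\<^esub> x \<oplus>\<^bsub>N\<^esub> (s \<otimes> y') \<odot>\<^bsub>N\<^esub> x"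
    using N.smult_l_distr[of "s \<otimes> y" "s \<otimes> y'" x] right sy by simp
  have "clear_denominator s (frag_of (x, y \<oplus> y') - frag_of (x, y) - frag_of (x, y')) = \<zero>\<^bsub>N\<^esub>"
    using right sy syy k' d N.smult_closed[of "s \<otimes> y" x] N.smult_closed[of "s \<otimes> y'" x]
    by (simp add: clear_denominator_hom(3) clear_denominator(2))
      (simp add: N.M.minus_eq N.M.a_ac N.M.r_neg N.M.r_neg1 N.M.r_neg2)
  then show ?case using s keys_diff_subset[OF k] by blast
next
  case (balanced r x y)
  obtain s where s: "s \<in> A" "s \<notin> q" "s \<otimes> y \<in> A" using den[OF balanced(3)] by auto
  have cr: "s \<in> carrier R" "r \<in> carrier R" "y \<in> carrier R" using s balanced A_closed by auto
  have e: "s \<otimes> (r \<otimes> y) = r \<otimes> (s \<otimes> y)" "s \<otimes> (r \<otimes> y) = (s \<otimes> y) \<otimes> r" using cr by (simp_all add: m_ac)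
  have m: "s \<otimes> (r \<otimes> y) \<in> A" unfolding e(1) using s balanced A_closed(5) by simp
  have k: "Poly_Mapping.keys (frag_of (r \<odot>\<^bsub>N\<^esub> x, y)) \<subseteq> cleared s" "Poly_Mapping.keys (frag_of (x, r \<otimes> y)) \<subseteq> cleared s"
    using balanced s m N.smult_closed[of r x] by auto
  have a: "(s \<otimes> (r \<otimes> y)) \<odot>\<^bsub>N\<^esub> x = (s \<otimes> y) \<odot>\<^bsub>N\<^esub> (r \<odot>\<^bsub>N\<^esub> x)"
    unfolding e(2) using N.smult_assoc1[of "s \<otimes> y" r x] balanced s by simp
  have "clear_denominator s (frag_of (r \<odot>\<^bsub>N\<^esub> x, y) - frag_of (x, r \<otimes> y)) =
    clear_denominator s (frag_of (r \<odot>\<^bsub>N\<^esub> x, y)) \<ominus>\<^bsub>N\<^esub> clear_denominator s (frag_of (x, r \<otimes> y))"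
    using k by (intro clear_denominator_hom(3)) auto
  also have "\<dots> = \<zero>\<^bsub>N\<^esub>"
    using balanced s m a N.smult_closed[of r x] N.smult_closed[of "s \<otimes> y" "r \<odot>\<^bsub>N\<^esub> x"]
    by (simp add: clear_denominator(2) N.M.minus_eq N.M.r_neg)
  finally show ?case using s keys_diff_subset[OF k] by blast
next
  case (diff a b)
  then obtain s t where s: "s \<in> A" "s \<notin> q" "Poly_Mapping.keys a \<subseteq> cleared s" "clear_denominator s a = \<zero>\<^bsub>N\<^esub>"
    and t: "t \<in> A" "t \<notin> q" "Poly_Mapping.keys b \<subseteq> cleared t" "clear_denominator t b = \<zero>\<^bsub>N\<^esub>" by blast
  have st: "t \<otimes> s \<in> A" "t \<otimes> s \<notin> q" "s \<otimes> t = t \<otimes> s"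
    using s t primeideal_subD(3)[OF B q, of t s] A_closed by (auto simp: m_comm)
  have ka: "Poly_Mapping.keys a \<subseteq> cleared (t \<otimes> s)" by (rule cleared_mult[OF s(1) t(1) s(3)])
  have kb: "Poly_Mapping.keys b \<subseteq> cleared (t \<otimes> s)" using cleared_mult[OF t(1) s(1) t(3)] st(3) by simp
  have "clear_denominator (t \<otimes> s) a = \<zero>\<^bsub>N\<^esub>"
    using clear_denominator_mult[OF s(1) t(1) s(3)] s(4) t(1) by simp
  moreover have "clear_denominator (t \<otimes> s) b = \<zero>\<^bsub>N\<^esub>"
    using clear_denominator_mult[OF t(1) s(1) t(3)] t(4) s(1) st(3) by simp
  moreover have "clear_denominator (t \<otimes> s) (a - b) = clear_denominator (t \<otimes> s) a \<ominus>\<^bsub>N\<^esub> clear_denominator (t \<otimes> s) b"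
    using ka kb by (intro clear_denominator_hom(3)) auto
  ultimately have "clear_denominator (t \<otimes> s) (a - b) = \<zero>\<^bsub>N\<^esub>" by (simp add: N.M.minus_eq)
  then show ?case using st keys_diff_subset[OF ka kb] by blast
qed

end

section \<open>Homomorphisms applied to formal sums, and injectivity\<close>

definition push :: "('n \<Rightarrow> 'k) \<Rightarrow> ('n \<times> 'a \<Rightarrow>\<^sub>0 int) \<Rightarrow> 'k \<times> 'a \<Rightarrow>\<^sub>0 int" where
  "push f = frag_extend (\<lambda>(x, y). frag_of (f x, y))"

lemma push_simps [simp]: "push f 0 = 0" "push f (frag_of (x, y)) = frag_of (f x, y)"
  "push f (a - b) = push f a - push f b"
  by (simp_all add: push_def frag_extend_diff)

context
  fixes N :: "('a, 'n) module" and N' :: "('a, 'k) module" and f :: "'n \<Rightarrow> 'k"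
  assumes N: "module (sub A) N" and N': "module (sub A) N'" and f: "f \<in> module_hom (sub A) N N'"
begin

interpretation N: module "sub A" N by (rule N)
interpretation N': module "sub A" N' by (rule N')

lemma f_props:
  "x \<in> carrier N \<Longrightarrow> f x \<in> carrier N'"
  "x \<in> carrier N \<Longrightarrow> y \<in> carrier N \<Longrightarrow> f (x \<oplus>\<^bsub>N\<^esub> y) = f x \<oplus>\<^bsub>N'\<^esub> f y"
  "r \<in> A \<Longrightarrow> x \<in> carrier N \<Longrightarrow> f (r \<odot>\<^bsub>N\<^esub> x) = r \<odot>\<^bsub>N'\<^esub> f x"
  using f by (auto simp: module_hom_def hom_def)

lemma f_zero: "f \<zero>\<^bsub>N\<^esub> = \<zero>\<^bsub>N'\<^esub>"
proof -
  have "f (\<zero> \<odot>\<^bsub>N\<^esub> \<zero>\<^bsub>N\<^esub>) = \<zero> \<odot>\<^bsub>N'\<^esub> f \<zero>\<^bsub>N\<^esub>" by (rule f_props(3)) (simp_all add: A_closed)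
  then show ?thesis using N.smult_l_null[of "\<zero>\<^bsub>N\<^esub>"] N'.smult_l_null[of "f \<zero>\<^bsub>N\<^esub>"] f_props(1)[of "\<zero>\<^bsub>N\<^esub>"] by simp
qed

lemma f_minus: "x \<in> carrier N \<Longrightarrow> y \<in> carrier N \<Longrightarrow> f (x \<ominus>\<^bsub>N\<^esub> y) = f x \<ominus>\<^bsub>N'\<^esub> f y"
proof -
  assume xy: "x \<in> carrier N" "y \<in> carrier N"
  have "f ((x \<ominus>\<^bsub>N\<^esub> y) \<oplus>\<^bsub>N\<^esub> y) = f (x \<ominus>\<^bsub>N\<^esub> y) \<oplus>\<^bsub>N'\<^esub> f y" using xy by (intro f_props(2)) auto
  moreover have "(x \<ominus>\<^bsub>N\<^esub> y) \<oplus>\<^bsub>N\<^esub> y = x" using xy by (simp add: N.M.minus_eq N.M.a_assoc N.M.l_neg)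
  ultimately have "f x \<ominus>\<^bsub>N'\<^esub> f y = (f (x \<ominus>\<^bsub>N\<^esub> y) \<oplus>\<^bsub>N'\<^esub> f y) \<ominus>\<^bsub>N'\<^esub> f y" by simp
  also have "\<dots> = f (x \<ominus>\<^bsub>N\<^esub> y)"
    using xy f_props(1)[of "x \<ominus>\<^bsub>N\<^esub> y"] f_props(1)[of y] by (simp add: N'.M.minus_eq N'.M.a_assoc N'.M.r_neg)
  finally show ?thesis by simp
qed

lemma push_relations: "c \<in> relations N \<Longrightarrow> push f c \<in> relations N'"
proof (induction rule: relations_induct[OF N, consumes 1])
  case (1)
  then show ?case by (simp add: relations_zero[OF N'])
next
  case (2 x x' y)
  then show ?case using relations_generators(1)[OF N' f_props(1)[of x] f_props(1)[of x']] by (simp add: f_props)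
next
  case (3 x y y')
  then show ?case using relations_generators(2)[OF N' f_props(1)[of x]] by simp
next
  case (4 r x y)
  then show ?case using relations_generators(3)[OF N' _ f_props(1)[of x]] by (simp add: f_props)
next
  case (5 a b)
  then show ?case using relations_diff[OF N'] by simp
qed

lemma push_keys: "Poly_Mapping.keys c \<subseteq> carrier N \<times> S \<Longrightarrow> Poly_Mapping.keys (push f c) \<subseteq> carrier N' \<times> S"
proof (induction rule: frag_induction)
  case (one p)
  then show ?case using f_props(1) by (cases p) simp
next
  case (diff a b)
  then show ?case by (simp add: keys_diff_subset)
qed simp

lemma clear_denominator_push:
  assumes s: "s \<in> A" and c: "Poly_Mapping.keys c \<subseteq> cleared N s"
  shows "clear_denominator N' s (push f c) = f (clear_denominator N s c)"
proof -
  have "Poly_Mapping.keys c \<subseteq> carrier N \<times> B \<and> clear_denominator N' s (push f c) = f (clear_denominator N s c)"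
    using c
  proof (induction rule: frag_induction)
    case zero
    then show ?case by (simp add: clear_denominator_hom[OF N] clear_denominator_hom[OF N'] f_zero)
  next
    case (one p)
    then show ?case
      by (cases p) (auto simp: clear_denominator(2)[OF N] clear_denominator(2)[OF N'] f_props)
  next
    case (diff a b)
    then have k: "Poly_Mapping.keys a \<subseteq> carrier N \<times> B" "Poly_Mapping.keys b \<subseteq> carrier N \<times> B" by auto
    show ?case using k keys_diff_subset[OF k] diff push_keys[OF k(1)] push_keys[OF k(2)]
        clear_denominator_hom(1)[OF N k(1)] clear_denominator_hom(1)[OF N k(2)]
      by (simp add: clear_denominator_hom(3)[OF N] clear_denominator_hom(3)[OF N'] f_minus)
  qed
  then show ?thesis by simp
qed

text \<open>If \<open>c\<close> were no relation, its annihilator would lie in a maximal ideal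
  \<open>q\<close> of \<open>B\<close>. Outside \<open>q\<close> there is a denominator that clears
  \<open>c\<close> and sends \<open>push f c\<close> to zero. Injectivity of \<open>f\<close> then
  makes the cleared element of \<open>c\<close> zero, so this denominator annihilates
  \<open>c\<close>.\<close>

lemma push_reflects_relations:
  assumes inj: "inj_on f (carrier N)"
    and den: "\<And>q f. primeideal q (sub B) \<Longrightarrow> f \<in> B \<Longrightarrow> \<exists>s\<in>A. s \<notin> q \<and> s \<otimes> f \<in> A"
    and c: "Poly_Mapping.keys c \<subseteq> carrier N \<times> B" "push f c \<in> relations N'"
  shows "c \<in> relations N"
proof -
  let ?I = "{d \<in> B. act d c \<in> relations N}"
  have I: "ideal ?I (sub B)" by (rule annihilator_ideal[OF N c(1)])
  have "\<one> \<in> ?I"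
  proof (rule ccontr)
    assume "\<one> \<notin> ?I"
    then obtain q where q: "maximalideal q (sub B)" "?I \<subseteq> q" by (rule exists_maximal[OF B I])
    have qp: "primeideal q (sub B)" by (rule maximal_sub_prime[OF B q(1)])
    note p = primeideal_subD[OF B qp]
    obtain s where s: "s \<in> A" "s \<notin> q" "Poly_Mapping.keys (push f c) \<subseteq> cleared N' s" "clear_denominator N' s (push f c) = \<zero>\<^bsub>N'\<^esub>"
      using relation_vanishes[OF N' qp den[OF qp] c(2)] by blast
    \<comment> \<open>\<open>s\<close> clears only the support of \<open>push f c\<close>, where
      terms may have cancelled; the finite support of \<open>c\<close> needs a denominator of its
      own.\<close>
    have "\<exists>t\<in>A. t \<notin> q \<and> (\<forall>y\<in>Y. t \<otimes> y \<in> A)" if "finite Y" "Y \<subseteq> B" for Y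
      using that
    proof (induction Y rule: finite_induct)
      case empty
      then show ?case using A_closed(3) p(2) by blast
    next
      case (insert y Y)
      then obtain t where t: "t \<in> A" "t \<notin> q" "\<And>y. y \<in> Y \<Longrightarrow> t \<otimes> y \<in> A" by auto
      obtain t' where t': "t' \<in> A" "t' \<notin> q" "t' \<otimes> y \<in> A" using den[OF qp, of y] insert.prems by auto
      have tt: "t \<otimes> t' \<in> A" "t \<otimes> t' \<notin> q" using t t' p(3)[of t t'] A_closed by auto
      have "(t \<otimes> t') \<otimes> z \<in> A" if z: "z \<in> insert y Y" for z
      proof -
        have cr: "t \<in> carrier R" "t' \<in> carrier R" "z \<in> carrier R" using t t' z insert.prems A_closed by auto
        have "(t \<otimes> t') \<otimes> z = t \<otimes> (t' \<otimes> z)" "(t \<otimes> t') \<otimes> z = t' \<otimes> (t \<otimes> z)" using cr by (simp_all add: m_ac)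
        moreover have "z = y \<Longrightarrow> t \<otimes> (t' \<otimes> z) \<in> A" "z \<in> Y \<Longrightarrow> t' \<otimes> (t \<otimes> z) \<in> A"
          using A_closed(5)[OF t(1) t'(3)] A_closed(5)[OF t'(1) t(3)[of z]] by auto
        ultimately show ?thesis using z by auto
      qed
      then show ?case using tt by blast
    qed
    from this[of "snd ` Poly_Mapping.keys c"] obtain t where t: "t \<in> A" "t \<notin> q" "\<And>y. y \<in> snd ` Poly_Mapping.keys c \<Longrightarrow> t \<otimes> y \<in> A"
      using c(1) by fastforce
    have kt: "Poly_Mapping.keys c \<subseteq> cleared N t" using c(1) t(3) by force
    have st: "s \<otimes> t \<in> A" "s \<otimes> t \<notin> q" "s \<otimes> t = t \<otimes> s" using s t p(3)[of s t] A_closed by (auto simp: m_comm)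
    have k: "Poly_Mapping.keys c \<subseteq> cleared N (s \<otimes> t)" by (rule cleared_mult[OF N t(1) s(1) kt])
    have "f (clear_denominator N (s \<otimes> t) c) = clear_denominator N' (t \<otimes> s) (push f c)"
      using clear_denominator_push[OF st(1) k] st(3) by simp
    also have "\<dots> = \<zero>\<^bsub>N'\<^esub>"
      using clear_denominator_mult[OF N' s(1) t(1) s(3)] s(4) t(1) by simp
    finally have "f (clear_denominator N (s \<otimes> t) c) = f \<zero>\<^bsub>N\<^esub>" by (simp add: f_zero)
    then have "clear_denominator N (s \<otimes> t) c = \<zero>\<^bsub>N\<^esub>"
      using inj_onD[OF inj] clear_denominator_hom(1)[OF N c(1)] by simp
    then have "act (s \<otimes> t) c - frag_of (\<zero>\<^bsub>N\<^esub>, \<one>) \<in> relations N"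
      using clear_denominator_act[OF N st(1) k] by simp
    \<comment> \<open>The case \<open>c = 0\<close> of the same lemma shows that the pair of zero
      and one is itself a relation up to sign.\<close>
    moreover have "act \<one> 0 - frag_of (\<zero>\<^bsub>N\<^esub>, \<one>) \<in> relations N"
      using clear_denominator_act[OF N A_closed(3), of 0] clear_denominator_hom(2)[OF N] by simp
    ultimately have "(act (s \<otimes> t) c - frag_of (\<zero>\<^bsub>N\<^esub>, \<one>)) - (act \<one> 0 - frag_of (\<zero>\<^bsub>N\<^esub>, \<one>)) \<in> relations N"
      by (rule relations_diff[OF N])
    then have "act (s \<otimes> t) c \<in> relations N" by (simp add: act_zero[OF N])
    then show False using q(2) st(2) A_sub_B[OF st(1)] by blast
  qed
  then show ?thesis using act_one[OF N c(1)] by simp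
qed

end

text \<open>Elements of the tensor product are cosets of formal sums, so injectivity of
  \<open>tensor_map\<close> amounts to \<open>push f\<close> reflecting relations for differences of
  representatives.\<close>

lemma flat_if_locally_localization:
  assumes den: "\<And>q f. primeideal q (sub B) \<Longrightarrow> f \<in> B \<Longrightarrow> \<exists>s\<in>A. s \<notin> q \<and> s \<otimes> f \<in> A"
  shows "flat_module TYPE('n) TYPE('k) (sub A) M"
  unfolding flat_module_def
proof (intro conjI allI impI M_module)
  fix N :: "('a, 'n) module" and N' :: "('a, 'k) module" and f
  assume "module (sub A) N \<and> module (sub A) N' \<and> f \<in> module_hom (sub A) N N' \<and> inj_on f (carrier N)"
  then have h: "module (sub A) N" "module (sub A) N'" "f \<in> module_hom (sub A) N N'" "inj_on f (carrier N)" by auto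
  note sg = relations_subgroup[OF h(1)] and sg' = relations_subgroup[OF h(2)]
  let ?G = "formal_sums N" and ?G' = "formal_sums N'"
  have same: "H #>\<^bsub>K\<^esub> a = H #>\<^bsub>K\<^esub> b \<longleftrightarrow> a - b \<in> H"
    if "K = free_Abelian_group S" "subgroup H K" "Poly_Mapping.keys a \<subseteq> S" "Poly_Mapping.keys b \<subseteq> S"
    for K H a b and S :: "'z set"
  proof -
    interpret K: group K using that(1) by simp
    have ab: "a \<in> carrier K" "b \<in> carrier K" using that by auto
    have "a - b \<in> H \<longleftrightarrow> a \<in> H #>\<^bsub>K\<^esub> b"
      using subgroup.rcos_module[OF that(2) K.is_group ab(2,1)] that(1,4) by simp
    also have "\<dots> \<longleftrightarrow> H #>\<^bsub>K\<^esub> a = H #>\<^bsub>K\<^esub> b"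
      using K.repr_independence[OF _ ab(2) that(2), of a] K.rcos_self[OF ab(1) that(2)] by auto
    finally show ?thesis by simp
  qed
  have map: "tensor_map (sub A) N' M f (relations N #>\<^bsub>?G\<^esub> c) = relations N' #>\<^bsub>?G'\<^esub> push f c"
    if c: "Poly_Mapping.keys c \<subseteq> carrier N \<times> B" for c
  proof -
    have cG: "c \<in> carrier ?G" using c by simp
    \<comment> \<open>\<open>tensor_map\<close> extracts the only element of an image of a coset, so
      independence of the representative has to be shown.\<close>
    have "relations N' #>\<^bsub>?G'\<^esub> push f c' = relations N' #>\<^bsub>?G'\<^esub> push f c" if c': "c' \<in> relations N #>\<^bsub>?G\<^esub> c" for c'
    proof -
      have k': "Poly_Mapping.keys c' \<subseteq> carrier N \<times> B"
        using subgroup.elemrcos_carrier[OF sg group_free_Abelian_group cG c'] by simp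
      have "c' - c \<in> relations N"
        using subgroup.rcos_module_imp[OF sg group_free_Abelian_group cG c'] c by simp
      then have "push f c' - push f c \<in> relations N'" using push_relations[OF h(1-3)] by fastforce
      then show ?thesis using same[OF refl sg'] push_keys[OF h(1-3) k'] push_keys[OF h(1-3) c] by blast
    qed
    moreover have "c \<in> relations N #>\<^bsub>?G\<^esub> c" using group.rcos_self[OF group_free_Abelian_group cG sg] .
    ultimately have "(\<lambda>c. relations N' #>\<^bsub>?G'\<^esub> push f c) ` (relations N #>\<^bsub>?G\<^esub> c) = {relations N' #>\<^bsub>?G'\<^esub> push f c}"
      by blast
    then show ?thesis unfolding tensor_map_def push_def by simp
  qed
  show "inj_on (tensor_map (sub A) N' M f) (carrier (tensor_product (sub A) N M))"
  proof (rule inj_onI)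
    fix C C' assume "C \<in> carrier (tensor_product (sub A) N M)" "C' \<in> carrier (tensor_product (sub A) N M)"
      and eq: "tensor_map (sub A) N' M f C = tensor_map (sub A) N' M f C'"
    then obtain c c' where c: "Poly_Mapping.keys c \<subseteq> carrier N \<times> B" "C = relations N #>\<^bsub>?G\<^esub> c"
      and c': "Poly_Mapping.keys c' \<subseteq> carrier N \<times> B" "C' = relations N #>\<^bsub>?G\<^esub> c'"
      by (auto simp: tensor_product_def FactGroup_def RCOSETS_def)
    have "push f c - push f c' \<in> relations N'"
      using eq map[OF c(1)] map[OF c'(1)] same[OF refl sg' push_keys[OF h(1-3) c(1)] push_keys[OF h(1-3) c'(1)]] c(2) c'(2) by simp
    then have "c - c' \<in> relations N"
      using push_reflects_relations[OF h den keys_diff_subset[OF c(1) c'(1)]] by simp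
    then show "C = C'" using same[OF refl sg c(1) c'(1)] c(2) c'(2) by simp
  qed
qed

end

section \<open>Charts of the projective model\<close>

context field
begin

text \<open>Elements of \<open>C\<close> outside the contracted prime are units of the local ring of
  \<open>A\<close> at \<open>P\<close>. Conversely, a fraction of that local ring has numerator and
  denominator in \<open>A\<close>, hence in the localization of \<open>C\<close>.\<close>

lemma dominating_subring_localization:
  assumes A: "subring A R" "primeideal P (sub A)" and C: "subring C R" "C \<subseteq> ext A P A"
    and sub: "A \<subseteq> ext C (ext A P P \<inter> C) C"
  shows "primeideal (ext A P P \<inter> C) (sub C)" "ext C (ext A P P \<inter> C) C = ext A P A"
proof -
  let ?L = "ext A P A" and ?p = "ext A P P \<inter> C"
  note L = ext_subring[OF A]
  have mp: "primeideal (ext A P P) (sub ?L)" by (rule ext_prime[OF A A(2) order_refl])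
  note m = primeideal_subD[OF L(1) mp]
  show p: "primeideal ?p (sub C)" by (rule prime_contract[OF C(1) L(1) C(2) mp])
  note pc = prime_complement_mult[OF C(1) p]
  note [simp] = subring_closed[OF C(1)] subring_closed[OF A(1)]
  note Lc = subring_closed[OF L(1)]
  show "ext C ?p C = ?L"
  proof
    show "ext C ?p C \<subseteq> ?L"
    proof
      fix f assume "f \<in> ext C ?p C"
      then obtain s where s: "f \<in> carrier R" "s \<in> C" "s \<notin> ?p" "s \<otimes> f \<in> C" by (rule extE)
      then have sL: "s \<in> ?L" "s \<notin> ext A P P" "s \<otimes> f \<in> ?L" using C(2) by auto
      have mx: "max_ideal (sub ?L) = ext A P P"
        unfolding max_ideal_def by (rule the_equality) (use ext_max(2,3)[OF A] in blast)+
      have loc: "local_ring (sub ?L)" unfolding local_ring_def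
        using sub_cring[OF L(1)] ext_max(2,3)[OF A] by blast
      have i: "inv s \<in> ?L" "s \<noteq> \<zero>" using local_ring_max_ideal(3)[OF L(1) loc sL(1)] sL(2) mx by auto
      have "inv s \<otimes> (s \<otimes> f) = f" using field_inv[of s] i(2) s(1,2) by (simp flip: m_assoc)
      then show "f \<in> ?L" using Lc(5)[OF i(1) sL(3)] by simp
    qed
    show "?L \<subseteq> ext C ?p C"
    proof
      fix f assume "f \<in> ?L"
      then obtain s where s: "f \<in> carrier R" "s \<in> A" "s \<notin> P" "s \<otimes> f \<in> A" by (rule extE)
      have "s \<otimes> f \<in> ext C ?p C" using sub s(4) by blast
      then obtain u where u: "u \<in> C" "u \<notin> ?p" "u \<otimes> (s \<otimes> f) \<in> C" by (rule extE)
      have "s \<in> ext C ?p C" using sub s(2) by blast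
      then obtain v where v: "v \<in> C" "v \<notin> ?p" "v \<otimes> s \<in> C" by (rule extE)
      have "s \<notin> ext A P P" using ext_contract[OF A A(2) order_refl] s(2,3) by blast
      then have "v \<otimes> s \<notin> ext A P P"
        using m(3)[of v s] v(1,2) C(2) s(2) L(2) by blast
      then have w: "u \<otimes> (v \<otimes> s) \<in> C" "u \<otimes> (v \<otimes> s) \<notin> ?p" using pc[OF u(1,2) v(3)] by auto
      have cr: "u \<in> carrier R" "v \<in> carrier R" "s \<in> carrier R" using u v s by simp_all
      have "(u \<otimes> (v \<otimes> s)) \<otimes> f = v \<otimes> (u \<otimes> (s \<otimes> f))" using cr s(1) by algebra
      also have "\<dots> \<in> C" using v(1) u(3) by simp
      finally show "f \<in> ext C ?p C" using s(1) w by (intro extI)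
    qed
  qed
qed

lemma ext_unit:
  assumes "subring A R" "primeideal P (sub A)" "s \<in> ext A P A" "t \<in> ext A P A" "s \<otimes> t = \<one>"
  shows "s \<notin> ext A P P"
proof
  note L = ext_subring[OF assms(1,2)]
  note m = primeideal_subD[OF L(1) ext_prime[OF assms(1,2,2) order_refl]]
  assume "s \<in> ext A P P"
  then have "\<one> \<in> ext A P P" using ideal_subD(7)[OF L(1) m(1) assms(4)] assms(5) by metis
  then show False using m(2) by simp
qed

context
  fixes D J :: "'a set"
  assumes D: "subring D R" and J: "ideal J (sub D)"
begin

lemmas [simp] = subring_closed[OF D]

lemma affine_component_props:
  assumes "b \<in> J" "b \<noteq> \<zero>"
  shows "subring (affine_component R D J b) R" "D \<subseteq> affine_component R D J b"
    "c \<in> J \<Longrightarrow> c \<otimes> inv b \<in> affine_component R D J b"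
    "subring S R \<Longrightarrow> D \<subseteq> S \<Longrightarrow> (\<And>c. c \<in> J \<Longrightarrow> c \<otimes> inv b \<in> S) \<Longrightarrow> affine_component R D J b \<subseteq> S"
proof -
  note j = ideal_subD[OF D J]
  let ?H = "D \<union> {c \<otimes> inv b | c. c \<in> J}"
  have bc: "b \<in> carrier R" using j(3) assms(1) .
  have H: "?H \<subseteq> carrier R" using field_inv(1)[OF bc assms(2)] j(3) by auto
  show "subring (affine_component R D J b) R"
    unfolding affine_component_def by (rule generate_ring_is_subring[OF H])
  have i: "?H \<subseteq> affine_component R D J b"
    unfolding affine_component_def by (auto intro: generate_ring.incl)
  show "D \<subseteq> affine_component R D J b" using i by blast
  show "c \<in> J \<Longrightarrow> c \<otimes> inv b \<in> affine_component R D J b" using i by blast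
  show "affine_component R D J b \<subseteq> S" if S: "subring S R" "D \<subseteq> S" "\<And>c. c \<in> J \<Longrightarrow> c \<otimes> inv b \<in> S"
  proof -
    have "?H \<subseteq> S" using S(2,3) by blast
    then show ?thesis unfolding affine_component_def by (rule generate_ring_min_subring1[OF H S(1)])
  qed
qed

text \<open>Lets statements about all fractions \<open>d/b\<close> with \<open>d \<in> J\<close> be
  checked on generators of \<open>J\<close>.\<close>

lemma fraction_ideal:
  assumes "subring S R" "D \<subseteq> S" "ideal I (sub S)" "b \<in> carrier R" "b \<noteq> \<zero>"
  shows "ideal {d \<in> D. d \<otimes> inv b \<in> I} (sub D)"
proof (rule ideal_subI[OF D])
  note i = ideal_subD[OF assms(1,3)]
  note ib = field_inv[OF assms(4,5)]
  show "\<zero> \<in> {d \<in> D. d \<otimes> inv b \<in> I}" using i(4) ib by simp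
  show "p \<oplus> q \<in> {d \<in> D. d \<otimes> inv b \<in> I}" if "p \<in> {d \<in> D. d \<otimes> inv b \<in> I}" "q \<in> {d \<in> D. d \<otimes> inv b \<in> I}" for p q
    using that i(5)[of "p \<otimes> inv b" "q \<otimes> inv b"] ib by (simp add: l_distr)
  show "a \<otimes> p \<in> {d \<in> D. d \<otimes> inv b \<in> I}" if "a \<in> D" "p \<in> {d \<in> D. d \<otimes> inv b \<in> I}" for a p
    using that i(6)[of a "p \<otimes> inv b"] ib assms(2) by (auto simp: m_assoc)
qed auto

lemma affine_component_noetherian:
  assumes "noetherian_ring (sub D)" "J = genideal (sub D) G" "finite G" "G \<subseteq> D" and b: "b \<in> J" "b \<noteq> \<zero>"
  shows "noetherian_ring (sub (affine_component R D J b))"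
proof -
  note j = ideal_subD[OF D J]
  note ap = affine_component_props[OF b]
  have bc: "b \<in> carrier R" using j(3) b by simp
  let ?H = "(\<lambda>g. g \<otimes> inv b) ` G"
  have GJ: "G \<subseteq> J" using genideal_subE(2)[OF D assms(4)] assms(2) by simp
  have H: "finite ?H" "?H \<subseteq> carrier R" using assms(3) GJ j(3) field_inv(1)[OF bc b(2)] by auto
  obtain S where S: "subring S R" "noetherian_ring (sub S)" "D \<union> ?H \<subseteq> S"
    "\<And>T. subring T R \<Longrightarrow> D \<union> ?H \<subseteq> T \<Longrightarrow> S \<subseteq> T"
    using noetherian_finite_type[OF D assms(1) H] by blast
  have "ideal {d \<in> D. d \<otimes> inv b \<in> S} (sub D)"
    by (rule fraction_ideal[OF S(1) _ carrier_ideal[OF S(1)] bc b(2)]) (use S(3) in auto)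
  moreover have "G \<subseteq> {d \<in> D. d \<otimes> inv b \<in> S}" using S(3) assms(4) by auto
  ultimately have "J \<subseteq> {d \<in> D. d \<otimes> inv b \<in> S}" unfolding assms(2) by (rule genideal_subE(3)[OF D assms(4)])
  then have "affine_component R D J b \<subseteq> S" using S(3) by (intro ap(4) S(1)) auto
  moreover have "S \<subseteq> affine_component R D J b"
    by (rule S(4)[OF ap(1)]) (use ap(2,3) GJ in auto)
  ultimately show ?thesis using S(2) by simp
qed

text \<open>Elements with a power of \<open>b\<close> as denominator form a subring that contains
  \<open>D\<close> and all \<open>c/b\<close> with \<open>c \<in> J\<close>.\<close>

lemma affine_component_denominator:
  assumes b: "b \<in> J" "b \<noteq> \<zero>" and z: "z \<in> affine_component R D J b"
  shows "\<exists>r::nat. b [^] r \<otimes> z \<in> D"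
proof -
  note j = ideal_subD[OF D J]
  have bD [simp]: "b \<in> D" "b \<in> carrier R" using j(2,3) b by simp_all
  let ?S = "{z \<in> carrier R. \<exists>r::nat. b [^] r \<otimes> z \<in> D}"
  have "subring ?S R"
  proof (rule subringI)
    have "b [^] (0::nat) \<otimes> \<one> \<in> D" by simp
    then show "\<one> \<in> ?S" by blast
    show "\<ominus> h \<in> ?S" if h: "h \<in> ?S" for h
    proof -
      obtain r where "b [^] (r::nat) \<otimes> h \<in> D" using h by auto
      then have "b [^] r \<otimes> \<ominus> h \<in> D" using h subring_closed(4)[OF D] by (auto simp: r_minus)
      then show ?thesis using h by auto
    qed
    show "h \<otimes> h' \<in> ?S" if h: "h \<in> ?S" "h' \<in> ?S" for h h'
    proof -
      obtain r r' where r: "b [^] (r::nat) \<otimes> h \<in> D" "b [^] (r'::nat) \<otimes> h' \<in> D" using h by auto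
      have "b [^] (r + r') \<otimes> (h \<otimes> h') = (b [^] r \<otimes> h) \<otimes> (b [^] r' \<otimes> h')"
        using h by (simp add: nat_pow_mult[symmetric] m_ac)
      also have "\<dots> \<in> D" using r by simp
      finally show ?thesis using h by blast
    qed
    show "h \<oplus> h' \<in> ?S" if h: "h \<in> ?S" "h' \<in> ?S" for h h'
    proof -
      obtain r r' where r: "b [^] (r::nat) \<otimes> h \<in> D" "b [^] (r'::nat) \<otimes> h' \<in> D" using h by auto
      have "b [^] (r + r') \<otimes> (h \<oplus> h') = b [^] r' \<otimes> (b [^] r \<otimes> h) \<oplus> b [^] r \<otimes> (b [^] r' \<otimes> h')"
        using h by (simp add: nat_pow_mult[symmetric] m_ac r_distr)
      also have "\<dots> \<in> D" using r by simp
      finally show ?thesis using h by blast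
    qed
  qed auto
  moreover have "D \<subseteq> ?S"
  proof
    fix d assume "d \<in> D"
    then have "d \<in> carrier R" "b [^] (0::nat) \<otimes> d \<in> D" by simp_all
    then show "d \<in> ?S" by blast
  qed
  moreover have "c \<otimes> inv b \<in> ?S" if c: "c \<in> J" for c
  proof -
    have cc: "c \<in> carrier R" "c \<in> D" using j(2,3) c by simp_all
    have "b [^] (1::nat) \<otimes> (c \<otimes> inv b) = c"
      using eq_mult_inv_iff[of "c \<otimes> inv b" c b] cc b(2) bD(2) field_inv(1)[OF bD(2) b(2)] by simp
    then show ?thesis using cc field_inv[OF bD(2) b(2)] by (metis (mono_tags, lifting) m_closed mem_Collect_eq)
  qed
  ultimately have "affine_component R D J b \<subseteq> ?S" by (rule affine_component_props(4)[OF b])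
  then show ?thesis using z by auto
qed

lemma fraction_mult:
  assumes "a \<in> J" "b \<in> J" "b \<noteq> \<zero>" "c \<in> J" "c \<noteq> \<zero>"
  shows "(b \<otimes> inv c) \<otimes> (a \<otimes> inv b) = a \<otimes> inv c"
proof -
  have cr: "a \<in> carrier R" "b \<in> carrier R" "c \<in> carrier R" using assms ideal_subD(3)[OF D J] by auto
  note ib = field_inv[OF cr(2) assms(3)] and ic = field_inv[OF cr(3) assms(5)]
  have "(b \<otimes> inv c) \<otimes> (a \<otimes> inv b) = (b \<otimes> inv b) \<otimes> (a \<otimes> inv c)"
    using cr ib(1) ic(1) by algebra
  then show ?thesis using ib ic cr by simp
qed

lemma fraction_self: "b \<in> J \<Longrightarrow> b \<noteq> \<zero> \<Longrightarrow> b \<otimes> inv b = \<one>"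
  using ideal_subD(3)[OF D J] field_inv(2) by blast

text \<open>\<open>b/c\<close> is a unit of the local ring, since its inverse \<open>c/b\<close>
  belongs to the chart of \<open>b\<close>. It thus lies outside the contracted prime
  \<open>p\<close>, and every \<open>d/b = (d/c)/(b/c)\<close> belongs to the localization of the
  chart of \<open>c\<close> at \<open>p\<close>.\<close>

lemma chart_change:
  assumes b: "b \<in> J" "b \<noteq> \<zero>" and c: "c \<in> J" "c \<noteq> \<zero>"
    and P: "primeideal P (sub (affine_component R D J b))"
    and sub: "affine_component R D J c \<subseteq> ext (affine_component R D J b) P (affine_component R D J b)"
  obtains p where "primeideal p (sub (affine_component R D J c))"
    "ext (affine_component R D J c) p (affine_component R D J c) =
      ext (affine_component R D J b) P (affine_component R D J b)"
proof -
  let ?A = "affine_component R D J b" and ?C = "affine_component R D J c"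
  note A = affine_component_props[OF b] and C = affine_component_props[OF c]
  note L = ext_subring[OF A(1) P]
  let ?p = "ext ?A P P \<inter> ?C"
  have mp: "primeideal (ext ?A P P) (sub (ext ?A P ?A))" by (rule ext_prime[OF A(1) P P order_refl])
  have p: "primeideal ?p (sub ?C)" by (rule prime_contract[OF C(1) L(1) sub mp])
  have u: "b \<otimes> inv c \<in> ?C" "c \<otimes> inv b \<in> ?A" using A(3)[OF c(1)] C(3)[OF b(1)] by auto
  have "(b \<otimes> inv c) \<otimes> (c \<otimes> inv b) = \<one>" using fraction_mult[OF c(1) b c] fraction_self[OF c] by simp
  then have "b \<otimes> inv c \<notin> ext ?A P P" using u sub L(2) by (intro ext_unit[OF A(1) P]) auto
  then have un: "b \<otimes> inv c \<notin> ?p" by auto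
  have "?A \<subseteq> ext ?C ?p ?C"
  proof (rule A(4))
    show "subring (ext ?C ?p ?C) R" by (rule ext_subring(1)[OF C(1) p])
    show "D \<subseteq> ext ?C ?p ?C" using C(2) ext_subring(2)[OF C(1) p] by auto
    fix d assume d: "d \<in> J"
    have "(b \<otimes> inv c) \<otimes> (d \<otimes> inv b) \<in> ?C" using fraction_mult[OF d b c] C(3)[OF d] by simp
    then show "d \<otimes> inv b \<in> ext ?C ?p ?C"
      using u(1) un subring_closed(1)[OF A(1) A(3)[OF d]] by (intro extI)
  qed
  then show ?thesis
    using that dominating_subring_localization[OF A(1) P C(1) sub] by blast
qed

text \<open>Needed because \<open>b\<close> may differ from the generators that define the model. If
  all \<open>c/b\<close> with \<open>c \<in> G\<close> were in \<open>P\<close>, so would be all of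
  \<open>J/b\<close>, including \<open>b/b = \<one>\<close>. A generator with \<open>c/b\<close>
  outside \<open>P\<close> gives a chart contained in the local ring.\<close>

lemma chart_containing_prime:
  assumes G: "J = genideal (sub D) G" "G \<subseteq> D" "\<zero> \<notin> G" and b: "b \<in> J" "b \<noteq> \<zero>"
    and P: "primeideal P (sub (affine_component R D J b))"
  obtains c p where "c \<in> G" "primeideal p (sub (affine_component R D J c))"
    "ext (affine_component R D J c) p (affine_component R D J c) =
      ext (affine_component R D J b) P (affine_component R D J b)"
proof -
  let ?A = "affine_component R D J b"
  note A = affine_component_props[OF b]
  note L = ext_subring[OF A(1) P]
  note p = primeideal_subD[OF A(1) P]
  have bc: "b \<in> carrier R" using ideal_subD(3)[OF D J] b by simp
  have GJ: "G \<subseteq> J" using genideal_subE(2)[OF D G(2)] G(1) by simp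
  have "\<exists>c\<in>G. c \<otimes> inv b \<notin> P"
  proof (rule ccontr)
    assume "\<not> ?thesis"
    then have "G \<subseteq> {d \<in> D. d \<otimes> inv b \<in> P}" using G(2) by auto
    then have "J \<subseteq> {d \<in> D. d \<otimes> inv b \<in> P}" unfolding G(1)
      by (rule genideal_subE(3)[OF D G(2) fraction_ideal[OF A(1,2) p(1) bc b(2)]])
    then show False using b fraction_self[OF b] p(2) by auto
  qed
  then obtain c where c: "c \<in> G" "c \<otimes> inv b \<notin> P" by auto
  then have cJ: "c \<in> J" "c \<noteq> \<zero>" using GJ G(3) by auto
  have "affine_component R D J c \<subseteq> ext ?A P ?A"
  proof (rule affine_component_props(4)[OF cJ L(1)])
    show "D \<subseteq> ext ?A P ?A" using A(2) L(2) by auto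
    fix d assume d: "d \<in> J"
    have "(c \<otimes> inv b) \<otimes> (d \<otimes> inv c) = d \<otimes> inv b" by (rule fraction_mult[OF d cJ b])
    then have "(c \<otimes> inv b) \<otimes> (d \<otimes> inv c) \<in> ?A" using A(3)[OF d] by simp
    moreover have "d \<otimes> inv c \<in> carrier R"
      using subring_closed(1)[OF affine_component_props(1)[OF cJ] affine_component_props(3)[OF cJ d]] .
    ultimately show "d \<otimes> inv c \<in> ext ?A P ?A" using c(2) A(3)[OF cJ(1)] by (intro extI)
  qed
  from chart_change[OF b cJ P this] that c(1) show ?thesis by blast
qed

end

lemma minimal_generator_nonzero:
  assumes D: "subring D R" and "minimal_generating_set (sub D) J G" "b \<in> G"
  shows "b \<noteq> \<zero>"
proof
  assume "b = \<zero>"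
  have G: "G \<subseteq> D" "genideal (sub D) G = J" "\<And>H. H \<subset> G \<Longrightarrow> genideal (sub D) H \<noteq> J"
    using assms(2) by (auto simp: minimal_generating_set_def)
  let ?H = "G - {\<zero>}"
  have H: "?H \<subseteq> D" using G(1) by auto
  note h = genideal_subE[OF D H] and g = genideal_subE[OF D G(1)]
  have "G \<subseteq> genideal (sub D) ?H" using h(2) ideal_subD(4)[OF D h(1)] by auto
  then have "genideal (sub D) G \<subseteq> genideal (sub D) ?H" by (rule g(3)[OF h(1)])
  moreover have "genideal (sub D) ?H \<subseteq> genideal (sub D) G" using h(3)[OF g(1)] g(2) by auto
  ultimately have "genideal (sub D) ?H = J" using G(2) by auto
  then show False using G(3)[of ?H] assms(3) \<open>b = \<zero>\<close> by auto
qed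

lemma two_generated_local_if_regular:
  assumes D: "subring D R" and reg: "regular_local_ring (sub D)" and dim: "krull_dim (sub D) = 2"
  obtains x y where "two_generated_local R D x y"
proof -
  obtain G where G: "G \<subseteq> D" "enat (card G) = 2" "genideal (sub D) G = max_ideal (sub D)"
    using reg dim by (auto simp: regular_local_ring_def)
  then obtain x y where xy: "G = {x, y}" by (auto simp: numeral_eq_enat card_2_iff)
  note [simp] = subring_closed[OF D]
  have [simp]: "x \<in> D" "y \<in> D" using G xy by auto
  let ?K = "{p \<oplus> q | p q. p \<in> {a \<otimes> x | a. a \<in> D} \<and> q \<in> {a \<otimes> y | a. a \<in> D}}"
  have K: "ideal ?K (sub D)" by (intro ideal_sum[OF D] principal_ideal[OF D]) auto
  have KK: "?K = {x \<otimes> a \<oplus> y \<otimes> b | a b. a \<in> D \<and> b \<in> D}"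
  proof (intro equalityI subsetI)
    fix u assume "u \<in> ?K"
    then obtain a b where ab: "a \<in> D" "b \<in> D" "u = a \<otimes> x \<oplus> b \<otimes> y" by auto
    then have "u = x \<otimes> a \<oplus> y \<otimes> b" by (simp add: m_comm)
    then show "u \<in> {x \<otimes> a \<oplus> y \<otimes> b | a b. a \<in> D \<and> b \<in> D}" using ab by blast
  next
    fix u assume "u \<in> {x \<otimes> a \<oplus> y \<otimes> b | a b. a \<in> D \<and> b \<in> D}"
    then obtain a b where ab: "a \<in> D" "b \<in> D" "u = x \<otimes> a \<oplus> y \<otimes> b" by auto
    then have "u = a \<otimes> x \<oplus> b \<otimes> y" by (simp add: m_comm)
    then show "u \<in> ?K" using ab by blast
  qed
  have "x = x \<otimes> \<one> \<oplus> y \<otimes> \<zero>" "y = x \<otimes> \<zero> \<oplus> y \<otimes> \<one>" by simp_all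
  then have "x \<in> ?K" "y \<in> ?K" unfolding KK using subring_closed(2,3)[OF D] by blast+
  then have "genideal (sub D) G \<subseteq> ?K" using genideal_subE(3)[OF D G(1) K] xy by simp
  moreover have "?K \<subseteq> genideal (sub D) G"
  proof -
    note g = genideal_subE(1,2)[OF D G(1)]
    note i = ideal_subD[OF D g(1)]
    have "x \<in> genideal (sub D) G" "y \<in> genideal (sub D) G" using g(2) xy by auto
    then show ?thesis using i(5,6) by auto
  qed
  ultimately have "max_ideal (sub D) = {x \<otimes> a \<oplus> y \<otimes> b | a b. a \<in> D \<and> b \<in> D}" using G(3) KK by simp
  then have "two_generated_local R D x y"
    using reg D by (intro two_generated_local.intro two_generated_local_axioms.intro field_axioms)
      (simp_all add: regular_local_ring_def)
  then show ?thesis by (rule that)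
qed

end

theorem theorem6p3:
  fixes F :: "('a, 'm) ring_scheme"
    and D J A B :: "'a set" and V U :: "'a set set"
    and a :: "nat \<Rightarrow> 'a" and n :: nat and b :: 'a
  assumes "field F"
    and "subring D F"
    and "quotient_field F D = carrier F"
    and "regular_local_ring (F\<lparr>carrier := D\<rparr>)"
    and "krull_dim (F\<lparr>carrier := D\<rparr>) = 2"
    and "\<forall>i \<le> n. a i \<in> D \<and> a i \<noteq> \<zero>\<^bsub>F\<^esub>"
    and "J = genideal (F\<lparr>carrier := D\<rparr>) (a ` {..n})"
    and "primary_to (F\<lparr>carrier := D\<rparr>) (max_ideal (F\<lparr>carrier := D\<rparr>)) J"
    and "V = proj_model F D n a"
    and "nonsingular_model F V"
    and "b \<in> J"
    and "\<exists>G. minimal_generating_set (F\<lparr>carrier := D\<rparr>) J G \<and> b \<in> G"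
    and "A = affine_component F D J b"
    and "U = {\<alpha> \<in> closed_points F V. A \<subseteq> \<alpha>}"
    and "B = intersection_ring F U"
  shows "(regular_domain F A) \<and>
     (\<forall>\<alpha> \<in> U. \<exists>M. maximalideal M (F\<lparr>carrier := A\<rparr>) \<and> height (F\<lparr>carrier := A\<rparr>) M = 2 \<and>
           \<alpha> = localization_at F A M) \<and>
     (\<forall>M. maximalideal M (F\<lparr>carrier := A\<rparr>) \<and> height (F\<lparr>carrier := A\<rparr>) M = 2 \<longrightarrow>
           localization_at F A M \<in> U \<and>
           localization_at F A M =
             localization_at F B (genideal (F\<lparr>carrier := localization_at F A M\<rparr>) M \<inter> B)) \<and>
     (essential_representation F U) \<and>
     (U \<noteq> {} \<longrightarrow> (\<forall>q. maximalideal q (F\<lparr>carrier := B\<rparr>) \<longrightarrow>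
           height (F\<lparr>carrier := B\<rparr>) q = 2 \<and> localization_at F B q = localization_at F A (q \<inter> A))) \<and>
     (overring F A B \<and>
           flat_module TYPE('n) TYPE('k) (F\<lparr>carrier := A\<rparr>) (subset_module F B))"
proof -
  interpret field F by fact
  note D = \<open>subring D F\<close>
  let ?G = "a ` {..n}"
  have GD: "?G \<subseteq> D" "\<zero>\<^bsub>F\<^esub> \<notin> ?G" using assms(6) by auto
  have Ji: "ideal J (sub D)" unfolding assms(7) by (rule genideal_subE(1)[OF D GD(1)])
  note j = ideal_subD[OF D Ji]
  have bn: "b \<noteq> \<zero>\<^bsub>F\<^esub>" using minimal_generator_nonzero[OF D] assms(12) by blast
  have b: "b \<in> J" "b \<noteq> \<zero>\<^bsub>F\<^esub>" using assms(11) bn by auto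
  note ap = affine_component_props[OF D Ji b, folded assms(13)]
  have A: "subring A F" by (rule ap(1))
  have noeth: "noetherian_ring (sub A)" unfolding assms(13)
    by (rule affine_component_noetherian[OF D Ji _ assms(7) _ GD(1) b]) (use assms(4) in \<open>auto simp: regular_local_ring_def\<close>)
  have aJ: "a i \<in> J" "a i \<noteq> \<zero>\<^bsub>F\<^esub>" if "i \<le> n" for i
    using genideal_subE(2)[OF D GD(1)] assms(6,7) that by auto
  let ?C = "\<lambda>i. affine_component F D J (a i)"
  have Ci: "subring (?C i) F" if "i \<le> n" for i by (rule affine_component_props(1)[OF D Ji aJ[OF that]])
  have zero_in: "\<zero>\<^bsub>F\<^esub> \<in> P" if "subring S F" "primeideal P (sub S)" for P S
    using ideal_subD(4)[OF that(1) primeideal_subD(1)[OF that]] .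
  have locA: "localization_at F S P = ext S P S" if "subring S F" "primeideal P (sub S)" for P S
    by (rule localization_at_eq_ext[OF that(1) zero_in[OF that]])
  have V: "V = {ext (?C i) p (?C i) | i p. i \<le> n \<and> primeideal p (sub (?C i))}" (is "_ = ?V")
  proof -
    have "V = {localization_at F (?C i) p | i p. i \<le> n \<and> primeideal p (sub (?C i))}"
      unfolding assms(9) proj_model_def Let_def assms(7) by simp
    also have "\<dots> = ?V" using locA[OF Ci] by (metis (no_types, lifting))
    finally show ?thesis .
  qed
  have inV: "ext A P A \<in> V" if P: "primeideal P (sub A)" for P
  proof -
    obtain c p where "c \<in> ?G" "primeideal p (sub (affine_component F D J c))"
      "ext (affine_component F D J c) p (affine_component F D J c) = ext A P A"
      using chart_containing_prime[OF D Ji assms(7) GD b P[unfolded assms(13)]] unfolding assms(13) by metis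
    then show ?thesis unfolding V by auto
  qed
  have reg: "regular_local_ring (sub (ext A P A))" if "primeideal P (sub A)" for P
    using inV[OF that] assms(10) by (auto simp: nonsingular_model_def)
  obtain x y where xy: "two_generated_local F D x y"
    by (rule two_generated_local_if_regular[OF D assms(4,5)])
  then interpret D: two_generated_local F D x y .
  have J_max: "J \<subseteq> max_ideal (sub D)" "max_ideal (sub D) \<subseteq> ideal_radical (sub D) J"
  proof -
    have "J \<noteq> D" using assms(8) by (simp add: primary_to_def)
    then have "\<one>\<^bsub>F\<^esub> \<notin> J" using ideal.one_imp_carrier[OF Ji] by auto
    then show "J \<subseteq> max_ideal (sub D)" using local_ring_max_ideal(4)[OF D.D(1,2) Ji] by simp
    show "max_ideal (sub D) \<subseteq> ideal_radical (sub D) J" using assms(8) by (simp add: primary_to_def)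
  qed
  have pow: "\<exists>k::nat. z [^]\<^bsub>F\<^esub> k \<in> J" if "z \<in> max_ideal (sub D)" for z
    using subsetD[OF J_max(2) that] by (simp add: ideal_radical_def sub_nat_pow)
  obtain k l where kl: "x [^]\<^bsub>F\<^esub> (k::nat) \<in> J" "y [^]\<^bsub>F\<^esub> (l::nat) \<in> J"
    using pow D.xy_max by blast
  \<comment> \<open>\<open>J A = b A\<close>: an element of \<open>J\<close> is \<open>b\<close>
    times its quotient by \<open>b\<close>, which is in \<open>A\<close>.\<close>
  have pw: "\<exists>u\<in>A. z \<otimes>\<^bsub>F\<^esub> w = b \<otimes>\<^bsub>F\<^esub> u" if "z \<in> J" "w \<in> D" for z w
  proof -
    have zw: "z \<otimes>\<^bsub>F\<^esub> w \<in> J" using j(7) that by simp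
    have cr: "b \<in> carrier F" "z \<otimes>\<^bsub>F\<^esub> w \<in> carrier F" using j(3) zw b by auto
    have "b \<otimes>\<^bsub>F\<^esub> ((z \<otimes>\<^bsub>F\<^esub> w) \<otimes>\<^bsub>F\<^esub> inv\<^bsub>F\<^esub> b) = z \<otimes>\<^bsub>F\<^esub> w"
      using eq_mult_inv_iff[of "(z \<otimes>\<^bsub>F\<^esub> w) \<otimes>\<^bsub>F\<^esub> inv\<^bsub>F\<^esub> b" "z \<otimes>\<^bsub>F\<^esub> w" b] cr b field_inv(1)[of b] by simp
    then show ?thesis using ap(3)[OF zw] by metis
  qed
  \<comment> \<open>The locale wants one exponent for both parameters. As \<open>x [^] k\<close> and
    \<open>y [^] l\<close> are in \<open>J\<close>, the sum \<open>k + l\<close> serves for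
    both.\<close>
  interpret chart: affine_chart F D x y A b "k + l"
  proof (rule affine_chart.intro[OF xy affine_chart_axioms.intro])
    show "krull_dim (sub D) = 2" by fact
    show "subring A F" "D \<subseteq> A" by (rule ap)+
    show "b \<in> max_ideal (sub D)" using J_max b by auto
    show "b \<noteq> \<zero>\<^bsub>F\<^esub>" by fact
    show "\<exists>r::nat. b [^]\<^bsub>F\<^esub> r \<otimes>\<^bsub>F\<^esub> z \<in> D" if "z \<in> A" for z
      by (rule affine_component_denominator[OF D Ji b]) (use that assms(13) in simp)
    show "\<exists>u\<in>A. x [^]\<^bsub>F\<^esub> (k + l) = b \<otimes>\<^bsub>F\<^esub> u"
      using pw[OF kl(1), of "x [^]\<^bsub>F\<^esub> l"] by (simp add: nat_pow_mult)
    show "\<exists>u\<in>A. y [^]\<^bsub>F\<^esub> (k + l) = b \<otimes>\<^bsub>F\<^esub> u"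
      using pw[OF kl(2), of "y [^]\<^bsub>F\<^esub> k"] by (simp add: nat_pow_mult add.commute)
  qed
  have frac: "\<exists>s\<in>D. s \<noteq> \<zero>\<^bsub>F\<^esub> \<and> (\<exists>d\<in>D. f = d \<otimes>\<^bsub>F\<^esub> inv\<^bsub>F\<^esub> s)" if "f \<in> carrier F" for f
    using that assms(3) unfolding quotient_field_def localization_def by blast
  interpret surf: regular_surface F A
  proof (rule regular_surface.intro[OF field_axioms regular_surface_axioms.intro])
    show "subring A F" by (rule A)
    show "noetherian_ring (sub A)" by (rule noeth)
    show "\<exists>a\<in>A. a \<noteq> \<zero>\<^bsub>F\<^esub> \<and> a \<otimes>\<^bsub>F\<^esub> f \<in> A" if f: "f \<in> carrier F" for f
    proof -
      obtain s d where s: "s \<in> D" "s \<noteq> \<zero>\<^bsub>F\<^esub>" "d \<in> D" "f = d \<otimes>\<^bsub>F\<^esub> inv\<^bsub>F\<^esub> s" using frac[OF f] by auto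
      then have "s \<otimes>\<^bsub>F\<^esub> f = d" using eq_mult_inv_iff[of f d s] f by simp
      moreover have "s \<in> A" "d \<in> A" using s(1,3) ap(2) by auto
      ultimately show ?thesis using s(2) by metis
    qed
    show False if "primeideal P1 (sub A)" "primeideal P2 (sub A)" "primeideal P3 (sub A)"
      "P1 \<noteq> {\<zero>\<^bsub>F\<^esub>}" "P1 \<subset> P2" "P2 \<subset> P3" for P1 P2 P3
      by (rule chart.prime_chain_bound[OF that])
    show "regular_local_ring (sub (ext A P A))" if "primeideal P (sub A)" for P by (rule reg[OF that])
  qed
  have in_U: "ext A M A \<in> U" if M: "M \<in> surf.surface_points" for M
  proof -
    note m = surf.surface_pointD[OF M]
    have "krull_dim (sub (ext A M A)) = 2" using height_eq_krull_dim[OF A m(2)] m(3) by simp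
    then show ?thesis unfolding assms(14) closed_points_def
      using inV[OF m(2)] ext_subring(2)[OF A m(2)] by simp
  qed
  \<comment> \<open>A closed point containing \<open>A\<close> is given as a local ring of some
    chart \<open>?C i\<close>. Passing from that chart to the one of \<open>b\<close> exhibits it as
    a localization of \<open>A\<close>, and its dimension is the height of the prime, which is
    therefore maximal.\<close>
  have U_sub: "\<exists>M\<in>surf.surface_points. \<alpha> = ext A M A" if \<alpha>: "\<alpha> \<in> U" for \<alpha>
  proof -
    have al: "\<alpha> \<in> V" "krull_dim (sub \<alpha>) = 2" "A \<subseteq> \<alpha>" using \<alpha> unfolding assms(14) closed_points_def by auto
    then obtain i p where ip: "i \<le> n" "primeideal p (sub (?C i))" "\<alpha> = ext (?C i) p (?C i)" unfolding V by auto
    obtain M where M: "primeideal M (sub A)" "ext A M A = \<alpha>"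
      using chart_change[OF D Ji aJ[OF ip(1)] b ip(2)] al(3) ip(3) unfolding assms(13) by metis
    have "height (sub A) M = 2" using height_eq_krull_dim[OF A M(1)] M(2) al(2) by simp
    then have "M \<in> surf.surface_points" using surf.height_2D(1)[OF M(1)] by (simp add: surf.surface_points_def)
    then show ?thesis using M(2) by auto
  qed
  have U: "U = {ext A M A | M. M \<in> surf.surface_points}" using in_U U_sub by blast
  have Bh: "B = surf.points_ring" unfolding assms(15) intersection_ring_def surf.points_ring_def U ..
  have B: "subring B F" "A \<subseteq> B" unfolding Bh by (rule surf.points_ring_subring)+
  have gen: "genideal (sub (localization_at F A M)) M \<inter> B = ext A M M \<inter> B" if "M \<in> surf.surface_points" for M
    using locA[OF A surf.surface_pointD(2)[OF that]] ext_genideal[OF A surf.surface_pointD(2)[OF that]] by simp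
  have locB: "localization_at F B (ext A M M \<inter> B) = ext A M A" if "M \<in> surf.surface_points" for M
    using locA[OF surf.points_ring_subring(1) surf.surface_point_prime(1)[OF that]] surf.surface_point_prime(3)[OF that]
    unfolding Bh by simp
  show ?thesis
  proof (intro conjI)
    show "regular_domain F A" unfolding regular_domain_def
      using subring_is_domain[OF A] noeth reg locA[OF A] by simp
    show "\<forall>\<alpha>\<in>U. \<exists>M. maximalideal M (sub A) \<and> height (sub A) M = 2 \<and> \<alpha> = localization_at F A M"
      using U_sub surf.surface_pointD locA[OF A] by metis
    show "\<forall>M. maximalideal M (sub A) \<and> height (sub A) M = 2 \<longrightarrow>
        localization_at F A M \<in> U \<and>
        localization_at F A M = localization_at F B (genideal (sub (localization_at F A M)) M \<inter> B)"
    proof (intro allI impI)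
      fix M assume "maximalideal M (sub A) \<and> height (sub A) M = 2"
      then have M: "M \<in> surf.surface_points" by (simp add: surf.surface_points_def)
      show "localization_at F A M \<in> U \<and>
        localization_at F A M = localization_at F B (genideal (sub (localization_at F A M)) M \<inter> B)"
        unfolding gen[OF M] locB[OF M] using in_U[OF M] locA[OF A surf.surface_pointD(2)[OF M]] by simp
    qed
    show "essential_representation F U" unfolding essential_representation_def is_localization_of_def
    proof
      fix \<alpha> assume "\<alpha> \<in> U"
      then obtain M where M: "M \<in> surf.surface_points" "\<alpha> = ext A M A" using U_sub by blast
      let ?q = "ext A M M \<inter> B"
      have q: "primeideal ?q (sub B)" using surf.surface_point_prime(1)[OF M(1)] unfolding Bh .
      note p = primeideal_subD[OF B(1) q]
      have "submonoid (B - ?q) (sub B)"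
      proof
        show "B - ?q \<subseteq> carrier (sub B)" by auto
        show "s \<otimes>\<^bsub>sub B\<^esub> t \<in> B - ?q" if "s \<in> B - ?q" "t \<in> B - ?q" for s t
          using prime_complement_mult[OF B(1) q, of s t] that by auto
        show "\<one>\<^bsub>sub B\<^esub> \<in> B - ?q" using p(2) subring_closed(3)[OF B(1)] by simp
      qed
      moreover have "\<zero>\<^bsub>F\<^esub> \<notin> B - ?q" using zero_in[OF B(1) q] by simp
      moreover have "\<alpha> = localization F B (B - ?q)" using locB[OF M(1)] M(2) by (simp add: localization_at_def)
      ultimately show "\<exists>S. submonoid S (sub (intersection_ring F U)) \<and> \<zero>\<^bsub>F\<^esub> \<notin> S \<and> \<alpha> = localization F (intersection_ring F U) S"
        unfolding assms(15)[symmetric] by blast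
    qed
    show "U \<noteq> {} \<longrightarrow> (\<forall>q. maximalideal q (sub B) \<longrightarrow>
        height (sub B) q = 2 \<and> localization_at F B q = localization_at F A (q \<inter> A))"
    proof (intro impI allI)
      fix q assume "U \<noteq> {}" and q: "maximalideal q (sub B)"
      then have ne: "surf.surface_points \<noteq> {}" using U by auto
      have qp: "primeideal q (sub B)" by (rule maximal_sub_prime[OF B(1) q])
      have P: "primeideal (q \<inter> A) (sub A)" by (rule prime_contract[OF A B qp])
      show "height (sub B) q = 2 \<and> localization_at F B q = localization_at F A (q \<inter> A)"
        using surf.points_ring_maximal(2)[OF ne q[unfolded Bh]] surf.points_ring_localization[OF qp[unfolded Bh]]
          locA[OF B(1) qp] locA[OF A P] unfolding Bh by simp
    qed
    show "overring F A B" unfolding overring_def quotient_field_def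
    proof (intro conjI B subsetI)
      fix f assume "f \<in> B"
      then have "f \<in> carrier F" using subring_closed(1)[OF B(1)] by simp
      then show "f \<in> localization F A (A - {\<zero>\<^bsub>F\<^esub>})"
        using frac[of f] ap(2) unfolding localization_def by blast
    qed
    interpret ex: subring_extension F A B
      by (rule subring_extension.intro[OF field_axioms subring_extension_axioms.intro[OF A B]])
    show "flat_module TYPE('n) TYPE('k) (sub A) (subset_module F B)"
      by (rule ex.flat_if_locally_localization) (use surf.points_ring_denominator[folded Bh] in blast)
  qed
qed

end
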